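(* For all $d\in\mathbb N$ and $n\ge d+1$, $$ \mathbb E\,\alpha(C_n)=\frac{\mathbb E\,\sigma_d(C_n\cap\mathbb S^d_+)}{\omega_{d+1}}=\frac{n!}{2\pi^n}\sum_{\substack{m\in\{d+2,\ldots,n+1\}\\ m\equiv d\ (\mathrm{mod}\ 2)}}B\{n+1,m\}\,(m-1)^2\,A[m-2,-1]. $$
   Context: $U_1,\ldots,U_n$ are independent random points distributed uniformly on the half-sphere $\mathbb S^d_+=\{x=(x_0,\ldots,x_d)\in\mathbb R^{d+1}:x_0\ge0,\ \|x\|=1\}$, and $C_n=\operatorname{pos}(U_1,\ldots,U_n)=\{\sum_{i=1}^n\lambda_iU_i:\lambda_1,\ldots,\lambda_n\ge0\}$. $\alpha(C_n)$ is the solid angle of the cone $C_n$ in $\mathbb R^{d+1}$, normalized so that the full-space solid angle is $1$. $\sigma_d$ is the $d$-dimensional surface measure on the unit sphere $\mathbb S^d\subset\mathbb R^{d+1}$, and $\omega_{d+1}=\sigma_d(\mathbb S^d)=2\pi^{(d+1)/2}/\Gamma(\frac{d+1}{2})$. Definition of $B\{n,k\}$ for $n\in\mathbb N$, $k\in\{1,\ldots,n\}$: $B\{n,k\}=\frac{1}{(k-1)!(n-k)!}\int_0^\pi(\sin x)^{k-1}x^{n-k}\,dx$. Definition of $A[n,k]$ for $n\in\mathbb N_0=\{0,1,2,\ldots\}$, $k\in\mathbb Z$: put $Q_0(x)=Q_1(x)=1$ and $Q_n(x)=\prod_{j\in\{1,\ldots,n-1\},\ j\not\equiv n\ (\mathrm{mod}\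 2)}(1+j^2x^2)$ for $n\ge2$. Then $A[n,k]=[x^k]Q_n(x)$ if $k$ is even; $A[n,k]=[x^k]\left(\tanh(\frac{\pi}{2x})Q_n(x)\right)$ if $k$ is odd and $n$ is even; $A[n,k]=[x^k]\left(\coth(\frac{\pi}{2x})Q_n(x)\right)$ if $k$ is odd and $n$ is odd. Here $[x^k]H(x)$ is the coefficient of $x^k$ in $H(x)$, a formal series in positive and negative powers of $x$; $\tanh(\pi/(2x))$ and $\coth(\pi/(2x))$ are expanded in powers of $1/x$ via the Laurent expansions of $\tanh y$ and $\coth y$ at $y=0$ with $y=\pi/(2x)$. *)

theory Defs
  imports "HOL-Probability.Probability" "HOL-Complex_Analysis.Complex_Analysis"
begin

text \<open>
  Surface measure on the unit sphere, as a Borel measure on the ambient space concentrated on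
  the sphere. It is given by polar coordinates: the surface area of a Borel set of directions is
  the dimension times the Lebesgue volume of the part of the unit ball lying in these directions
  (\<open>sgn x\<close> is \<open>x /\<^sub>R norm x\<close>). In dimension \<open>d + 1\<close> this is the \<open>d\<close>-dimensional surface measure
  in its usual, unnormalized scaling; see \<open>measure_sphere_measure_sphere\<close> below.
\<close>

definition sphere_measure :: "'a::euclidean_space measure" where
  "sphere_measure =
     scale_measure (of_nat DIM('a)) (distr (restrict_space lborel (cball 0 1)) borel sgn)"

definition omega :: "nat \<Rightarrow> real" where
  "omega k = 2 * pi powr (real k / 2) / Gamma (real k / 2)"

definition half_sphere :: "'i::finite \<Rightarrow> (real ^ 'i) set" where
  "half_sphere i0 = {x. x $ i0 \<ge> 0 \<and> norm x = 1}"

definition pos_span :: "nat \<Rightarrow> (nat \<Rightarrow> 'a::real_vector) \<Rightarrow> 'a set" where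
  "pos_span n u = {(\<Sum>i=1..n. l i *\<^sub>R u i) | l :: nat \<Rightarrow> real. \<forall>i\<in>{1..n}. l i \<ge> 0}"

definition solid_angle :: "'a::euclidean_space set \<Rightarrow> real" where
  "solid_angle C = measure sphere_measure (C \<inter> sphere 0 1) / measure sphere_measure (sphere 0 1 :: 'a set)"

text \<open>The numbers \<open>B{n,k}\<close>, meaningful for \<open>1 \<le> k \<le> n\<close>.\<close>

definition B_num :: "nat \<Rightarrow> nat \<Rightarrow> real" where
  "B_num n k =
     1 / (fact (k - 1) * fact (n - k)) * integral {0..pi} (\<lambda>x. sin x ^ (k - 1) * x ^ (n - k))"

text \<open>
  The series used to define \<open>A[n,k]\<close> have finitely many positive but infinitely many negative
  powers of \<open>x\<close>. We represent them as formal Laurent series in \<open>t = 1/x\<close>: the indeterminate \<open>x\<close> is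
  \<open>fls_X_inv\<close>, and the coefficient of \<open>x^k\<close> is the one with index \<open>-k\<close>.
  The product in \<open>Q_series\<close> is empty for \<open>n \<le> 1\<close>, which gives \<open>Q_0 = Q_1 = 1\<close>.
\<close>

definition Q_series :: "nat \<Rightarrow> complex fls" where
  "Q_series n = (\<Prod>j | j \<in> {1..<n} \<and> j mod 2 \<noteq> n mod 2. 1 + of_nat (j\<^sup>2) * fls_X_inv\<^sup>2)"

definition tanh_series :: "complex fls" where
  "tanh_series = laurent_expansion (\<lambda>t. tanh (of_real pi * t / 2)) 0"

definition coth_series :: "complex fls" where
  "coth_series = laurent_expansion (\<lambda>t. cosh (of_real pi * t / 2) / sinh (of_real pi * t / 2)) 0"

text \<open>
  The library's Laurent expansions are over the complex numbers; all coefficients involved are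
  real, so that \<open>Re\<close> is only a change of type.
\<close>

definition A_num :: "nat \<Rightarrow> int \<Rightarrow> real" where
  "A_num n k = Re (fls_nth
     (if even k then Q_series n
      else if even n then tanh_series * Q_series n
      else coth_series * Q_series n) (- k))"

lemma sets_sphere_measure [simp, measurable_cong]: "sets sphere_measure = sets borel"
  by (simp add: sphere_measure_def)

lemma measure_sphere_measure:
  assumes "A \<in> sets borel"
  shows "measure (sphere_measure :: 'a::euclidean_space measure) A =
           DIM('a) * measure lborel {x \<in> cball 0 1. sgn x \<in> A}"
proof -
  have sgn [measurable]: "(sgn :: 'a \<Rightarrow> 'a) \<in> borel_measurable borel"
    unfolding sgn_div_norm by measurable
  have m: "(sgn :: 'a \<Rightarrow> 'a) \<in> measurable (restrict_space lborel (cball 0 1)) borel"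
    by (rule measurable_restrict_space1) simp
  have eq: "sgn -` A \<inter> space (restrict_space lborel (cball 0 1)) = {x \<in> cball 0 1. sgn x \<in> A}"
    by (auto simp: space_restrict_space)
  have "emeasure (sphere_measure :: 'a measure) A =
          of_nat DIM('a) * emeasure lborel {x \<in> cball 0 1. sgn x \<in> A}"
    unfolding sphere_measure_def emeasure_scale_measure emeasure_distr[OF m assms] eq
    by (subst emeasure_restrict_space) auto
  then show ?thesis
    by (simp add: measure_def enn2real_mult)
qed

lemma measure_sphere_measure_sphere:
  "measure sphere_measure (sphere 0 1 :: 'a::euclidean_space set) = omega DIM('a)"
proof -
  have "{x \<in> cball 0 1. sgn x \<in> sphere (0::'a) 1} = cball 0 1 - {0}"
    by (auto simp: norm_sgn)
  moreover have "measure lborel (cball (0::'a) 1 - {0}) = measure lborel (cball (0::'a) 1)"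
    by (intro measure_Diff_null_set) auto
  ultimately have "measure sphere_measure (sphere 0 1 :: 'a set) = DIM('a) * unit_ball_vol (DIM('a))"
    by (subst measure_sphere_measure) (auto simp: content_cball)
  also have "\<dots> = omega DIM('a)"
  proof -
    have "Gamma (real DIM('a) / 2 + 1) = real DIM('a) / 2 * Gamma (real DIM('a) / 2)"
      by (rule Gamma_plus1) (use DIM_positive[where 'a = 'a] in \<open>force dest: nonpos_Ints_nonpos\<close>)
    then show ?thesis
      unfolding omega_def unit_ball_vol_def by (simp only:) simp
  qed
  finally show ?thesis .
qed

end

theory Submission
  imports Defs
begin

text \<open>
  By Fubini, \<open>E \<sigma>(C \<inter> S)\<close> is half of \<open>\<omega>\<close> times the probability \<open>p n d\<close> that one further
  uniform point \<open>U 0\<close> lies in \<open>pos(U 1, ..., U n)\<close>. Directions of Gaussian vectors with a positive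
  first coordinate are uniform on the half-sphere. Subtracting from each such vector the multiple
  of the vector number \<open>0\<close> that cancels its first coordinate (\<open>cols\<close>) turns the event into:
  \<open>0\<close> is a nontrivial nonnegative combination of \<open>n\<close> vectors in dimension \<open>d\<close>. All dimensions
  live on one array of Gaussians.

  Let \<open>G k\<close> be the event that a nonnegative combination vanishes in the rows \<open>1, ..., k - 1\<close> and is
  positive in row \<open>k\<close>. Linear programming and the reflection of row \<open>k\<close> give
  \<open>p n d + p n (d + 1) = 2 P(G (d + 1))\<close>, so that \<open>p n d - p n (d + 2)\<close> is twice the probability
  that \<open>G (d + 1)\<close> holds and \<open>G (d + 2)\<close> fails. In that case a linear program in \<open>n\<close> variables is
  bounded, and almost surely it has exactly one optimal basis, of size \<open>k = d + 1\<close>. Integrating out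
  the Gaussians shows that a given basis is optimal with probability \<open>c k * \<pi>^(k - n)\<close> times the
  integral of \<open>sin(x)^k x^(n - k)\<close> over \<open>[0, \<pi>]\<close>, which is where \<open>B{n + 1, k + 1}\<close> comes from.

  The constants \<open>c k\<close> need not be computed. Since \<open>p n 0 = 1\<close> and \<open>p n 1 = (n - 1) / (n + 1)\<close>,
  they solve two triangular linear systems; the generating functions of \<open>B{n + 1, k + 1}\<close> satisfy
  a two-step recursion in \<open>k\<close>, and reading off coefficients after clearing denominators yields
  \<open>2 * c k * \<pi>^k = k^2 * A[k - 1, -1]\<close>.
\<close>

section \<open>Optimal bases of a generic system of columns\<close>

text \<open>That the probability of an optimal basis splits into a constant and an integral rests on
  two cancellations. Given the vectors number 0 to k, every other reduced column is tested against
  one dual functional, independently of the rest, and passes with probability an angle over pi: this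
  angle is the x of the integral, and n - k columns give its power. The functional annihilates the
  basis columns. When the square in the other coordinates of vector number 0 is completed, its
  centre is a combination of basis columns and drops out, so that the angle depends on a standard
  normal variable divided by the norm of the first k + 1 heights and on nothing else. The remaining
  weight is homogeneous of degree 0 in the heights, hence a rescaling separates the two and yields
  the power of the sine.

  So there is one unknown per k and, within a parity class of k, one equation per n. Both classes
  need a starting value because taking differences of the two-term relations moves the dimension by
  2.

  Genericity is imposed on leading rows and on all sets of columns at once: outside one null set,
  weak and strict forms of all conditions on the programs agree in every dimension.\<close>

lemma homogeneous_system_nontrivial:
  fixes D :: "'a \<Rightarrow> 'b \<Rightarrow> real"
  assumes "finite R" "finite I" "card R < card I"
  shows "\<exists>x. (\<exists>i\<in>I. x i \<noteq> 0) \<and> (\<forall>j\<in>R. (\<Sum>i\<in>I. x i * D i j) = 0)"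
  using assms
proof (induction R arbitrary: I D rule: finite_induct)
  case empty
  then have "I \<noteq> {}" by auto
  then show ?case by (intro exI[of _ "\<lambda>_. 1"]) auto
next
  case (insert r R)
  show ?case
  proof (cases "\<forall>i\<in>I. D i r = 0")
    case True
    from insert obtain x where "\<exists>i\<in>I. x i \<noteq> 0" "\<forall>j\<in>R. (\<Sum>i\<in>I. x i * D i j) = 0"
      by (metis card_insert_disjoint less_SucI Suc_lessD)
    then show ?thesis using True by (intro exI[of _ x]) auto
  next
    case False
    then obtain a where a: "a \<in> I" "D a r \<noteq> 0" by blast
    \<comment> \<open>Elimination with pivot \<open>D a r\<close>: row \<open>r\<close> is cleared
      in all other columns, and \<open>s\<close> below is the coefficient of column \<open>a\<close>
      that makes row \<open>r\<close> of the original system vanish.\<close>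
    define D' where "D' = (\<lambda>i j. D i j - D i r / D a r * D a j)"
    have "finite (I - {a})" "card R < card (I - {a})"
      using insert.prems insert.hyps a by auto
    from insert.IH[OF this, of D'] obtain x where
      x: "\<exists>i\<in>I - {a}. x i \<noteq> 0" "\<forall>j\<in>R. (\<Sum>i\<in>I - {a}. x i * D' i j) = 0" by blast
    define s where "s = - (\<Sum>i\<in>I - {a}. x i * D i r) / D a r"
    define y where "y = x(a := s)"
    have eq: "(\<Sum>i\<in>I. y i * D i j) = (\<Sum>i\<in>I - {a}. x i * D' i j)" for j
    proof -
      have "(\<Sum>i\<in>I. y i * D i j) = s * D a j + (\<Sum>i\<in>I - {a}. x i * D i j)"
        using insert.prems a by (subst sum.remove[of _ a]) (auto simp: y_def intro!: sum.cong)
      also have "s * D a j = - (\<Sum>i\<in>I - {a}. x i * (D i r / D a r * D a j))"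
        by (simp add: s_def sum_divide_distrib sum_distrib_right mult.assoc)
      finally show ?thesis
        by (simp add: D'_def right_diff_distrib sum_subtractf)
    qed
    have "(\<Sum>i\<in>I - {a}. x i * D' i r) = 0"
      using a by (simp add: D'_def)
    with x eq have "\<forall>j\<in>insert r R. (\<Sum>i\<in>I. y i * D i j) = 0" by auto
    moreover have "\<exists>i\<in>I. y i \<noteq> 0" using x by (auto simp: y_def)
    ultimately show ?thesis by blast
  qed
qed

text \<open>Adjoining \<open>b\<close> as an extra column leaves more unknowns than equations.
  Injectivity on the old columns forces the coefficient of \<open>b\<close> in a nontrivial solution
  to be nonzero, so one can divide by it.\<close>

lemma square_system_solvable:
  fixes D :: "'a \<Rightarrow> 'b \<Rightarrow> real"
  assumes "finite R" "finite I" "card R = card I"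
    and inj: "\<And>x. \<forall>j\<in>R. (\<Sum>i\<in>I. x i * D i j) = 0 \<Longrightarrow> \<forall>i\<in>I. x i = 0"
  shows "\<exists>x. \<forall>j\<in>R. (\<Sum>i\<in>I. x i * D i j) = b j"
proof -
  define D' where "D' = (\<lambda>i j. case i of None \<Rightarrow> b j | Some i \<Rightarrow> D i j)"
  have sum_eq: "(\<Sum>i\<in>insert None (Some ` I). x i * D' i j) = x None * b j + (\<Sum>i\<in>I. x (Some i) * D i j)"
    for x j using assms(2) by (simp add: sum.reindex D'_def)
  have "card R < card (insert None (Some ` I))"
    using assms by (simp add: card_image)
  from homogeneous_system_nontrivial[OF assms(1) _ this, of D'] assms(2) obtain x where
    x: "\<exists>i\<in>insert None (Some ` I). x i \<noteq> 0"
       "\<forall>j\<in>R. x None * b j + (\<Sum>i\<in>I. x (Some i) * D i j) = 0"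
    unfolding sum_eq by blast
  have "x None \<noteq> 0"
  proof
    assume "x None = 0"
    with x(2) inj[of "\<lambda>i. x (Some i)"] have "\<forall>i\<in>I. x (Some i) = 0" by simp
    with \<open>x None = 0\<close> x(1) show False by auto
  qed
  have "(\<Sum>i\<in>I. (- x (Some i) / x None) * D i j) = b j" if "j \<in> R" for j
  proof -
    have "(\<Sum>i\<in>I. (- x (Some i) / x None) * D i j) = - (\<Sum>i\<in>I. x (Some i) * D i j) / x None"
      by (simp add: sum_divide_distrib sum_negf)
    also have "\<dots> = b j" using x(2) that \<open>x None \<noteq> 0\<close> by (auto simp: field_simps add_eq_0_iff)
    finally show ?thesis .
  qed
  then show ?thesis by (intro exI[of _ "\<lambda>i. - x (Some i) / x None"]) blast
qed

text \<open>The transposed system is injective as well: a vector \<open>c\<close> that it kills is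
  itself a combination of the columns, and pairing \<open>c\<close> with that combination makes its
  sum of squares vanish.\<close>

lemma transposed_system_solvable:
  fixes D :: "'a \<Rightarrow> 'b \<Rightarrow> real"
  assumes "finite R" "finite I" "card R = card I"
    and inj: "\<And>x. \<forall>j\<in>R. (\<Sum>i\<in>I. x i * D i j) = 0 \<Longrightarrow> \<forall>i\<in>I. x i = 0"
  shows "\<exists>c. \<forall>i\<in>I. (\<Sum>j\<in>R. c j * D i j) = w i"
proof -
  have "\<forall>j\<in>R. c j = 0" if c: "\<forall>i\<in>I. (\<Sum>j\<in>R. c j * D i j) = 0" for c
  proof -
  obtain x where x: "\<forall>j\<in>R. (\<Sum>i\<in>I. x i * D i j) = c j"
    using square_system_solvable[OF assms(1-3) inj, where b = c] by blast
  have "(\<Sum>j\<in>R. c j * c j) = (\<Sum>j\<in>R. c j * (\<Sum>i\<in>I. x i * D i j))"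
    using x by (auto intro!: sum.cong)
  also have "\<dots> = (\<Sum>i\<in>I. x i * (\<Sum>j\<in>R. c j * D i j))"
    by (subst sum_distrib_left, subst sum.swap) (simp add: sum_distrib_left mult_ac)
  also have "\<dots> = 0" using c by simp
  finally have "\<forall>j\<in>R. c j * c j = 0"
    using assms(1) by (subst (asm) sum_nonneg_eq_0_iff) auto
  then show "\<forall>j\<in>R. c j = 0" by simp
  qed
  from square_system_solvable[of I R "\<lambda>j i. D i j", OF assms(2,1) assms(3)[symmetric] this] show ?thesis
    by simp
qed

section \<open>The linear programs of an array of columns\<close>

definition comb :: "nat \<Rightarrow> (nat \<Rightarrow> nat \<Rightarrow> real) \<Rightarrow> (nat \<Rightarrow> real) \<Rightarrow> nat \<Rightarrow> real" where
  "comb n D x j = (\<Sum>i\<in>{1..n}. x i * D i j)"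

text \<open>Nonsingularity of a square block. The rows are always the leading ones because the
  programs of all dimensions read the same array from the top.\<close>

definition indep_cols :: "(nat \<Rightarrow> nat \<Rightarrow> real) \<Rightarrow> nat set \<Rightarrow> bool" where
  "indep_cols D I \<longleftrightarrow>
     (\<forall>x. (\<forall>j\<in>{1..card I}. (\<Sum>i\<in>I. x i * D i j) = 0) \<longrightarrow> (\<forall>i\<in>I. x i = 0))"

definition generic :: "nat \<Rightarrow> (nat \<Rightarrow> nat \<Rightarrow> real) \<Rightarrow> bool" where
  "generic n D \<longleftrightarrow> (\<forall>I\<subseteq>{1..n}. indep_cols D I)"

definition feas_zero :: "nat \<Rightarrow> nat \<Rightarrow> (nat \<Rightarrow> nat \<Rightarrow> real) \<Rightarrow> bool" where
  "feas_zero n d D \<longleftrightarrow> (\<exists>x. (\<forall>i\<in>{1..n}. x i \<ge> 0) \<and> (\<exists>i\<in>{1..n}. x i > 0) \<and>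
     (\<forall>j\<in>{1..d}. comb n D x j = 0))"

definition feas_pos :: "nat \<Rightarrow> nat \<Rightarrow> (nat \<Rightarrow> nat \<Rightarrow> real) \<Rightarrow> bool" where
  "feas_pos n k D \<longleftrightarrow> (\<exists>x. (\<forall>i\<in>{1..n}. x i \<ge> 0) \<and>
     (\<forall>j\<in>{1..<k}. comb n D x j = 0) \<and> comb n D x k > 0)"

definition feas_neg :: "nat \<Rightarrow> nat \<Rightarrow> (nat \<Rightarrow> nat \<Rightarrow> real) \<Rightarrow> bool" where
  "feas_neg n k D \<longleftrightarrow> (\<exists>x. (\<forall>i\<in>{1..n}. x i \<ge> 0) \<and>
     (\<forall>j\<in>{1..<k}. comb n D x j = 0) \<and> comb n D x k < 0)"

text \<open>With \<open>k = card I\<close>, the program maximises row \<open>k + 1\<close> over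
  nonnegative \<open>x\<close> whose rows below \<open>k\<close> are zero and whose row
  \<open>k\<close> is 1; the 1 normalises the strict inequality of \<open>feas_pos\<close>. Here the
  basic solution of \<open>I\<close> has to be strictly positive.\<close>

definition primal :: "(nat \<Rightarrow> nat \<Rightarrow> real) \<Rightarrow> nat set \<Rightarrow> bool" where
  "primal D I \<longleftrightarrow> (\<exists>x. (\<forall>i\<in>I. x i > 0) \<and>
     (\<forall>j\<in>{1..card I}. (\<Sum>i\<in>I. x i * D i j) = (if j = card I then 1 else 0)))"

text \<open>The entry -1 belongs to the objective row, so the value of the functional at a column
  outside \<open>I\<close> is minus its reduced cost. Strict signs leave room for one optimal basis
  only.\<close>

definition dual :: "nat \<Rightarrow> (nat \<Rightarrow> nat \<Rightarrow> real) \<Rightarrow> nat set \<Rightarrow> bool" where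
  "dual n D I \<longleftrightarrow> (\<exists>c. c (Suc (card I)) = - 1 \<and>
     (\<forall>i\<in>I. (\<Sum>j\<in>{1..Suc (card I)}. c j * D i j) = 0) \<and>
     (\<forall>i\<in>{1..n} - I. (\<Sum>j\<in>{1..Suc (card I)}. c j * D i j) > 0))"

definition optimal :: "nat \<Rightarrow> (nat \<Rightarrow> nat \<Rightarrow> real) \<Rightarrow> nat set \<Rightarrow> bool" where
  "optimal n D I \<longleftrightarrow> indep_cols D I \<and> primal D I \<and> dual n D I"

lemma indep_colsD:
  "indep_cols D I \<Longrightarrow> (\<And>j. j \<in> {1..card I} \<Longrightarrow> (\<Sum>i\<in>I. x i * D i j) = 0) \<Longrightarrow> i \<in> I \<Longrightarrow> x i = 0"
  unfolding indep_cols_def by blast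

lemma comb_add_scaled: "comb n D (\<lambda>i. x i + t * y i) j = comb n D x j + t * comb n D y j"
  by (simp add: comb_def distrib_right sum.distrib sum_distrib_left mult.assoc)

lemma comb_supported:
  assumes "I \<subseteq> {1..n}" "\<And>i. i \<in> {1..n} - I \<Longrightarrow> x i = 0"
  shows "comb n D x j = (\<Sum>i\<in>I. x i * D i j)"
  unfolding comb_def using assms by (intro sum.mono_neutral_right) auto

lemma comb_linear_form:
  "(\<Sum>i\<in>{1..n}. x i * (\<Sum>j\<in>J. c j * D i j)) = (\<Sum>j\<in>J. c j * comb n D x j)"
  unfolding comb_def
  by (simp only: sum_distrib_left, subst sum.swap) (simp add: mult_ac)

lemma finite_subset_atLeastAtMost: "I \<subseteq> {1..n::nat} \<Longrightarrow> finite I"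
  by (rule finite_subset) auto

lemma feas_pos_or_neg_imp_zero:
  assumes "feas_pos n (Suc d) D \<or> feas_neg n (Suc d) D"
  shows "feas_zero n d D"
proof -
  obtain x where x: "\<forall>i\<in>{1..n}. x i \<ge> 0" "\<forall>j\<in>{1..d}. comb n D x j = 0" "comb n D x (Suc d) \<noteq> 0"
    using assms unfolding feas_pos_def feas_neg_def atLeastLessThanSuc_atLeastAtMost by force
  have "\<exists>i\<in>{1..n}. x i > 0"
  proof (rule ccontr)
    assume "\<not> ?thesis"
    with x(1) have "\<forall>i\<in>{1..n}. x i = 0" by force
    then show False using x(3) by (simp add: comb_def)
  qed
  with x show ?thesis unfolding feas_zero_def by blast
qed

lemma feas_pos_and_neg_imp_zero:
  assumes "feas_pos n (Suc d) D" "feas_neg n (Suc d) D"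
  shows "feas_zero n (Suc d) D"
proof -
  obtain x where x: "\<forall>i\<in>{1..n}. x i \<ge> 0" "\<forall>j\<in>{1..d}. comb n D x j = 0" "comb n D x (Suc d) > 0"
    using assms unfolding feas_pos_def atLeastLessThanSuc_atLeastAtMost by force
  obtain y where y: "\<forall>i\<in>{1..n}. y i \<ge> 0" "\<forall>j\<in>{1..d}. comb n D y j = 0" "comb n D y (Suc d) < 0"
    using assms unfolding feas_neg_def atLeastLessThanSuc_atLeastAtMost by force
  \<comment> \<open>The weight that cancels row \<open>Suc d\<close>. Both vectors are nonnegative,
    so a vanishing mixture would force \<open>x\<close> to vanish.\<close>
  define t where "t = comb n D x (Suc d) / (- comb n D y (Suc d))"
  have t: "t > 0" using x y by (simp add: t_def divide_pos_neg)
  define z where "z = (\<lambda>i. x i + t * y i)"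
  have z0: "\<forall>i\<in>{1..n}. z i \<ge> 0" using x y t by (simp add: z_def)
  have "\<exists>i\<in>{1..n}. z i > 0"
  proof (rule ccontr)
    assume "\<not> ?thesis"
    with z0 have z: "z i = 0" if "i \<in> {1..n}" for i using that by force
    have "x i = 0" if "i \<in> {1..n}" for i
      using z[OF that] x(1) y(1) t that unfolding z_def
      by (metis add_nonneg_eq_0_iff mult_nonneg_nonneg less_imp_le)
    then show False using x(3) by (simp add: comb_def)
  qed
  moreover have "comb n D z j = 0" if "j \<in> {1..Suc d}" for j
    using that x(2,3) y(2,3) unfolding z_def comb_add_scaled
    by (cases "j = Suc d") (auto simp: t_def)
  ultimately show ?thesis using z0 unfolding feas_zero_def by blast
qed

lemma exists_small_step:
  fixes x y :: "'a \<Rightarrow> real"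
  assumes "finite I" "\<And>i. i \<in> I \<Longrightarrow> x i > 0"
  shows "\<exists>t>0. \<forall>i\<in>I. x i + t * y i > 0 \<and> x i - t * y i > 0"
  using assms
proof (induction I rule: finite_induct)
  case empty show ?case by (intro exI[of _ 1]) auto
next
  case (insert a I)
  then obtain t where t: "t > 0" "\<forall>i\<in>I. x i + t * y i > 0 \<and> x i - t * y i > 0" by auto
  \<comment> \<open>The summand 1 avoids division by zero and keeps the step strictly too short to
    bring entry \<open>a\<close> down to 0.\<close>
  define s where "s = min t (x a / (\<bar>y a\<bar> + 1))"
  have xa: "x a > 0" using insert by auto
  have s: "s > 0" "s \<le> t" using t xa by (auto simp: s_def add_nonneg_pos)
  have "s * \<bar>y a\<bar> < x a"
  proof -
    have "s * \<bar>y a\<bar> \<le> x a / (\<bar>y a\<bar> + 1) * \<bar>y a\<bar>" by (intro mult_right_mono) (auto simp: s_def)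
    also have "\<dots> < x a" using xa by (auto simp: field_simps)
    finally show ?thesis .
  qed
  moreover have "\<bar>s * y a\<bar> = s * \<bar>y a\<bar>" using s by (simp add: abs_mult)
  ultimately have "x a + s * y a > 0 \<and> x a - s * y a > 0" by linarith
  moreover have "x i + s * y i > 0 \<and> x i - s * y i > 0" if "i \<in> I" for i
  proof -
    have "t * \<bar>y i\<bar> < x i" using t that by (auto simp: abs_if not_less)
    moreover have "\<bar>s * y i\<bar> \<le> t * \<bar>y i\<bar>" using s by (simp add: abs_mult mult_right_mono)
    ultimately show ?thesis by linarith
  qed
  ultimately show ?case using s(1) by auto
qed

context
  fixes n :: nat and D :: "nat \<Rightarrow> nat \<Rightarrow> real"
  assumes gen: "generic n D"
begin

lemma generic_kernel_eq_0:
  assumes "I \<subseteq> {1..n}" "card I \<le> k" "\<And>j. j \<in> {1..k} \<Longrightarrow> (\<Sum>i\<in>I. x i * D i j) = 0" "i \<in> I"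
  shows "x i = 0"
  using gen assms by (intro indep_colsD[of D I x i]) (auto simp: generic_def)

text \<open>By genericity a solution is supported on more than \<open>Suc d\<close> columns, and a
  square block inside the support yields a direction that changes row \<open>Suc d\<close> alone
  among the first \<open>Suc d\<close> rows. On the support \<open>x\<close> is positive, so small
  steps both ways stay nonnegative.\<close>

lemma feas_zero_imp_pos_and_neg:
  assumes "feas_zero n (Suc d) D"
  shows "feas_pos n (Suc d) D \<and> feas_neg n (Suc d) D"
proof -
  obtain x where x: "\<forall>i\<in>{1..n}. x i \<ge> 0" "\<exists>i\<in>{1..n}. x i > 0" "\<forall>j\<in>{1..Suc d}. comb n D x j = 0"
    using assms unfolding feas_zero_def by blast
  define S where "S = {i\<in>{1..n}. x i > 0}"
  have S: "S \<subseteq> {1..n}" by (auto simp: S_def)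
  have cS: "comb n D x j = (\<Sum>i\<in>S. x i * D i j)" for j
    by (rule comb_supported) (use x in \<open>force simp: S_def\<close>)+
  have "Suc d < card S"
  proof (rule ccontr)
    assume "\<not> ?thesis"
    then have "x i = 0" if "i \<in> S" for i
      using that x(3) cS S by (intro generic_kernel_eq_0[of S "Suc d" x i]) auto
    then show False using x(2) by (force simp: S_def)
  qed
  then obtain I where I: "I \<subseteq> S" "card I = Suc d"
    by (meson less_imp_le obtain_subset_with_card_n)
  have fI: "finite I" "I \<subseteq> {1..n}" using I S finite_subset_atLeastAtMost by blast+
  obtain y where y: "\<forall>j\<in>{1..Suc d}. (\<Sum>i\<in>I. y i * D i j) = (if j = Suc d then 1 else 0)"
    using square_system_solvable[of "{1..Suc d}" I D "\<lambda>j. if j = Suc d then 1 else 0"]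
      generic_kernel_eq_0[of I "Suc d"] fI I by (auto simp: Ball_def)
  define z where "z = (\<lambda>i. if i \<in> I then y i else 0)"
  have cz: "comb n D z j = (if j = Suc d then 1 else 0)" if "j \<in> {1..Suc d}" for j
  proof -
    have "comb n D z j = (\<Sum>i\<in>I. z i * D i j)" by (rule comb_supported) (use fI in \<open>auto simp: z_def\<close>)
    also have "\<dots> = (\<Sum>i\<in>I. y i * D i j)" by (simp add: z_def)
    finally show ?thesis using y that by simp
  qed
  have "finite S" "\<And>i. i \<in> S \<Longrightarrow> x i > 0" by (auto simp: S_def)
  from exists_small_step[where x = x and y = z, OF this] obtain t where
    t: "t > 0" "\<forall>i\<in>S. x i + t * z i > 0 \<and> x i - t * z i > 0" by blast
  have nonneg: "x i + t * z i \<ge> 0 \<and> x i + (-t) * z i \<ge> 0" if "i \<in> {1..n}" for i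
  proof (cases "i \<in> S")
    case False
    then have "z i = 0" using I by (auto simp: z_def)
    with x that show ?thesis by auto
  next
    case True
    with t(2) show ?thesis by (metis less_imp_le minus_mult_left diff_conv_add_uminus)
  qed
  have "feas_pos n (Suc d) D" unfolding feas_pos_def
    by (rule exI[of _ "\<lambda>i. x i + t * z i"], unfold comb_add_scaled) (use nonneg x(3) cz t(1) in simp)
  moreover have "feas_neg n (Suc d) D" unfolding feas_neg_def
    by (rule exI[of _ "\<lambda>i. x i + (-t) * z i"], unfold comb_add_scaled) (use nonneg x(3) cz t(1) in simp)
  ultimately show ?thesis ..
qed

text \<open>A solution for \<open>d\<close> rows has some sign in row \<open>Suc d\<close>; if the
  value there is 0, it solves the problem for \<open>Suc d\<close> rows and can be moved to either
  sign.\<close>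

lemma feas_zero_iff_or: "feas_zero n d D \<longleftrightarrow> feas_pos n (Suc d) D \<or> feas_neg n (Suc d) D"
proof
  assume "feas_zero n d D"
  then obtain x where x: "\<forall>i\<in>{1..n}. x i \<ge> 0" "\<exists>i\<in>{1..n}. x i > 0" "\<forall>j\<in>{1..d}. comb n D x j = 0"
    unfolding feas_zero_def by blast
  consider "comb n D x (Suc d) = 0" | "comb n D x (Suc d) > 0" | "comb n D x (Suc d) < 0" by linarith
  then show "feas_pos n (Suc d) D \<or> feas_neg n (Suc d) D"
  proof cases
    case 1
    with x have "feas_zero n (Suc d) D" unfolding feas_zero_def
      by (intro exI[of _ x]) (auto simp: atLeastAtMostSuc_conv)
    then show ?thesis using feas_zero_imp_pos_and_neg by blast
  next
    case 2 with x show ?thesis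
      unfolding feas_pos_def atLeastLessThanSuc_atLeastAtMost by blast
  next
    case 3 with x show ?thesis
      unfolding feas_neg_def atLeastLessThanSuc_atLeastAtMost by blast
  qed
qed (rule feas_pos_or_neg_imp_zero)

lemma feas_zero_Suc_iff_and: "feas_zero n (Suc d) D \<longleftrightarrow> feas_pos n (Suc d) D \<and> feas_neg n (Suc d) D"
  using feas_zero_imp_pos_and_neg feas_pos_and_neg_imp_zero by blast

text \<open>A positive value in row \<open>k + 2\<close> gives \<open>feas_zero n (Suc k)\<close>,
  and this gives both signs in row \<open>k + 1\<close>.\<close>

lemma feas_pos_antimono:
  assumes "feas_pos n (Suc (Suc k)) D" shows "feas_pos n (Suc k) D"
  using assms feas_zero_iff_or feas_zero_Suc_iff_and by blast

lemma not_feas_zero: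
  assumes "n \<le> d" shows "\<not> feas_zero n d D"
proof
  assume "feas_zero n d D"
  then obtain x where x: "\<exists>i\<in>{1..n}. x i > 0" "\<forall>j\<in>{1..d}. comb n D x j = 0"
    unfolding feas_zero_def by blast
  then obtain i where i: "i \<in> {1..n}" "x i > 0" by blast
  have "x i = 0" using assms x i by (intro generic_kernel_eq_0[of "{1..n}" d x i]) (auto simp: comb_def)
  with i show False by simp
qed

text \<open>Moving along a kernel direction supported on a part of the support of \<open>x\<close> strictly raises
  the objective (the row \<open>Suc k\<close>) until the support shrinks; it must shrink, because the
  problem is bounded.\<close>

lemma improve_to_basis:
  assumes bounded: "\<not> feas_pos n (Suc k) D"
    and "\<forall>i\<in>{1..n}. x i \<ge> 0" "\<forall>j\<in>{1..k}. comb n D x j = b j" "card {i\<in>{1..n}. x i \<noteq> 0} \<ge> k"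
  shows "\<exists>y. (\<forall>i\<in>{1..n}. y i \<ge> 0) \<and> (\<forall>j\<in>{1..k}. comb n D y j = b j) \<and>
    card {i\<in>{1..n}. y i \<noteq> 0} \<le> k \<and> comb n D y (Suc k) \<ge> comb n D x (Suc k)"
  using assms(2-)
proof (induction "card {i\<in>{1..n}. x i \<noteq> 0}" arbitrary: x rule: less_induct)
  case less
  define S where "S = {i\<in>{1..n}. x i \<noteq> 0}"
  show ?case
  proof (cases "card S \<le> k")
    case True
    then show ?thesis using less.prems unfolding S_def by blast
  next
    case False
    then obtain I where I: "I \<subseteq> S" "card I = Suc k"
      by (metis not_le Suc_leI obtain_subset_with_card_n)
    have fI: "I \<subseteq> {1..n}" "finite I"
      using I finite_subset_atLeastAtMost[of I n] unfolding S_def by blast+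
    have "card {1..k} < card I" using I by simp
    from homogeneous_system_nontrivial[OF _ fI(2) this, of D] obtain y where
      y: "\<exists>i\<in>I. y i \<noteq> 0" "\<forall>j\<in>{1..k}. (\<Sum>i\<in>I. y i * D i j) = 0" by blast
    have y1: "(\<Sum>i\<in>I. y i * D i (Suc k)) \<noteq> 0"
    proof
      assume "(\<Sum>i\<in>I. y i * D i (Suc k)) = 0"
      with y(2) have "(\<Sum>i\<in>I. y i * D i j) = 0" if "j \<in> {1..Suc k}" for j
        using that by (cases "j = Suc k") auto
      with fI I have "y i = 0" if "i \<in> I" for i
        using that by (intro generic_kernel_eq_0[of I "Suc k" y i]) auto
      with y(1) show False by blast
    qed
    \<comment> \<open>The sign orients the kernel direction so that row \<open>Suc k\<close>
      increases along it.\<close>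
    define z where "z = (\<lambda>i. if i \<in> I then sgn (\<Sum>i\<in>I. y i * D i (Suc k)) * y i else 0)"
    have cz: "comb n D z j = sgn (\<Sum>i\<in>I. y i * D i (Suc k)) * (\<Sum>i\<in>I. y i * D i j)" for j
    proof -
      have "comb n D z j = (\<Sum>i\<in>I. z i * D i j)" by (rule comb_supported) (use fI in \<open>auto simp: z_def\<close>)
      also have "\<dots> = sgn (\<Sum>i\<in>I. y i * D i (Suc k)) * (\<Sum>i\<in>I. y i * D i j)"
        unfolding sum_distrib_left by (intro sum.cong) (simp_all add: z_def)
      finally show ?thesis .
    qed
    have z0: "\<forall>j\<in>{1..k}. comb n D z j = 0" using y by (simp add: cz)
    have zp: "comb n D z (Suc k) > 0" using y1 by (simp add: cz abs_sgn[symmetric] mult.commute)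
    have "\<exists>i\<in>{1..n}. z i < 0"
    proof (rule ccontr)
      assume "\<not> ?thesis"
      then have "feas_pos n (Suc k) D" using z0 zp unfolding feas_pos_def atLeastLessThanSuc_atLeastAtMost
        by (intro exI[of _ z]) (auto simp: not_less)
      with bounded show False by simp
    qed
    define N where "N = {i\<in>{1..n}. z i < 0}"
    have N: "finite N" "N \<noteq> {}" "N \<subseteq> I" using \<open>\<exists>i\<in>{1..n}. z i < 0\<close> by (auto simp: N_def z_def split: if_splits)
    \<comment> \<open>Ratio test: the longest step along \<open>z\<close> that keeps all entries
      nonnegative. An index attaining the minimum leaves the support.\<close>
    define t where "t = Min ((\<lambda>i. x i / (- z i)) ` N)"
    have xpos: "x i > 0" if "i \<in> S" for i using that less.prems(1) by (force simp: S_def)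
    have "t \<in> (\<lambda>i. x i / (- z i)) ` N" unfolding t_def using N by (intro Min_in) auto
    then obtain a where a: "a \<in> N" "t = x a / (- z a)" by blast
    have t: "t > 0" unfolding a(2) using a(1) N I xpos
      by (intro divide_pos_pos) (auto simp: N_def)
    have tle: "t \<le> x i / (- z i)" if "i \<in> N" for i unfolding t_def using that N by (intro Min_le) auto
    define w where "w = (\<lambda>i. x i + t * z i)"
    have w0: "w i \<ge> 0" if "i \<in> {1..n}" for i
    proof (cases "i \<in> N")
      case True
      then have "z i < 0" by (simp add: N_def)
      then show ?thesis using tle[OF True] by (simp add: w_def field_simps)
    next
      case False
      then show ?thesis using that less.prems(1) t by (auto simp: w_def N_def not_less)
    qed
    have wa: "w a = 0" using a by (auto simp: w_def N_def)
    have "{i\<in>{1..n}. w i \<noteq> 0} \<subseteq> S - {a}"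
      using wa I by (auto simp: w_def S_def z_def split: if_splits)
    moreover have "a \<in> S" using a N I by auto
    moreover have "finite S" by (simp add: S_def)
    ultimately have cless: "card {i\<in>{1..n}. w i \<noteq> 0} < card S"
      by (meson card_Diff1_less card_mono finite_Diff le_less_trans)
    have cw: "comb n D w j = b j" if "j \<in> {1..k}" for j
      using that less.prems(2) z0 by (simp add: w_def comb_add_scaled)
    have up: "comb n D w (Suc k) \<ge> comb n D x (Suc k)" using zp t by (simp add: w_def comb_add_scaled)
    show ?thesis
    proof (cases "card {i\<in>{1..n}. w i \<noteq> 0} \<ge> k")
      case True
      from less.hyps[OF cless[unfolded S_def] _ _ True] w0 cw obtain v where
        "\<forall>i\<in>{1..n}. v i \<ge> 0" "\<forall>j\<in>{1..k}. comb n D v j = b j"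
        "card {i\<in>{1..n}. v i \<noteq> 0} \<le> k" "comb n D v (Suc k) \<ge> comb n D w (Suc k)" by blast
      then show ?thesis using up by (intro exI[of _ v]) auto
    next
      case False
      then show ?thesis using w0 cw up by (intro exI[of _ w]) auto
    qed
  qed
qed


text \<open>The basic solution settles the first claim. For the second, an improving ray would pair
  with the dual functional to a negative number although all its entries and all values of the
  functional are nonnegative. The empty basis is treated in \<open>optimal_empty_iff\<close>, since
  its own row would be row 0.\<close>

lemma optimal_imp_feas_pos:
  assumes I: "I \<subseteq> {1..n}" and opt: "optimal n D I" and "I \<noteq> {}"
  shows "feas_pos n (card I) D" "\<not> feas_pos n (Suc (card I)) D"
proof -
  let ?k = "card I"
  have k: "?k \<ge> 1" using assms finite_subset_atLeastAtMost[OF I] by (simp add: Suc_le_eq card_gt_0_iff)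
  obtain x where x: "\<forall>i\<in>I. x i > 0"
    "\<forall>j\<in>{1..?k}. (\<Sum>i\<in>I. x i * D i j) = (if j = ?k then 1 else 0)"
    using opt unfolding optimal_def primal_def by blast
  obtain c where c: "c (Suc ?k) = - 1" "\<forall>i\<in>I. (\<Sum>j\<in>{1..Suc ?k}. c j * D i j) = 0"
    "\<forall>i\<in>{1..n} - I. (\<Sum>j\<in>{1..Suc ?k}. c j * D i j) > 0"
    using opt unfolding optimal_def dual_def by blast
  define z where "z = (\<lambda>i. if i \<in> I then x i else 0)"
  have cz: "comb n D z j = (\<Sum>i\<in>I. x i * D i j)" for j
    by (subst comb_supported[OF I]) (auto simp: z_def)
  show "feas_pos n ?k D" unfolding feas_pos_def
  proof (rule exI[of _ z], intro conjI)
    show "\<forall>i\<in>{1..n}. 0 \<le> z i" using x(1) by (auto simp: z_def less_imp_le)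
  qed (use x(2) k in \<open>auto simp: cz\<close>)
  show "\<not> feas_pos n (Suc ?k) D"
  proof
    assume "feas_pos n (Suc ?k) D"
    then obtain y where y: "\<forall>i\<in>{1..n}. y i \<ge> 0" "\<forall>j\<in>{1..?k}. comb n D y j = 0"
      "comb n D y (Suc ?k) > 0"
      unfolding feas_pos_def atLeastLessThanSuc_atLeastAtMost by blast
    have "(\<Sum>j\<in>{1..Suc ?k}. c j * comb n D y j) = - comb n D y (Suc ?k)"
      using y(2) c(1) by simp
    moreover have "(\<Sum>i\<in>{1..n}. y i * (\<Sum>j\<in>{1..Suc ?k}. c j * D i j)) \<ge> 0"
    proof (rule sum_nonneg)
      fix i assume i: "i \<in> {1..n}"
      have "(\<Sum>j\<in>{1..Suc ?k}. c j * D i j) \<ge> 0"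
        using i c(2,3) by (metis DiffI less_eq_real_def)
      then show "y i * (\<Sum>j\<in>{1..Suc ?k}. c j * D i j) \<ge> 0"
        using y(1) i by (metis mult_nonneg_nonneg)
    qed
    ultimately show False using y(3) unfolding comb_linear_form by linarith
  qed
qed

text \<open>Weak duality: both bases have the same value, so complementary slackness puts each inside
  the other.\<close>

lemma optimal_unique:
  assumes I: "I \<subseteq> {1..n}" "I' \<subseteq> {1..n}" and card: "card I = card I'"
    and opt: "optimal n D I" "optimal n D I'"
  shows "I = I'"
proof -
  let ?k = "card I"
  have main: "\<exists>x c. (\<forall>i\<in>{1..n}. x i \<ge> 0) \<and> (\<forall>i\<in>{1..n}. x i > 0 \<longleftrightarrow> i \<in> J) \<and>
      (\<forall>j\<in>{1..?k}. comb n D x j = (if j = ?k then 1 else 0)) \<and> c (Suc ?k) = - 1 \<and>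
      (\<forall>i\<in>{1..n}. (\<Sum>j\<in>{1..Suc ?k}. c j * D i j) \<ge> 0) \<and>
      (\<forall>i\<in>{1..n}. (\<Sum>j\<in>{1..Suc ?k}. c j * D i j) = 0 \<longleftrightarrow> i \<in> J)"
    if J: "J \<subseteq> {1..n}" "card J = ?k" "optimal n D J" for J
  proof -
    obtain x where x: "\<forall>i\<in>J. x i > 0"
      "\<forall>j\<in>{1..?k}. (\<Sum>i\<in>J. x i * D i j) = (if j = ?k then 1 else 0)"
      using J unfolding optimal_def primal_def by auto
    obtain c where c: "c (Suc ?k) = - 1" "\<forall>i\<in>J. (\<Sum>j\<in>{1..Suc ?k}. c j * D i j) = 0"
      "\<forall>i\<in>{1..n} - J. (\<Sum>j\<in>{1..Suc ?k}. c j * D i j) > 0"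
      using J unfolding optimal_def dual_def by auto
    define z where "z = (\<lambda>i. if i \<in> J then x i else 0)"
    have cz: "comb n D z j = (\<Sum>i\<in>J. x i * D i j)" for j
      by (subst comb_supported[OF J(1)]) (auto simp: z_def)
    show ?thesis
    proof (rule exI[of _ z], rule exI[of _ c], intro conjI)
      show "\<forall>i\<in>{1..n}. (\<Sum>j\<in>{1..Suc ?k}. c j * D i j) \<ge> 0"
        "\<forall>i\<in>{1..n}. ((\<Sum>j\<in>{1..Suc ?k}. c j * D i j) = 0) = (i \<in> J)"
        using c(2,3) by (metis DiffI less_eq_real_def, metis DiffI less_irrefl)
    qed (use x c(1) cz in \<open>auto simp: z_def less_imp_le\<close>)
  qed
  from main[OF I(1) refl opt(1)] obtain x c where
    x: "\<forall>i\<in>{1..n}. x i \<ge> 0" "\<forall>i\<in>{1..n}. x i > 0 \<longleftrightarrow> i \<in> I"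
       "\<forall>j\<in>{1..?k}. comb n D x j = (if j = ?k then 1 else 0)" and
    c: "c (Suc ?k) = - 1" "\<forall>i\<in>{1..n}. (\<Sum>j\<in>{1..Suc ?k}. c j * D i j) \<ge> 0"
       "\<forall>i\<in>{1..n}. (\<Sum>j\<in>{1..Suc ?k}. c j * D i j) = 0 \<longleftrightarrow> i \<in> I" by blast
  from main[OF I(2) card[symmetric] opt(2)] obtain x' c' where
    x': "\<forall>i\<in>{1..n}. x' i \<ge> 0" "\<forall>i\<in>{1..n}. x' i > 0 \<longleftrightarrow> i \<in> I'"
       "\<forall>j\<in>{1..?k}. comb n D x' j = (if j = ?k then 1 else 0)" and
    c': "c' (Suc ?k) = - 1" "\<forall>i\<in>{1..n}. (\<Sum>j\<in>{1..Suc ?k}. c' j * D i j) \<ge> 0"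
       "\<forall>i\<in>{1..n}. (\<Sum>j\<in>{1..Suc ?k}. c' j * D i j) = 0 \<longleftrightarrow> i \<in> I'" by blast
  have form: "(\<Sum>i\<in>{1..n}. y i * (\<Sum>j\<in>{1..Suc ?k}. a j * D i j)) =
      (\<Sum>j\<in>{1..?k}. a j * (if j = ?k then 1 else 0)) - comb n D y (Suc ?k)"
    if "\<forall>j\<in>{1..?k}. comb n D y j = (if j = ?k then 1 else 0)" "a (Suc ?k) = - 1" for y a
  proof -
    have "(\<Sum>j\<in>{1..Suc ?k}. a j * comb n D y j) = (\<Sum>j\<in>{1..?k}. a j * comb n D y j) - comb n D y (Suc ?k)"
      using that(2) by simp
    also have "(\<Sum>j\<in>{1..?k}. a j * comb n D y j) = (\<Sum>j\<in>{1..?k}. a j * (if j = ?k then 1 else 0))"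
      using that(1) by (intro sum.cong) auto
    finally show ?thesis unfolding comb_linear_form .
  qed
  have zero: "(\<Sum>i\<in>{1..n}. x i * (\<Sum>j\<in>{1..Suc ?k}. c j * D i j)) = 0"
    "(\<Sum>i\<in>{1..n}. x' i * (\<Sum>j\<in>{1..Suc ?k}. c' j * D i j)) = 0"
    using x(1,2) c(3) x'(1,2) c'(3)
    by (intro sum.neutral ballI; metis less_eq_real_def mult_eq_0_iff)+
  have nonneg: "(\<Sum>i\<in>{1..n}. x' i * (\<Sum>j\<in>{1..Suc ?k}. c j * D i j)) \<ge> 0"
    "(\<Sum>i\<in>{1..n}. x i * (\<Sum>j\<in>{1..Suc ?k}. c' j * D i j)) \<ge> 0"
    using x(1) x'(1) c(2) c'(2) by (intro sum_nonneg; metis mult_nonneg_nonneg)+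
  have "(\<Sum>i\<in>{1..n}. x' i * (\<Sum>j\<in>{1..Suc ?k}. c j * D i j)) = 0"
    using zero nonneg form[of x c, OF x(3) c(1)] form[of x' c, OF x'(3) c(1)]
      form[of x c', OF x(3) c'(1)] form[of x' c', OF x'(3) c'(1)]
    by linarith
  then have "\<forall>i\<in>{1..n}. x' i * (\<Sum>j\<in>{1..Suc ?k}. c j * D i j) = 0"
    using x'(1) c(2) by (subst (asm) sum_nonneg_eq_0_iff) auto
  then have "I' \<subseteq> I" using x'(2) c(3) I(2)
    by (metis mult_eq_0_iff less_irrefl subsetD subsetI)
  then show ?thesis
    using card I finite_subset_atLeastAtMost[OF I(1)] by (metis card_subset_eq)
qed

text \<open>The maximum is attained because every feasible point is dominated by a basic one and
  only finitely many values occur at basic points. At a best basic point the functional is strictly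
  positive outside the basis: otherwise letting column \<open>a\<close> enter would keep the
  constraints, and genericity in \<open>k + 1\<close> rows makes the gain strict.\<close>

lemma exists_optimal:
  assumes k: "k \<ge> 1" and feas: "feas_pos n k D" and bounded: "\<not> feas_pos n (Suc k) D"
  shows "\<exists>I\<subseteq>{1..n}. card I = k \<and> optimal n D I"
proof -
  define b where "b = (\<lambda>j. if j = k then 1 else (0::real))"
  define ok where "ok = (\<lambda>x. (\<forall>i\<in>{1..n}. x i \<ge> 0) \<and> (\<forall>j\<in>{1..k}. comb n D x j = b j))"
  define supp where "supp = (\<lambda>x::nat \<Rightarrow> real. {i\<in>{1..n}. x i \<noteq> 0})"
  have supp: "supp x \<subseteq> {1..n}" "finite (supp x)" for x by (auto simp: supp_def)
  have comb_supp: "comb n D x j = (\<Sum>i\<in>supp x. x i * D i j)" for x j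
    by (rule comb_supported) (auto simp: supp_def)
  \<comment> \<open>Rows below \<open>k\<close> vanish, so by genericity a support of at most
    \<open>k - 1\<close> columns would carry only zero coefficients, against row \<open>k\<close>
    being 1.\<close>
  have supp_ge: "card (supp x) \<ge> k" if "ok x" for x
  proof (rule ccontr)
    assume "\<not> ?thesis"
    then have le: "card (supp x) \<le> k - 1" by simp
    have "x i = 0" if "i \<in> supp x" for i
      using that le \<open>ok x\<close> supp unfolding ok_def comb_supp
      by (intro generic_kernel_eq_0[of "supp x" "k - 1" x i]) (auto simp: b_def)
    then have "comb n D x k = 0" by (simp add: comb_supp)
    with \<open>ok x\<close> k show False by (simp add: ok_def b_def)
  qed
  define V where "V = {comb n D x (Suc k) | x. ok x \<and> card (supp x) = k}"
  have val_det: "comb n D x (Suc k) = comb n D y (Suc k)"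
    if "ok x" "ok y" "card (supp x) = k" "supp x = supp y" for x y
  proof -
    have "x i - y i = 0" if i: "i \<in> supp x" for i
      using that \<open>ok x\<close> \<open>ok y\<close> \<open>card (supp x) = k\<close> \<open>supp x = supp y\<close> supp(1)[of x] unfolding ok_def comb_supp
      by (intro generic_kernel_eq_0[of "supp x" k "\<lambda>i. x i - y i" i]) (simp_all add: left_diff_distrib sum_subtractf)
    then show ?thesis using \<open>supp x = supp y\<close> by (simp add: comb_supp)
  qed
  \<comment> \<open>A basic solution is determined by its support (\<open>val_det\<close>), so there
    are no more values than supports.\<close>
  have "finite V"
  proof (rule finite_subset)
    show "V \<subseteq> (\<lambda>S. comb n D (SOME x. ok x \<and> supp x = S) (Suc k)) ` Pow {1..n}"
    proof
      fix v assume "v \<in> V"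
      then obtain x where x: "v = comb n D x (Suc k)" "ok x" "card (supp x) = k" by (auto simp: V_def)
      define y where "y = (SOME y. ok y \<and> supp y = supp x)"
      have "ok y \<and> supp y = supp x" unfolding y_def by (rule someI[of _ x]) (use x in auto)
      then have "v = comb n D y (Suc k)" unfolding x(1) using x by (intro val_det) auto
      then show "v \<in> (\<lambda>S. comb n D (SOME x. ok x \<and> supp x = S) (Suc k)) ` Pow {1..n}"
        unfolding y_def using supp(1)[of x] by blast
    qed
  qed simp
  have improve: "\<exists>v\<in>V. v \<ge> comb n D x (Suc k)" if "ok x" for x
  proof -
    from improve_to_basis[OF bounded, of x b] that supp_ge[OF that] obtain y where
      "\<forall>i\<in>{1..n}. y i \<ge> 0" "\<forall>j\<in>{1..k}. comb n D y j = b j" "card (supp y) \<le> k"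
      "comb n D y (Suc k) \<ge> comb n D x (Suc k)" unfolding ok_def supp_def by blast
    then show ?thesis using supp_ge[of y] unfolding V_def ok_def by (force intro: le_antisym)
  qed
  obtain x0 where x0: "\<forall>i\<in>{1..n}. x0 i \<ge> 0" "\<forall>j\<in>{1..<k}. comb n D x0 j = 0" "comb n D x0 k > 0"
    using feas unfolding feas_pos_def by blast
  \<comment> \<open>Dividing by row \<open>k\<close> normalises it to 1; the summand 0 gives the
    quotient the shape of \<open>comb_add_scaled\<close>.\<close>
  have "ok (\<lambda>i. 0 + (1 / comb n D x0 k) * x0 i)"
    unfolding ok_def comb_add_scaled using x0 by (auto simp: b_def comb_def[of n D "\<lambda>_. 0"])
  from improve[OF this] have "V \<noteq> {}" by blast
  define v where "v = Max V"
  have "v \<in> V" using \<open>finite V\<close> \<open>V \<noteq> {}\<close> by (simp add: v_def)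
  then obtain x where x: "v = comb n D x (Suc k)" "ok x" "card (supp x) = k" by (auto simp: V_def)
  have max: "comb n D y (Suc k) \<le> v" if "ok y" for y
    using improve[OF that] \<open>finite V\<close> unfolding v_def by (meson Max_ge order_trans)
  define I where "I = supp x"
  have I: "I \<subseteq> {1..n}" "finite I" "card I = k" using supp x by (auto simp: I_def)
  have indep: "indep_cols D I" using gen I by (simp add: generic_def)
  have xpos: "x i > 0" if "i \<in> I" for i
    using that x(2) by (force simp: I_def supp_def ok_def less_le)
  have "primal D I" unfolding primal_def
    using xpos x(2) I comb_supp[of x] by (intro exI[of _ x]) (auto simp: ok_def b_def I_def)
  moreover have "dual n D I"
  proof -
    obtain c0 where c0: "\<forall>i\<in>I. (\<Sum>j\<in>{1..k}. c0 j * D i j) = D i (Suc k)"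
      using transposed_system_solvable[of "{1..k}" I D "\<lambda>i. D i (Suc k)"] I indep
      unfolding indep_cols_def by auto
    define c where "c = c0(Suc k := - 1)"
    have c_eq: "(\<Sum>j\<in>{1..Suc k}. c j * D i j) = (\<Sum>j\<in>{1..k}. c0 j * D i j) - D i (Suc k)" for i
      by (auto simp: c_def intro!: sum.cong)
    have cI: "\<forall>i\<in>I. (\<Sum>j\<in>{1..Suc k}. c j * D i j) = 0" using c0 unfolding c_eq by simp
    have "(\<Sum>j\<in>{1..Suc k}. c j * D a j) > 0" if a: "a \<in> {1..n} - I" for a
    proof (rule ccontr)
      assume neg: "\<not> ?thesis"
      obtain y0 where y0: "\<forall>j\<in>{1..k}. (\<Sum>i\<in>I. y0 i * D i j) = - D a j"
        using square_system_solvable[of "{1..k}" I D "\<lambda>j. - D a j"] I indep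
        unfolding indep_cols_def by auto
      \<comment> \<open>Column \<open>a\<close> enters with coefficient 1 and the basis compensates
        in the rows up to \<open>k\<close>. The gain in row \<open>Suc k\<close> along
        \<open>y\<close> is minus the value of the functional at \<open>a\<close>; it is not 0
        because the columns of \<open>insert a I\<close> are independent in \<open>Suc k\<close>
        rows.\<close>
      define y where "y = (\<lambda>i. if i = a then 1 else if i \<in> I then y0 i else 0)"
      have cy: "comb n D y j = D a j + (\<Sum>i\<in>I. y0 i * D i j)" for j
      proof -
        have "comb n D y j = (\<Sum>i\<in>insert a I. y i * D i j)"
          using a I by (intro comb_supported) (auto simp: y_def)
        also have "\<dots> = D a j + (\<Sum>i\<in>I. y i * D i j)" using a I by (simp add: y_def)
        also have "(\<Sum>i\<in>I. y i * D i j) = (\<Sum>i\<in>I. y0 i * D i j)"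
          using a by (intro sum.cong) (auto simp: y_def)
        finally show ?thesis .
      qed
      have y_0: "comb n D y j = 0" if "j \<in> {1..k}" for j using y0 that by (simp add: cy)
      have "(\<Sum>i\<in>{1..n}. y i * (\<Sum>j\<in>{1..Suc k}. c j * D i j)) = (\<Sum>j\<in>{1..Suc k}. c j * D a j)"
      proof -
        have "(\<Sum>i\<in>{1..n}. y i * (\<Sum>j\<in>{1..Suc k}. c j * D i j)) =
            (\<Sum>i\<in>{a}. y i * (\<Sum>j\<in>{1..Suc k}. c j * D i j))"
        proof (rule sum.mono_neutral_right)
          show "\<forall>i\<in>{1..n} - {a}. y i * (\<Sum>j\<in>{1..Suc k}. c j * D i j) = 0"
            using cI by (metis Diff_iff mult_eq_0_iff singletonI y_def)
        qed (use a in auto)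
        then show ?thesis by (simp add: y_def)
      qed
      moreover have "(\<Sum>j\<in>{1..Suc k}. c j * comb n D y j) = - comb n D y (Suc k)"
        using y_0 by (simp add: c_def)
      ultimately have "comb n D y (Suc k) = - (\<Sum>j\<in>{1..Suc k}. c j * D a j)"
        unfolding comb_linear_form by linarith
      with neg have yge: "comb n D y (Suc k) \<ge> 0" by simp
      have "comb n D y (Suc k) \<noteq> 0"
      proof
        assume eq: "comb n D y (Suc k) = 0"
        have comb_y: "comb n D y j = (\<Sum>i\<in>insert a I. y i * D i j)" for j
          using a I by (intro comb_supported) (auto simp: y_def)
        have "y a = 0"
        proof (rule generic_kernel_eq_0[of "insert a I" "Suc k"])
          fix j assume "j \<in> {1..Suc k}"
          then show "(\<Sum>i\<in>insert a I. y i * D i j) = 0"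
            using eq y_0 unfolding comb_y[symmetric] by (cases "j = Suc k") auto
        qed (use a I in auto)
        then show False by (simp add: y_def)
      qed
      with yge have ypos: "comb n D y (Suc k) > 0" by simp
      from exists_small_step[where x = x and y = y, OF I(2) xpos] obtain t where
        t: "t > 0" "\<forall>i\<in>I. x i + t * y i > 0" by blast
      have "x i + t * y i \<ge> 0" if "i \<in> {1..n}" for i
      proof (cases "i \<in> I")
        case True with t show ?thesis by (simp add: less_imp_le)
      next
        case False
        then have "y i \<ge> 0" by (simp add: y_def)
        moreover have "x i \<ge> 0" using x(2) that by (simp add: ok_def)
        ultimately show ?thesis using t by simp
      qed
      moreover have "comb n D (\<lambda>i. x i + t * y i) j = b j" if "j \<in> {1..k}" for j
        using x(2) y_0 that by (simp add: comb_add_scaled ok_def)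
      ultimately have "ok (\<lambda>i. x i + t * y i)" by (simp add: ok_def)
      from max[OF this] show False using ypos t x(1) by (simp add: comb_add_scaled mult_le_0_iff)
    qed
    then show ?thesis unfolding dual_def I(3)
      using cI by (intro exI[of _ c]) (auto simp: c_def)
  qed
  ultimately show ?thesis using I indep unfolding optimal_def by blast
qed

text \<open>Without basis columns the dual condition says that every entry of row 1 is negative;
  zero entries are excluded by genericity, and a positive one would be feasible by itself.\<close>

lemma optimal_empty_iff: "optimal n D {} \<longleftrightarrow> \<not> feas_pos n 1 D"
proof
  assume "optimal n D {}"
  then obtain c where c: "c 1 = - 1" "\<forall>i\<in>{1..n}. c 1 * D i 1 > 0"
    unfolding optimal_def dual_def by auto
  then have neg: "D i 1 < 0" if "i \<in> {1..n}" for i using that by auto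
  show "\<not> feas_pos n 1 D"
  proof
    assume "feas_pos n 1 D"
    then obtain x where x: "\<forall>i\<in>{1..n}. x i \<ge> 0" "comb n D x 1 > 0" unfolding feas_pos_def by blast
    have "comb n D x 1 \<le> 0" unfolding comb_def
      using x neg by (intro sum_nonpos mult_nonneg_nonpos) (auto simp: less_imp_le)
    with x show False by simp
  qed
next
  assume *: "\<not> feas_pos n 1 D"
  have "D i 1 < 0" if i: "i \<in> {1..n}" for i
  proof (rule ccontr)
    assume "\<not> ?thesis"
    moreover have "D i 1 \<noteq> 0"
    proof
      assume "D i 1 = 0"
      then have "(1::real) = 0"
        using generic_kernel_eq_0[of "{i}" 1 "\<lambda>_. 1" i] i by auto
      then show False by simp
    qed
    ultimately have "D i 1 > 0" by simp
    define x where "x = (\<lambda>l. if l = i then 1 else (0::real))"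
    have "comb n D x 1 = D i 1"
      by (subst comb_supported[of "{i}"]) (use i in \<open>auto simp: x_def\<close>)
    with \<open>D i 1 > 0\<close> have "feas_pos n 1 D" unfolding feas_pos_def
      by (intro exI[of _ x]) (auto simp: x_def)
    with * show False by simp
  qed
  then show "optimal n D {}" unfolding optimal_def indep_cols_def primal_def dual_def
    by (auto intro!: exI[of _ "\<lambda>_. -1"])
qed

end

section \<open>Measurability of the linear-programming events\<close>

text \<open>Projection along a compact factor is a closed map; \<open>S\<close> is first cut down to
  the slab over \<open>K\<close>.\<close>

lemma closed_projection_compact:
  fixes S :: "('a::topological_space \<times> 'b::topological_space) set"
  assumes "compact K" "closed S"
  shows "closed {y. \<exists>x\<in>K. (x, y) \<in> S}"
proof -
  have "closed_map (prod_topology (top_of_set K) euclidean) (euclidean :: 'b topology) snd"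
    by (rule closed_map_snd) (use assms in \<open>simp add: compact_space_subtopology\<close>)
  moreover have "closedin (prod_topology (top_of_set K) (euclidean :: 'b topology)) (S \<inter> K \<times> UNIV)"
  proof -
    have "prod_topology (top_of_set K) (euclidean :: 'b topology) = top_of_set (K \<times> UNIV)"
      by (metis prod_topology_subtopology_eu subtopology_UNIV)
    moreover have "closedin (top_of_set (K \<times> UNIV)) (S \<inter> K \<times> UNIV)"
      unfolding closedin_closed using assms(2) by (intro exI[of _ S]) blast
    ultimately show ?thesis by simp
  qed
  ultimately have "closed (snd ` (S \<inter> K \<times> UNIV))"
    unfolding closed_map_def closed_closedin by blast
  also have "snd ` (S \<inter> K \<times> UNIV) = {y. \<exists>x\<in>K. (x, y) \<in> S}" by force
  finally show ?thesis .
qed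

lemma compact_cube: "compact {x :: 'a \<Rightarrow> real. \<forall>i. \<bar>x i\<bar> \<le> b}"
proof -
  have "compactin (product_topology (\<lambda>_. euclidean) UNIV) (PiE UNIV (\<lambda>_. {-b..b}) :: ('a \<Rightarrow> real) set)"
    by (simp add: compactin_PiE)
  moreover have "PiE UNIV (\<lambda>_. {-b..b}) = {x :: 'a \<Rightarrow> real. \<forall>i. \<bar>x i\<bar> \<le> b}"
    by (auto simp: PiE_def Pi_def abs_le_iff minus_le_iff)
  ultimately show ?thesis by (simp add: euclidean_product_topology)
qed

text \<open>An existential quantifier over an unbounded parameter becomes a countable union of
  projections along compact cubes.\<close>

lemma borel_ex_parameter:
  fixes S :: "nat \<Rightarrow> (('a \<Rightarrow> real) \<times> 'b::topological_space) set"
  assumes "\<And>N. closed (S N)"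
  shows "{y. \<exists>N x. (\<forall>i. \<bar>x i\<bar> \<le> real N) \<and> (x, y) \<in> S N} \<in> sets borel"
proof -
  have "{y. \<exists>N x. (\<forall>i. \<bar>x i\<bar> \<le> real N) \<and> (x, y) \<in> S N} =
      (\<Union>N. {y. \<exists>x\<in>{x. \<forall>i. \<bar>x i\<bar> \<le> real N}. (x, y) \<in> S N})" by auto
  also have "\<dots> \<in> sets borel"
  proof (rule sets.countable_nat_UN, rule image_subsetI)
    show "{y. \<exists>x\<in>{x. \<forall>i. \<bar>x i\<bar> \<le> real N}. (x, y) \<in> S N} \<in> sets borel" for N
      by (rule borel_closed, rule closed_projection_compact[OF compact_cube assms])
  qed
  finally show ?thesis .
qed

lemma exists_parameter_bound:
  fixes x :: "'a \<Rightarrow> real"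
  assumes "finite A" "\<epsilon> > 0"
  shows "\<exists>N::nat. (\<forall>i\<in>A. \<bar>x i\<bar> \<le> real N) \<and> inverse (real (Suc N)) \<le> \<epsilon>"
proof -
  obtain N where N: "real N > max (\<Sum>i\<in>A. \<bar>x i\<bar>) (inverse \<epsilon>)" using reals_Archimedean2 by blast
  have "\<bar>x i\<bar> \<le> real N" if "i \<in> A" for i
  proof -
    have "\<bar>x i\<bar> \<le> (\<Sum>i\<in>A. \<bar>x i\<bar>)" using that assms(1) by (intro member_le_sum) auto
    then show ?thesis using N by linarith
  qed
  moreover have "inverse (real (Suc N)) \<le> inverse (inverse \<epsilon>)"
    using N assms(2) by (intro le_imp_inverse_le) auto
  then have "inverse (real (Suc N)) \<le> \<epsilon>" by simp
  ultimately show ?thesis by blast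
qed

lemma continuous_on_fst_coordinate [continuous_intros]:
  "continuous_on X (\<lambda>p. fst p i)" for X :: "(('a \<Rightarrow> 'b::topological_space) \<times> 'c::topological_space) set"
  by (rule continuous_on_subset[OF _ subset_UNIV])
    (intro continuous_on_compose2[OF continuous_on_product_coordinates continuous_on_fst[OF continuous_on_id]]; simp)+

lemma continuous_on_snd_coordinate [continuous_intros]:
  "continuous_on X (\<lambda>p. snd p i)" for X :: "('c::topological_space \<times> ('a \<Rightarrow> 'b::topological_space)) set"
  by (rule continuous_on_subset[OF _ subset_UNIV])
    (intro continuous_on_compose2[OF continuous_on_product_coordinates continuous_on_snd[OF continuous_on_id]]; simp)+

lemma continuous_on_snd_coordinate2 [continuous_intros]:
  "continuous_on X (\<lambda>p. snd p i j)"
  for X :: "('c::topological_space \<times> ('a \<Rightarrow> 'd \<Rightarrow> 'b::topological_space)) set"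
  by (rule continuous_on_subset[OF _ subset_UNIV])
    (intro continuous_on_compose2[OF continuous_on_product_coordinates continuous_on_snd_coordinate]; simp)+

lemma closed_Collect_ball:
  assumes "\<And>i. i \<in> A \<Longrightarrow> closed {x. P i x}"
  shows "closed {x. \<forall>i\<in>A. P i x}"
  using closed_INT[of A "\<lambda>i. {x. P i x}"] assms by (simp add: Collect_ball_eq)

text \<open>In the applications \<open>N\<close> serves twice: it confines the parameter to a cube,
  and it turns strict inequalities into closed ones with margin
  \<open>inverse (real (Suc N))\<close>. Both restrictions are exhausted as \<open>N\<close>
  grows.\<close>

lemma borel_parametric_Collect:
  fixes P :: "nat \<Rightarrow> ('a \<Rightarrow> real) \<Rightarrow> 'b::topological_space \<Rightarrow> bool"
  assumes "\<And>N. closed {p. P N (fst p) (snd p)}"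
    and "\<And>y. Q y \<longleftrightarrow> (\<exists>N x. (\<forall>i. \<bar>x i\<bar> \<le> real N) \<and> P N x y)"
  shows "{y. Q y} \<in> sets borel"
  using borel_ex_parameter[of "\<lambda>N. {p. P N (fst p) (snd p)}", OF assms(1)]
  unfolding assms(2) by simp

text \<open>The cube bounds the parameter at every index, so witnesses are cut off outside the
  finite set that enters the condition.\<close>

lemma truncated_parameter:
  fixes x :: "'a \<Rightarrow> real"
  assumes "\<And>i. i \<in> A \<Longrightarrow> \<bar>x i\<bar> \<le> real N"
  shows "\<forall>i. \<bar>if i \<in> A then x i else 0\<bar> \<le> real N"
  using assms by auto

lemma borel_feas_pos: "{D. feas_pos n k D} \<in> sets borel"
proof (rule borel_parametric_Collect)
  let ?P = "\<lambda>N x D. (\<forall>i\<in>{1..n}. x i \<ge> 0) \<and> (\<forall>j\<in>{1..<k}. comb n D x j = 0) \<and>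
    inverse (real (Suc N)) \<le> comb n D x k"
  show "closed {p. ?P N (fst p) (snd p)}" for N unfolding comb_def
    by (intro closed_Collect_conj closed_Collect_ball closed_Collect_le closed_Collect_eq
        continuous_on_sum continuous_intros)
  show "feas_pos n k D \<longleftrightarrow> (\<exists>N x. (\<forall>i. \<bar>x i\<bar> \<le> real N) \<and> ?P N x D)" for D
  proof
    assume "feas_pos n k D"
    then obtain x where x: "\<forall>i\<in>{1..n}. x i \<ge> 0" "\<forall>j\<in>{1..<k}. comb n D x j = 0" "comb n D x k > 0"
      unfolding feas_pos_def by blast
    from exists_parameter_bound[OF _ x(3), of "{1..n}" x] obtain N where
      N: "\<forall>i\<in>{1..n}. \<bar>x i\<bar> \<le> real N" "inverse (real (Suc N)) \<le> comb n D x k" by auto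
    define y where "y = (\<lambda>i. if i \<in> {1..n} then x i else 0)"
    have "comb n D y j = comb n D x j" for j by (simp add: comb_def y_def)
    moreover have "\<forall>i. \<bar>y i\<bar> \<le> real N" unfolding y_def by (rule truncated_parameter) (use N in blast)
    ultimately show "\<exists>N x. (\<forall>i. \<bar>x i\<bar> \<le> real N) \<and> ?P N x D"
      using x N by (intro exI[of _ N] exI[of _ y]) (auto simp: y_def)
  next
    assume "\<exists>N x. (\<forall>i. \<bar>x i\<bar> \<le> real N) \<and> ?P N x D"
    then show "feas_pos n k D" unfolding feas_pos_def
      by (smt (verit) inverse_positive_iff_positive of_nat_0_less_iff zero_less_Suc)
  qed
qed

lemma borel_feas_neg: "{D. feas_neg n k D} \<in> sets borel"
proof (rule borel_parametric_Collect)
  let ?P = "\<lambda>N x D. (\<forall>i\<in>{1..n}. x i \<ge> 0) \<and> (\<forall>j\<in>{1..<k}. comb n D x j = 0) \<and>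
    inverse (real (Suc N)) \<le> - comb n D x k"
  show "closed {p. ?P N (fst p) (snd p)}" for N unfolding comb_def
    by (intro closed_Collect_conj closed_Collect_ball closed_Collect_le closed_Collect_eq
        continuous_on_sum continuous_intros)
  show "feas_neg n k D \<longleftrightarrow> (\<exists>N x. (\<forall>i. \<bar>x i\<bar> \<le> real N) \<and> ?P N x D)" for D
  proof
    assume "feas_neg n k D"
    then obtain x where x: "\<forall>i\<in>{1..n}. x i \<ge> 0" "\<forall>j\<in>{1..<k}. comb n D x j = 0" "- comb n D x k > 0"
      unfolding feas_neg_def by auto
    from exists_parameter_bound[OF _ x(3), of "{1..n}" x] obtain N where
      N: "\<forall>i\<in>{1..n}. \<bar>x i\<bar> \<le> real N" "inverse (real (Suc N)) \<le> - comb n D x k" by auto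
    define y where "y = (\<lambda>i. if i \<in> {1..n} then x i else 0)"
    have "comb n D y j = comb n D x j" for j by (simp add: comb_def y_def)
    moreover have "\<forall>i. \<bar>y i\<bar> \<le> real N" unfolding y_def by (rule truncated_parameter) (use N in blast)
    ultimately show "\<exists>N x. (\<forall>i. \<bar>x i\<bar> \<le> real N) \<and> ?P N x D"
      using x N by (intro exI[of _ N] exI[of _ y]) (auto simp: y_def)
  next
    assume "\<exists>N x. (\<forall>i. \<bar>x i\<bar> \<le> real N) \<and> ?P N x D"
    then show "feas_neg n k D" unfolding feas_neg_def
      by (smt (verit) inverse_positive_iff_positive of_nat_0_less_iff zero_less_Suc)
  qed
qed

lemma borel_feas_zero: "{D. feas_zero n d D} \<in> sets borel"
proof (rule borel_parametric_Collect)
  \<comment> \<open>A nonnegative \<open>x\<close> is nontrivial when its sum is positive, and a sum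
    admits a margin.\<close>
  let ?P = "\<lambda>N x D. (\<forall>i\<in>{1..n}. x i \<ge> 0) \<and> (\<forall>j\<in>{1..d}. comb n D x j = 0) \<and>
    inverse (real (Suc N)) \<le> (\<Sum>i\<in>{1..n}. x i)"
  show "closed {p. ?P N (fst p) (snd p)}" for N unfolding comb_def
    by (intro closed_Collect_conj closed_Collect_ball closed_Collect_le closed_Collect_eq
        continuous_on_sum continuous_intros)
  show "feas_zero n d D \<longleftrightarrow> (\<exists>N x. (\<forall>i. \<bar>x i\<bar> \<le> real N) \<and> ?P N x D)" for D
  proof
    assume "feas_zero n d D"
    then obtain x where x: "\<forall>i\<in>{1..n}. x i \<ge> 0" "\<forall>j\<in>{1..d}. comb n D x j = 0" "\<exists>i\<in>{1..n}. x i > 0"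
      unfolding feas_zero_def by blast
    have "(\<Sum>i\<in>{1..n}. x i) > 0" using x by (auto intro: sum_pos2)
    from exists_parameter_bound[OF _ this, of "{1..n}" x] obtain N where
      N: "\<forall>i\<in>{1..n}. \<bar>x i\<bar> \<le> real N" "inverse (real (Suc N)) \<le> (\<Sum>i\<in>{1..n}. x i)" by auto
    define y where "y = (\<lambda>i. if i \<in> {1..n} then x i else 0)"
    have "comb n D y j = comb n D x j" for j by (simp add: comb_def y_def)
    moreover have "\<forall>i. \<bar>y i\<bar> \<le> real N" unfolding y_def by (rule truncated_parameter) (use N in blast)
    ultimately show "\<exists>N x. (\<forall>i. \<bar>x i\<bar> \<le> real N) \<and> ?P N x D"
      using x N by (intro exI[of _ N] exI[of _ y]) (auto simp: y_def)
  next
    assume "\<exists>N x. (\<forall>i. \<bar>x i\<bar> \<le> real N) \<and> ?P N x D"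
    then obtain N x where x: "?P N x D" by blast
    moreover have "\<exists>i\<in>{1..n}. x i > 0"
    proof (rule ccontr)
      assume "\<not> ?thesis"
      then have "(\<Sum>i\<in>{1..n}. x i) \<le> 0" by (intro sum_nonpos) (auto simp: not_less)
      moreover have "inverse (real (Suc N)) > 0" by simp
      ultimately show False using x by linarith
    qed
    ultimately show "feas_zero n d D" unfolding feas_zero_def by blast
  qed
qed

lemma borel_indep_cols:
  assumes "finite I" shows "{D. indep_cols D I} \<in> sets borel"
proof -
  have "{D. \<not> indep_cols D I} \<in> sets borel"
  proof (rule borel_parametric_Collect)
    let ?P = "\<lambda>N x D. (\<forall>j\<in>{1..card I}. (\<Sum>i\<in>I. x i * D i j) = 0) \<and>
      inverse (real (Suc N)) \<le> (\<Sum>i\<in>I. \<bar>x i\<bar>)"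
    show "closed {p. ?P N (fst p) (snd p)}" for N
      by (intro closed_Collect_conj closed_Collect_ball closed_Collect_le closed_Collect_eq
          continuous_on_sum continuous_intros)
    show "(\<not> indep_cols D I) \<longleftrightarrow> (\<exists>N x. (\<forall>i. \<bar>x i\<bar> \<le> real N) \<and> ?P N x D)" for D
    proof
      assume "\<not> indep_cols D I"
      then obtain x where x: "\<forall>j\<in>{1..card I}. (\<Sum>i\<in>I. x i * D i j) = 0" "\<exists>i\<in>I. x i \<noteq> 0"
        unfolding indep_cols_def by blast
      have "(\<Sum>i\<in>I. \<bar>x i\<bar>) > 0" using x assms by (auto intro: sum_pos2)
      from exists_parameter_bound[OF assms this, of x] obtain N where
        N: "\<forall>i\<in>I. \<bar>x i\<bar> \<le> real N" "inverse (real (Suc N)) \<le> (\<Sum>i\<in>I. \<bar>x i\<bar>)" by auto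
      define y where "y = (\<lambda>i. if i \<in> I then x i else 0)"
      have "\<forall>i. \<bar>y i\<bar> \<le> real N" unfolding y_def by (rule truncated_parameter) (use N in blast)
      then show "\<exists>N x. (\<forall>i. \<bar>x i\<bar> \<le> real N) \<and> ?P N x D"
        using x N by (intro exI[of _ N] exI[of _ y]) (auto simp: y_def)
    next
      assume "\<exists>N x. (\<forall>i. \<bar>x i\<bar> \<le> real N) \<and> ?P N x D"
      then obtain N x where x: "?P N x D" by blast
      have "\<exists>i\<in>I. x i \<noteq> 0"
      proof (rule ccontr)
        assume "\<not> ?thesis"
        then have "(\<Sum>i\<in>I. \<bar>x i\<bar>) = 0" by simp
        moreover have "inverse (real (Suc N)) > 0" by simp
        ultimately show False using x by linarith
      qed
      then show "\<not> indep_cols D I" using x unfolding indep_cols_def by blast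
    qed
  qed
  then have "- {D. \<not> indep_cols D I} \<in> sets borel" by (rule borel_comp)
  then show ?thesis by (simp add: Compl_eq)
qed

lemma borel_primal:
  assumes "finite I" shows "{D. primal D I} \<in> sets borel"
proof (rule borel_parametric_Collect)
  let ?P = "\<lambda>N x D. (\<forall>i\<in>I. inverse (real (Suc N)) \<le> x i) \<and>
     (\<forall>j\<in>{1..card I}. (\<Sum>i\<in>I. x i * D i j) = (if j = card I then 1 else 0))"
  show "closed {p. ?P N (fst p) (snd p)}" for N
    by (intro closed_Collect_conj closed_Collect_ball closed_Collect_le closed_Collect_eq
        continuous_on_sum continuous_intros)
  show "primal D I \<longleftrightarrow> (\<exists>N x. (\<forall>i. \<bar>x i\<bar> \<le> real N) \<and> ?P N x D)" for D
  proof
    assume "primal D I"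
    then obtain x where x: "\<forall>i\<in>I. x i > 0"
      "\<forall>j\<in>{1..card I}. (\<Sum>i\<in>I. x i * D i j) = (if j = card I then 1 else 0)"
      unfolding primal_def by blast
    \<comment> \<open>The inserted 1 keeps the minimum defined when \<open>I\<close> is
      empty.\<close>
    have "Min (insert 1 (x ` I)) > 0" using x assms by simp
    from exists_parameter_bound[OF assms this, of x] obtain N where
      N: "\<forall>i\<in>I. \<bar>x i\<bar> \<le> real N" "inverse (real (Suc N)) \<le> Min (insert 1 (x ` I))" by auto
    define y where "y = (\<lambda>i. if i \<in> I then x i else 0)"
    have "\<forall>i. \<bar>y i\<bar> \<le> real N" unfolding y_def by (rule truncated_parameter) (use N in blast)
    then show "\<exists>N x. (\<forall>i. \<bar>x i\<bar> \<le> real N) \<and> ?P N x D"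
      using x N assms by (intro exI[of _ N] exI[of _ y]) (auto simp: y_def)
  next
    assume "\<exists>N x. (\<forall>i. \<bar>x i\<bar> \<le> real N) \<and> ?P N x D"
    then show "primal D I" unfolding primal_def
      by (smt (verit) inverse_positive_iff_positive of_nat_0_less_iff zero_less_Suc)
  qed
qed

lemma borel_dual: "{D. dual n D I} \<in> sets borel"
proof (rule borel_parametric_Collect)
  let ?R = "{1..Suc (card I)}"
  let ?P = "\<lambda>N c D. c (Suc (card I)) = - 1 \<and> (\<forall>i\<in>I. (\<Sum>j\<in>?R. c j * D i j) = 0) \<and>
     (\<forall>i\<in>{1..n} - I. inverse (real (Suc N)) \<le> (\<Sum>j\<in>?R. c j * D i j))"
  show "closed {p. ?P N (fst p) (snd p)}" for N
    by (intro closed_Collect_conj closed_Collect_ball closed_Collect_le closed_Collect_eq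
        continuous_on_sum continuous_intros)
  show "dual n D I \<longleftrightarrow> (\<exists>N c. (\<forall>i. \<bar>c i\<bar> \<le> real N) \<and> ?P N c D)" for D
  proof
    assume "dual n D I"
    then obtain c where c: "c (Suc (card I)) = - 1" "\<forall>i\<in>I. (\<Sum>j\<in>?R. c j * D i j) = 0"
      "\<forall>i\<in>{1..n} - I. (\<Sum>j\<in>?R. c j * D i j) > 0"
      unfolding dual_def by blast
    let ?M = "Min (insert 1 ((\<lambda>i. \<Sum>j\<in>?R. c j * D i j) ` ({1..n} - I)))"
    have "?M > 0" using c by (subst Min_gr_iff) auto
    from exists_parameter_bound[OF _ this, of ?R c] obtain N where
      N: "\<forall>i\<in>?R. \<bar>c i\<bar> \<le> real N" "inverse (real (Suc N)) \<le> ?M" by auto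
    define b where "b = (\<lambda>i. if i \<in> ?R then c i else 0)"
    have sum_b: "(\<Sum>j\<in>?R. b j * D i j) = (\<Sum>j\<in>?R. c j * D i j)" for i
      by (intro sum.cong) (auto simp: b_def)
    have "inverse (real (Suc N)) \<le> (\<Sum>j\<in>?R. b j * D i j)" if "i \<in> {1..n} - I" for i
      unfolding sum_b by (rule order_trans[OF N(2)], rule Min_le) (use that in auto)
    moreover have "\<forall>i. \<bar>b i\<bar> \<le> real N" unfolding b_def by (rule truncated_parameter) (use N in blast)
    moreover have "b (Suc (card I)) = - 1" using c by (simp add: b_def)
    ultimately show "\<exists>N c. (\<forall>i. \<bar>c i\<bar> \<le> real N) \<and> ?P N c D"
      using c sum_b by (intro exI[of _ N] exI[of _ b]) metis
  next
    assume "\<exists>N c. (\<forall>i. \<bar>c i\<bar> \<le> real N) \<and> ?P N c D"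
    then obtain N c where c: "?P N c D" by blast
    have "inverse (real (Suc N)) > 0" by simp
    then have "\<forall>i\<in>{1..n} - I. (\<Sum>j\<in>?R. c j * D i j) > 0" using c less_le_trans by blast
    then show "dual n D I" using c unfolding dual_def by blast
  qed
qed

lemma borel_optimal:
  assumes "finite I" shows "{D. optimal n D I} \<in> sets borel"
proof -
  have "{D. optimal n D I} = {D. indep_cols D I} \<inter> {D. primal D I} \<inter> {D. dual n D I}"
    by (auto simp: optimal_def)
  then show ?thesis using borel_indep_cols borel_primal borel_dual assms by auto
qed

section \<open>Independent normal coordinates\<close>

abbreviation lebesgue_prod :: "(nat \<times> nat) set \<Rightarrow> ((nat \<times> nat) \<Rightarrow> real) measure" where
  "lebesgue_prod A \<equiv> PiM A (\<lambda>_. lborel)"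

text \<open>Entry \<open>(i, j)\<close> is coordinate \<open>j\<close> of vector number
  \<open>i\<close>. The heights, \<open>j = 0\<close>, are half-normal, so each vector is a Gaussian
  one conditioned to lie in the half-space.\<close>

definition coord_density :: "nat \<times> nat \<Rightarrow> real \<Rightarrow> real" where
  "coord_density a x =
     (if snd a = 0 then 2 * std_normal_density x * indicator {0<..} x else std_normal_density x)"

definition coord :: "nat \<times> nat \<Rightarrow> real measure" where
  "coord a = density lborel (\<lambda>x. ennreal (coord_density a x))"

lemma coord_density_nonneg [simp]: "coord_density a x \<ge> 0"
  by (simp add: coord_density_def)

lemma borel_measurable_coord_density [measurable]: "coord_density a \<in> borel_measurable borel"
  unfolding coord_density_def[abs_def] by measurable

lemma sets_coord [simp, measurable_cong]: "sets (coord a) = sets borel"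
  by (simp add: coord_def)

lemma space_coord [simp]: "space (coord a) = UNIV"
  by (simp add: coord_def)

lemma sets_PiM_coord: "sets (PiM A coord) = sets (PiM A (\<lambda>_. borel))"
  by (intro sets_PiM_cong) auto

lemma sets_lebesgue_prod: "sets (lebesgue_prod A) = sets (PiM A coord)"
  by (intro sets_PiM_cong) auto

lemma measurable_PiM_coord_iff: "f \<in> borel_measurable (PiM A coord) \<longleftrightarrow> f \<in> borel_measurable (lebesgue_prod A)"
  by (intro arg_cong[of _ _ "\<lambda>X. f \<in> X"] measurable_cong_sets sets_lebesgue_prod[symmetric] refl)

lemma nn_integral_std_normal: "(\<integral>\<^sup>+x. ennreal (std_normal_density x) \<partial>lborel) = 1"
  using prob_space.emeasure_space_1[OF prob_space_normal_density[of 1 0]]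
  by (simp add: emeasure_density)

lemma std_normal_density_even: "std_normal_density (- x) = std_normal_density x"
  by (simp add: std_normal_density_def)

lemma prob_space_coord: "prob_space (coord a)"
proof (cases "snd a = 0")
  case True
  have pos: "(\<integral>\<^sup>+x. ennreal (std_normal_density x) * indicator {0<..} x \<partial>lborel) =
      (\<integral>\<^sup>+x. ennreal (std_normal_density x) * indicator {..<0} x \<partial>lborel)"
    by (subst nn_integral_real_affine[where c = "-1" and t = 0])
      (auto simp: std_normal_density_even indicator_def intro!: nn_integral_cong)
  have "(1::ennreal) = (\<integral>\<^sup>+x. ennreal (std_normal_density x) * indicator {0<..} x +
      ennreal (std_normal_density x) * indicator {..<0} x \<partial>lborel)"
    unfolding nn_integral_std_normal[symmetric]
  proof (rule nn_integral_cong_AE)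
    have "AE x in lborel. x \<noteq> (0::real)" by (rule AE_lborel_singleton)
    then show "AE x in lborel. ennreal (std_normal_density x) =
        ennreal (std_normal_density x) * indicator {0<..} x + ennreal (std_normal_density x) * indicator {..<0} x"
      by eventually_elim (auto simp: indicator_def)
  qed
  also have "\<dots> = 2 * (\<integral>\<^sup>+x. ennreal (std_normal_density x) * indicator {0<..} x \<partial>lborel)"
    by (subst nn_integral_add) (simp_all add: pos mult_2)
  also have "\<dots> = (\<integral>\<^sup>+x. ennreal (coord_density a x) \<partial>lborel)"
    by (subst nn_integral_cmult[symmetric])
      (auto simp: coord_density_def True indicator_def ennreal_mult intro!: nn_integral_cong)
  finally show ?thesis unfolding coord_def by (intro prob_spaceI) (simp add: emeasure_density)
next
  case False
  then show ?thesis unfolding coord_def coord_density_def[abs_def] by (simp add: prob_space_normal_density)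
qed

lemma emeasure_coord_UNIV [simp]: "emeasure (coord a) UNIV = 1"
  using prob_space.emeasure_space_1[OF prob_space_coord, of a] by simp

interpretation coords: product_prob_space coord UNIV
  by unfold_locales (auto intro!: exI[of _ "{UNIV}"])

interpretation lborels: product_sigma_finite "\<lambda>_::nat \<times> nat. lborel :: real measure"
  by unfold_locales

text \<open>Passes to Lebesgue measure, where affine substitutions are available.\<close>

lemma nn_integral_PiM_coord:
  assumes "finite A" "f \<in> borel_measurable (lebesgue_prod A)"
  shows "(\<integral>\<^sup>+g. f g \<partial>PiM A coord) = (\<integral>\<^sup>+g. (\<Prod>a\<in>A. ennreal (coord_density a (g a))) * f g \<partial>lebesgue_prod A)"
  using assms
proof (induction A arbitrary: f rule: finite_induct)
  case empty
  then show ?case by (simp add: nn_integral_count_space_finite PiM_empty)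
next
  case (insert a A)
  note f [measurable] = insert.prems
  have f' [measurable]: "f \<in> borel_measurable (PiM (insert a A) coord)"
    using f by (simp add: measurable_PiM_coord_iff)
  have "(\<integral>\<^sup>+g. f g \<partial>PiM (insert a A) coord) = (\<integral>\<^sup>+x. (\<integral>\<^sup>+y. f (x(a := y)) \<partial>coord a) \<partial>PiM A coord)"
    by (rule coords.product_nn_integral_insert) (use insert f' in auto)
  also have "\<dots> = (\<integral>\<^sup>+x. (\<integral>\<^sup>+y. ennreal (coord_density a y) * f (x(a := y)) \<partial>lborel) \<partial>PiM A coord)"
  proof (rule nn_integral_cong)
    fix x assume "x \<in> space (PiM A coord)"
    then have x [measurable]: "x \<in> space (lebesgue_prod A)" by (simp add: space_PiM)
    have "(\<lambda>y. f (x(a := y))) \<in> borel_measurable lborel"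
      using measurable_comp[OF measurable_component_update[OF x insert.hyps(2)] f] by (simp add: comp_def)
    then show "(\<integral>\<^sup>+y. f (x(a := y)) \<partial>coord a) = (\<integral>\<^sup>+y. ennreal (coord_density a y) * f (x(a := y)) \<partial>lborel)"
      unfolding coord_def by (subst nn_integral_density) auto
  qed
  also have "\<dots> = (\<integral>\<^sup>+x. (\<Prod>b\<in>A. ennreal (coord_density b (x b))) *
      (\<integral>\<^sup>+y. ennreal (coord_density a y) * f (x(a := y)) \<partial>lborel) \<partial>lebesgue_prod A)"
    using insert.hyps by (intro insert.IH) measurable
  also have "\<dots> = (\<integral>\<^sup>+x. (\<integral>\<^sup>+y. (\<Prod>b\<in>insert a A. ennreal (coord_density b ((x(a := y)) b))) * f (x(a := y)) \<partial>lborel) \<partial>lebesgue_prod A)"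
  proof (rule nn_integral_cong)
    fix x assume x: "x \<in> space (lebesgue_prod A)"
    have [measurable]: "(\<lambda>y. f (x(a := y))) \<in> borel_measurable lborel"
      using measurable_comp[OF measurable_component_update[OF x insert.hyps(2)] f] by (simp add: comp_def)
    have "(\<Prod>b\<in>insert a A. ennreal (coord_density b ((x(a := y)) b))) =
        (\<Prod>b\<in>A. ennreal (coord_density b (x b))) * ennreal (coord_density a y)" for y
    proof -
      have "(\<Prod>b\<in>A. ennreal (coord_density b ((x(a := y)) b))) = (\<Prod>b\<in>A. ennreal (coord_density b (x b)))"
        using insert.hyps by (intro prod.cong) auto
      then show ?thesis using insert.hyps by (simp add: mult.commute)
    qed
    then show "(\<Prod>b\<in>A. ennreal (coord_density b (x b))) * (\<integral>\<^sup>+y. ennreal (coord_density a y) * f (x(a := y)) \<partial>lborel) =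
        (\<integral>\<^sup>+y. (\<Prod>b\<in>insert a A. ennreal (coord_density b ((x(a := y)) b))) * f (x(a := y)) \<partial>lborel)"
      by (subst nn_integral_cmult[symmetric]) (auto simp: mult.assoc)
  qed
  also have "\<dots> = (\<integral>\<^sup>+g. (\<Prod>b\<in>insert a A. ennreal (coord_density b (g b))) * f g \<partial>lebesgue_prod (insert a A))"
    using insert.hyps by (intro lborels.product_nn_integral_insert[symmetric]) auto
  finally show ?case .
qed

text \<open>\<open>t\<close> and \<open>s\<close> may depend on coordinates outside \<open>A\<close>
  that are held fixed; applied block by block, this gives triangular changes of variables.\<close>

lemma nn_integral_lebesgue_prod_affine:
  assumes "finite A" "f \<in> borel_measurable (lebesgue_prod A)" "\<And>a. a \<in> A \<Longrightarrow> s a \<noteq> 0"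
  shows "(\<integral>\<^sup>+g. f g \<partial>lebesgue_prod A) =
    (\<Prod>a\<in>A. ennreal \<bar>s a\<bar>) * (\<integral>\<^sup>+g. f (\<lambda>a\<in>A. t a + s a * g a) \<partial>lebesgue_prod A)"
  using assms
proof (induction A arbitrary: f rule: finite_induct)
  case empty
  then show ?case by (simp add: PiM_empty nn_integral_count_space_finite)
next
  case (insert a A)
  note f [measurable] = insert.prems(1)
  have upd: "(\<lambda>y. f (x(a := y))) \<in> borel_measurable lborel" if "x \<in> space (lebesgue_prod A)" for x
    using measurable_comp[OF measurable_component_update[OF that insert.hyps(2)] f] by (simp add: comp_def)
  have maps: "(\<lambda>g. \<lambda>a\<in>A'. t a + s a * g a) \<in> measurable (lebesgue_prod A') (lebesgue_prod A')" for A'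
    by measurable
  have "(\<integral>\<^sup>+g. f g \<partial>lebesgue_prod (insert a A)) = (\<integral>\<^sup>+x. (\<integral>\<^sup>+y. f (x(a := y)) \<partial>lborel) \<partial>lebesgue_prod A)"
    using insert.hyps by (intro lborels.product_nn_integral_insert f) auto
  also have "\<dots> = (\<Prod>a\<in>A. ennreal \<bar>s a\<bar>) *
      (\<integral>\<^sup>+x. (\<integral>\<^sup>+y. f ((\<lambda>a\<in>A. t a + s a * x a)(a := y)) \<partial>lborel) \<partial>lebesgue_prod A)"
  proof (rule insert.IH)
    show "(\<lambda>x. \<integral>\<^sup>+y. f (x(a := y)) \<partial>lborel) \<in> borel_measurable (lebesgue_prod A)"
      using insert.hyps by measurable
  qed (use insert.prems(2) in auto)
  also have "(\<integral>\<^sup>+x. (\<integral>\<^sup>+y. f ((\<lambda>a\<in>A. t a + s a * x a)(a := y)) \<partial>lborel) \<partial>lebesgue_prod A) =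
      (\<integral>\<^sup>+x. ennreal \<bar>s a\<bar> * (\<integral>\<^sup>+y. f (\<lambda>b\<in>insert a A. t b + s b * (x(a := y)) b) \<partial>lborel) \<partial>lebesgue_prod A)"
  proof (rule nn_integral_cong)
    fix x assume x: "x \<in> space (lebesgue_prod A)"
    have x': "(\<lambda>a\<in>A. t a + s a * x a) \<in> space (lebesgue_prod A)"
      using measurable_space[OF maps x] .
    have eq: "(\<lambda>a\<in>A. t a + s a * x a)(a := t a + s a * y) = (\<lambda>b\<in>insert a A. t b + s b * (x(a := y)) b)" for y
      using insert.hyps by (auto simp: fun_eq_iff)
    show "(\<integral>\<^sup>+y. f ((\<lambda>a\<in>A. t a + s a * x a)(a := y)) \<partial>lborel) =
      ennreal \<bar>s a\<bar> * (\<integral>\<^sup>+y. f (\<lambda>b\<in>insert a A. t b + s b * (x(a := y)) b) \<partial>lborel)"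
      by (subst nn_integral_real_affine[where c = "s a" and t = "t a"])
        (use upd[OF x'] insert.prems(2) eq in auto)
  qed
  also have "\<dots> = ennreal \<bar>s a\<bar> * (\<integral>\<^sup>+x. (\<integral>\<^sup>+y. f (\<lambda>b\<in>insert a A. t b + s b * (x(a := y)) b) \<partial>lborel) \<partial>lebesgue_prod A)"
    by (rule nn_integral_cmult) measurable
  also have "(\<integral>\<^sup>+x. (\<integral>\<^sup>+y. f (\<lambda>b\<in>insert a A. t b + s b * (x(a := y)) b) \<partial>lborel) \<partial>lebesgue_prod A) =
      (\<integral>\<^sup>+g. f (\<lambda>b\<in>insert a A. t b + s b * g b) \<partial>lebesgue_prod (insert a A))"
    using insert.hyps measurable_comp[OF maps f]
    by (intro lborels.product_nn_integral_insert[symmetric]) (auto simp: comp_def)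
  finally show ?case
    unfolding prod.insert[OF insert.hyps(1,2)] by (simp only: mult_ac)
qed

lemma prob_space_PiM_coord: "prob_space (PiM A coord)"
  by (intro prob_space_PiM prob_space_coord)

lemma measurable_coordinate:
  assumes "\<And>a. sets (M a) = sets (borel :: 'b::topological_space measure)"
  shows "(\<lambda>g. g a) \<in> borel_measurable (PiM A M)"
proof (cases "a \<in> A")
  case True
  have "(\<lambda>g. g a) \<in> measurable (PiM A M) (M a)" using True by (rule measurable_component_singleton)
  then show ?thesis using measurable_cong_sets[OF refl assms] by blast
next
  case False
  then show ?thesis
    by (subst measurable_cong[where g = "\<lambda>_. undefined"]) (auto simp: space_PiM PiE_def extensional_def)
qed

lemma distr_coordinate:
  assumes "finite A" "a \<in> A"
  shows "distr (PiM A coord) borel (\<lambda>g. g a) = coord a"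
proof -
  interpret A: product_prob_space coord A
    by unfold_locales (auto intro!: exI[of _ "{UNIV}"])
  have "distr (PiM A coord) borel (\<lambda>g. g a) = distr (PiM A coord) (coord a) (\<lambda>g. g a)"
    by (rule distr_cong) auto
  then show ?thesis using A.PiM_component[OF assms(2)] by simp
qed

lemma indep_vars_coordinates:
  assumes "finite A" "A \<noteq> {}"
  shows "prob_space.indep_vars (PiM A coord) (\<lambda>_. borel) (\<lambda>a g. g a) A"
proof -
  interpret prob_space "PiM A coord" by (rule prob_space_PiM_coord)
  have "distr (PiM A coord) (PiM A (\<lambda>_. borel)) (\<lambda>g. \<lambda>a\<in>A. g a) = distr (PiM A coord) (PiM A coord) (\<lambda>g. g)"
    by (rule distr_cong) (auto simp: sets_PiM_coord space_PiM PiE_def extensional_restrict)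
  also have "\<dots> = PiM A coord" by (rule distr_id2) simp
  also have "\<dots> = PiM A (\<lambda>a. distr (PiM A coord) borel (\<lambda>g. g a))"
    using distr_coordinate[OF assms(1)] by (intro PiM_cong) auto
  finally show ?thesis using assms measurable_coordinate[of coord]
    by (subst indep_vars_iff_distr_eq_PiM') auto
qed

lemma distributed_linear_form:
  fixes c :: "nat \<times> nat \<Rightarrow> real"
  assumes J: "finite J" "\<And>a. a \<in> J \<Longrightarrow> snd a \<noteq> 0" and c: "\<exists>a\<in>J. c a \<noteq> 0"
  shows "distributed (PiM J coord) lborel (\<lambda>g. (\<Sum>a\<in>J. c a * g a) / sqrt (\<Sum>a\<in>J. (c a)\<^sup>2)) std_normal_density"
proof -
  interpret prob_space "PiM J coord" by (rule prob_space_PiM_coord)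
  \<comment> \<open>A normal law needs positive variance, so the terms with zero coefficient are
    removed before summing.\<close>
  define K where "K = {a\<in>J. c a \<noteq> 0}"
  have K: "finite K" "K \<noteq> {}" "K \<subseteq> J" using J c by (auto simp: K_def)
  have indep: "indep_vars (\<lambda>_. borel) (\<lambda>a g. c a * g a) K"
    using indep_vars_subset[OF indep_vars_coordinates K(3)] J K
    by (intro indep_vars_compose2[where Y = "\<lambda>a x. c a * x" and X = "\<lambda>a g. g a"]) auto
  have dist: "distributed (PiM J coord) lborel (\<lambda>g. c a * g a) (normal_density 0 \<bar>c a\<bar>)" if a: "a \<in> K" for a
  proof -
    have "distributed (PiM J coord) lborel (\<lambda>g. g a) std_normal_density"
      unfolding distributed_def
    proof (intro conjI)
      have "distr (PiM J coord) lborel (\<lambda>g. g a) = distr (PiM J coord) borel (\<lambda>g. g a)"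
        by (rule distr_cong) auto
      also have "\<dots> = coord a" using a K J by (intro distr_coordinate) auto
      also have "\<dots> = density lborel (\<lambda>x. ennreal (std_normal_density x))"
        using J(2)[of a] a K by (auto simp: coord_def coord_density_def)
      finally show "distr (PiM J coord) lborel (\<lambda>g. g a) = density lborel (\<lambda>x. ennreal (std_normal_density x))" .
    qed (use measurable_coordinate[of coord] in auto)
    then have "distributed (PiM J coord) lborel (\<lambda>g. 0 + c a * g a) (normal_density (0 + c a * 0) (\<bar>c a\<bar> * 1))"
      using a by (intro normal_density_affine) (auto simp: K_def)
    then show ?thesis by simp
  qed
  have "distributed (PiM J coord) lborel (\<lambda>g. \<Sum>a\<in>K. c a * g a)
      (normal_density (\<Sum>a\<in>K. 0) (sqrt (\<Sum>a\<in>K. \<bar>c a\<bar>\<^sup>2)))"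
    using K indep dist by (intro sum_indep_normal) (auto simp: K_def)
  moreover have "(\<Sum>a\<in>K. c a * g a) = (\<Sum>a\<in>J. c a * g a)" for g :: "nat \<times> nat \<Rightarrow> real"
    using J by (intro sum.mono_neutral_left) (auto simp: K_def)
  moreover have "(\<Sum>a\<in>K. \<bar>c a\<bar>\<^sup>2) = (\<Sum>a\<in>J. (c a)\<^sup>2)"
    using J by (subst power2_abs, intro sum.mono_neutral_left) (auto simp: K_def)
  ultimately have "distributed (PiM J coord) lborel (\<lambda>g. \<Sum>a\<in>J. c a * g a)
      (normal_density 0 (sqrt (\<Sum>a\<in>J. (c a)\<^sup>2)))" by simp
  moreover have "0 < sqrt (\<Sum>a\<in>J. (c a)\<^sup>2)"
    using J c by (auto intro: sum_pos2)
  ultimately show ?thesis by (subst (asm) normal_standard_normal_convert) simp_all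
qed

section \<open>The angle under which a random column is seen\<close>

text \<open>For a half-normal \<open>h\<close> and an independent standard normal \<open>x\<close>
  the direction of \<open>(h, x)\<close> is uniform on a half-circle, and
  \<open>t * h + x > 0\<close> cuts out the angle \<open>pi / 2 + arctan t\<close>.\<close>

definition angle_prob :: "real \<Rightarrow> real" where
  "angle_prob t = 1 / 2 + arctan t / pi"

lemma angle_prob_nonneg: "angle_prob t \<ge> 0"
proof -
  have "- (pi / 2) / pi \<le> arctan t / pi"
    using arctan_lbound[of t] by (intro divide_right_mono) auto
  then show ?thesis by (simp add: angle_prob_def)
qed

lemma borel_measurable_angle_prob [measurable]: "angle_prob \<in> borel_measurable borel"
  unfolding angle_prob_def[abs_def] by measurable

lemma nn_integral_x_exp_square:
  assumes "a > 0"
  shows "(\<integral>\<^sup>+x. ennreal (x * exp (- a * x\<^sup>2 / 2)) * indicator {0..} x \<partial>lborel) = ennreal (1 / a)"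
proof -
  have "(\<integral>\<^sup>+x. ennreal (x * exp (- a * x\<^sup>2 / 2)) * indicator {0..} x \<partial>lborel) =
      ennreal (0 - (- exp (- a * 0\<^sup>2 / 2) / a))"
  proof (rule nn_integral_FTC_atLeast)
    show "((\<lambda>x. - exp (- a * x\<^sup>2 / 2) / a) has_real_derivative x * exp (- a * x\<^sup>2 / 2)) (at x)" for x
      using assms by (auto intro!: derivative_eq_intros simp: field_simps)
    have "LIM x at_top. (a / 2) * x\<^sup>2 :> at_top"
      using assms
      by (intro filterlim_tendsto_pos_mult_at_top[OF tendsto_const] filterlim_pow_at_top filterlim_ident) auto
    then have "((\<lambda>x. exp (- ((a / 2) * x\<^sup>2))) \<longlongrightarrow> 0) at_top"
      by (intro filterlim_compose[OF exp_at_bot] filterlim_compose[OF filterlim_uminus_at_bot_at_top])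
    then have "((\<lambda>x. exp (- a * x\<^sup>2 / 2)) \<longlongrightarrow> 0) at_top" by simp
    then have "((\<lambda>x. - exp (- a * x\<^sup>2 / 2) / a) \<longlongrightarrow> - 0 / a) at_top"
      using assms by (intro tendsto_divide tendsto_minus tendsto_const) auto
    then show "((\<lambda>x. - exp (- a * x\<^sup>2 / 2) / a) \<longlongrightarrow> 0) at_top" by simp
  qed auto
  then show ?thesis by simp
qed

lemma nn_integral_arctan_deriv:
  "(\<integral>\<^sup>+x. ennreal (1 / (pi * (1 + x\<^sup>2))) * indicator {a..} x \<partial>lborel) = ennreal (angle_prob (- a))"
proof -
  have "(\<integral>\<^sup>+x. ennreal (1 / (pi * (1 + x\<^sup>2))) * indicator {a..} x \<partial>lborel) =
      ennreal ((pi / 2) / pi - arctan a / pi)"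
  proof (rule nn_integral_FTC_atLeast)
    show "((\<lambda>x. arctan x / pi) has_real_derivative 1 / (pi * (1 + x\<^sup>2))) (at x)" for x
      using DERIV_cdivide[OF DERIV_arctan, of pi x] by (simp add: divide_inverse mult.commute)
    show "((\<lambda>x. arctan x / pi) \<longlongrightarrow> (pi / 2) / pi) at_top"
      by (intro tendsto_divide tendsto_arctan_at_top tendsto_const) simp
    show "0 \<le> 1 / (pi * (1 + x\<^sup>2))" for x :: real by (simp add: add_nonneg_pos)
    show "(\<lambda>x::real. 1 / (pi * (1 + x\<^sup>2))) \<in> borel_measurable borel" by measurable
  qed
  then show ?thesis by (simp add: angle_prob_def arctan_minus)
qed

text \<open>Substituting \<open>x = s h\<close> for fixed \<open>h\<close> makes the inner integral over \<open>h\<close> elementary.\<close>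

lemma half_plane_probability:
  assumes \<sigma>: "\<sigma> > 0"
  shows "(\<integral>\<^sup>+x. ennreal (std_normal_density x) *
      (\<integral>\<^sup>+h. ennreal (2 * std_normal_density h * indicator {0<..} h) *
        indicator {0<..} (c * h + \<sigma> * x) \<partial>lborel) \<partial>lborel) = ennreal (angle_prob (c / \<sigma>))"
proof -
  have dens: "std_normal_density h * std_normal_density (s * h) = exp (- (1 + s\<^sup>2) * h\<^sup>2 / 2) / (2 * pi)" for s h
    by (simp add: std_normal_density_def exp_add[symmetric] power_mult_distrib field_simps real_sqrt_mult)
  have "(\<integral>\<^sup>+x. ennreal (std_normal_density x) *
      (\<integral>\<^sup>+h. ennreal (2 * std_normal_density h * indicator {0<..} h) *
        indicator {0<..} (c * h + \<sigma> * x) \<partial>lborel) \<partial>lborel) =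
    (\<integral>\<^sup>+x. (\<integral>\<^sup>+h. ennreal (std_normal_density x) * (ennreal (2 * std_normal_density h * indicator {0<..} h) *
        indicator {0<..} (c * h + \<sigma> * x)) \<partial>lborel) \<partial>lborel)"
    by (intro nn_integral_cong nn_integral_cmult[symmetric]) measurable
  also have "\<dots> = (\<integral>\<^sup>+h. (\<integral>\<^sup>+x. ennreal (std_normal_density x) * (ennreal (2 * std_normal_density h * indicator {0<..} h) *
        indicator {0<..} (c * h + \<sigma> * x)) \<partial>lborel) \<partial>lborel)"
    by (rule lborel_pair.Fubini') measurable
  also have "\<dots> = (\<integral>\<^sup>+h. (\<integral>\<^sup>+s. ennreal (h * exp (- (1 + s\<^sup>2) * h\<^sup>2 / 2)) * indicator {0<..} h *
      (ennreal (1 / pi) * indicator {- c / \<sigma><..} s) \<partial>lborel) \<partial>lborel)"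
  proof (rule nn_integral_cong)
    fix h :: real
    show "(\<integral>\<^sup>+x. ennreal (std_normal_density x) * (ennreal (2 * std_normal_density h * indicator {0<..} h) *
        indicator {0<..} (c * h + \<sigma> * x)) \<partial>lborel) =
      (\<integral>\<^sup>+s. ennreal (h * exp (- (1 + s\<^sup>2) * h\<^sup>2 / 2)) * indicator {0<..} h *
      (ennreal (1 / pi) * indicator {- c / \<sigma><..} s) \<partial>lborel)"
    proof (cases "h > 0")
      case True
      have "c * h + \<sigma> * (h * s) > 0 \<longleftrightarrow> s > - c / \<sigma>" for s
      proof -
        have "c * h + \<sigma> * (h * s) = h * \<sigma> * (c / \<sigma> + s)" using \<sigma> by (simp add: field_simps)
        moreover have "h * \<sigma> > 0" using True \<sigma> by simp
        ultimately have "c * h + \<sigma> * (h * s) > 0 \<longleftrightarrow> c / \<sigma> + s > 0"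
          by (metis mult_pos_pos zero_less_mult_pos)
        then show ?thesis by linarith
      qed
      then have ind: "indicator {0<..} (c * h + \<sigma> * (h * s)) = (indicator {- c / \<sigma><..} s :: ennreal)" for s
        by (simp add: indicator_def)
      have "(\<integral>\<^sup>+x. ennreal (std_normal_density x) * (ennreal (2 * std_normal_density h * indicator {0<..} h) *
          indicator {0<..} (c * h + \<sigma> * x)) \<partial>lborel) =
        ennreal \<bar>h\<bar> * (\<integral>\<^sup>+s. ennreal (std_normal_density (0 + h * s)) * (ennreal (2 * std_normal_density h * indicator {0<..} h) *
          indicator {0<..} (c * h + \<sigma> * (0 + h * s))) \<partial>lborel)"
      proof (subst nn_integral_real_affine[where c = h and t = 0])
        show "(\<lambda>x. ennreal (std_normal_density x) * (ennreal (2 * std_normal_density h * indicator {0<..} h) *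
          indicator {0<..} (c * h + \<sigma> * x))) \<in> borel_measurable borel" by measurable
      qed (use True in auto)
      also have "\<dots> = (\<integral>\<^sup>+s. ennreal \<bar>h\<bar> * (ennreal (std_normal_density (0 + h * s)) * (ennreal (2 * std_normal_density h * indicator {0<..} h) *
          indicator {0<..} (c * h + \<sigma> * (0 + h * s)))) \<partial>lborel)"
        by (intro nn_integral_cmult[symmetric]) measurable
      also have "\<dots> = (\<integral>\<^sup>+s. ennreal (h * exp (- (1 + s\<^sup>2) * h\<^sup>2 / 2)) * indicator {0<..} h *
        (ennreal (1 / pi) * indicator {- c / \<sigma><..} s) \<partial>lborel)"
      proof (rule nn_integral_cong)
        fix s :: real
        have "\<bar>h\<bar> * (std_normal_density (0 + h * s) * (2 * std_normal_density h)) =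
            h * exp (- (1 + s\<^sup>2) * h\<^sup>2 / 2) * (1 / pi)"
          using True dens[of h s] by (simp add: mult_ac)
        moreover have "ennreal \<bar>h\<bar> * (ennreal (std_normal_density (0 + h * s)) * ennreal (2 * std_normal_density h)) =
            ennreal (\<bar>h\<bar> * (std_normal_density (0 + h * s) * (2 * std_normal_density h)))"
          by (subst ennreal_mult[symmetric]; simp)+
        moreover have "ennreal (h * exp (- (1 + s\<^sup>2) * h\<^sup>2 / 2)) * ennreal (1 / pi) =
            ennreal (h * exp (- (1 + s\<^sup>2) * h\<^sup>2 / 2) * (1 / pi))"
          using True by (intro ennreal_mult[symmetric]) auto
        ultimately have "ennreal \<bar>h\<bar> * (ennreal (std_normal_density (0 + h * s)) * ennreal (2 * std_normal_density h)) =
            ennreal (h * exp (- (1 + s\<^sup>2) * h\<^sup>2 / 2)) * ennreal (1 / pi)" by simp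
        moreover have "2 * std_normal_density h * indicator {0<..} h = 2 * std_normal_density h"
          "indicator {0<..} h = (1::ennreal)"
          using True by (simp_all add: indicator_def)
        ultimately show "ennreal \<bar>h\<bar> * (ennreal (std_normal_density (0 + h * s)) * (ennreal (2 * std_normal_density h * indicator {0<..} h) *
          indicator {0<..} (c * h + \<sigma> * (0 + h * s)))) = ennreal (h * exp (- (1 + s\<^sup>2) * h\<^sup>2 / 2)) * indicator {0<..} h *
          (ennreal (1 / pi) * indicator {- c / \<sigma><..} s)"
          unfolding add_0_left ind by (simp only: mult_1_right mult.assoc[symmetric])
      qed
      finally show ?thesis .
    qed auto
  qed
  also have "\<dots> = (\<integral>\<^sup>+s. (\<integral>\<^sup>+h. ennreal (h * exp (- (1 + s\<^sup>2) * h\<^sup>2 / 2)) * indicator {0<..} h *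
      (ennreal (1 / pi) * indicator {- c / \<sigma><..} s) \<partial>lborel) \<partial>lborel)"
    by (rule lborel_pair.Fubini') measurable
  also have "\<dots> = (\<integral>\<^sup>+s. ennreal (1 / (pi * (1 + s\<^sup>2))) * indicator {- c / \<sigma>..} s \<partial>lborel)"
  \<comment> \<open>The open half-line is closed at the cost of a null set, to match
    \<open>nn_integral_arctan_deriv\<close>.\<close>
  proof (rule nn_integral_cong_AE)
    have "AE s in lborel. s \<noteq> - c / \<sigma>" by (rule AE_lborel_singleton)
    then show "AE s in lborel. (\<integral>\<^sup>+h. ennreal (h * exp (- (1 + s\<^sup>2) * h\<^sup>2 / 2)) * indicator {0<..} h *
      (ennreal (1 / pi) * indicator {- c / \<sigma><..} s) \<partial>lborel) =
      ennreal (1 / (pi * (1 + s\<^sup>2))) * indicator {- c / \<sigma>..} s"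
    proof eventually_elim
      case (elim s)
      have "(\<integral>\<^sup>+h. ennreal (h * exp (- (1 + s\<^sup>2) * h\<^sup>2 / 2)) * indicator {0<..} h *
          (ennreal (1 / pi) * indicator {- c / \<sigma><..} s) \<partial>lborel) =
        (\<integral>\<^sup>+h. ennreal (h * exp (- (1 + s\<^sup>2) * h\<^sup>2 / 2)) * indicator {0..} h *
          (ennreal (1 / pi) * indicator {- c / \<sigma><..} s) \<partial>lborel)"
        by (intro nn_integral_cong) (auto simp: indicator_def)
      also have "\<dots> = (\<integral>\<^sup>+h. ennreal (h * exp (- (1 + s\<^sup>2) * h\<^sup>2 / 2)) * indicator {0..} h \<partial>lborel) *
          (ennreal (1 / pi) * indicator {- c / \<sigma><..} s)"
        by (rule nn_integral_multc) measurable
      also have "(\<integral>\<^sup>+h. ennreal (h * exp (- (1 + s\<^sup>2) * h\<^sup>2 / 2)) * indicator {0..} h \<partial>lborel) = ennreal (1 / (1 + s\<^sup>2))"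
        by (rule nn_integral_x_exp_square) (simp add: add_pos_nonneg)
      also have "\<dots> * (ennreal (1 / pi) * indicator {- c / \<sigma><..} s) =
          ennreal (1 / (pi * (1 + s\<^sup>2))) * indicator {- c / \<sigma>..} s"
        using elim by (auto simp: indicator_def ennreal_mult'[symmetric] mult.commute)
      finally show ?case .
    qed
  qed
  also have "\<dots> = ennreal (angle_prob (c / \<sigma>))" by (simp add: nn_integral_arctan_deriv)
  finally show ?thesis .
qed

definition cols :: "(nat \<times> nat \<Rightarrow> real) \<Rightarrow> nat \<Rightarrow> nat \<Rightarrow> real" where
  "cols g i j = g (i, j) - g (i, 0) / g (0, 0) * g (0, j)"

lemma measurable_cols:
  assumes "\<And>a. sets (M a) = sets (borel :: real measure)"
  shows "cols \<in> borel_measurable (PiM A M)"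
proof (rule measurable_coordinatewise_then_product, rule measurable_coordinatewise_then_product)
  note [measurable] = measurable_coordinate[OF assms]
  show "(\<lambda>g. cols g i j) \<in> borel_measurable (PiM A M)" for i j
    unfolding cols_def by measurable
qed

lemma merge_apply:
  "a \<in> A \<Longrightarrow> merge A B (x, y) a = x a"
  "A \<inter> B = {} \<Longrightarrow> a \<in> B \<Longrightarrow> merge A B (x, y) a = y a"
  by (auto simp: merge_def)

text \<open>The coordinates from 1 on contribute a centred normal variable of deviation
  \<open>\<sigma>\<close>, independent of the half-normal height, so
  \<open>half_plane_probability\<close> applies with slope \<open>c 0 / \<sigma>\<close>.\<close>

lemma column_probability:
  assumes c: "\<exists>j\<in>{1..m}. c j \<noteq> 0"
  shows "(\<integral>\<^sup>+g. indicator {0<..} (\<Sum>j\<in>{0..m}. c j * g (i, j)) \<partial>PiM ({i} \<times> {0..m}) coord) =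
    ennreal (angle_prob (c 0 / sqrt (\<Sum>j\<in>{1..m}. (c j)\<^sup>2)))"
proof -
  define J where "J = {i} \<times> {1..m}"
  define \<sigma> where "\<sigma> = sqrt (\<Sum>j\<in>{1..m}. (c j)\<^sup>2)"
  have J: "finite J" "(i, 0) \<notin> J" by (auto simp: J_def)
  have split: "{i} \<times> {0..m} = insert (i, 0) J" by (auto simp: J_def)
  have \<sigma>: "\<sigma> > 0" unfolding \<sigma>_def using c by (auto intro: sum_pos2)
  have sum_J: "(\<Sum>a\<in>J. f a) = (\<Sum>j\<in>{1..m}. f (i, j))" for f :: "nat \<times> nat \<Rightarrow> real"
  proof -
    have "J = Pair i ` {1..m}" by (auto simp: J_def)
    then show ?thesis by (simp add: sum.reindex inj_on_def)
  qed
  note [measurable] = measurable_coordinate[of coord]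
  have eq: "(\<Sum>j\<in>{0..m}. c j * (x((i, 0) := h)) (i, j)) =
      c 0 * h + \<sigma> * ((\<Sum>a\<in>J. c (snd a) * x a) / sqrt (\<Sum>a\<in>J. (c (snd a))\<^sup>2))" for x h
  proof -
    have "(\<Sum>j\<in>{0..m}. c j * (x((i, 0) := h)) (i, j)) =
        c 0 * h + (\<Sum>j\<in>{1..m}. c j * (x((i, 0) := h)) (i, j))"
      by (simp add: sum.atLeast_Suc_atMost)
    also have "(\<Sum>j\<in>{1..m}. c j * (x((i, 0) := h)) (i, j)) = (\<Sum>a\<in>J. c (snd a) * x a)"
      unfolding sum_J by (intro sum.cong) auto
    finally have 1: "(\<Sum>j\<in>{0..m}. c j * (x((i, 0) := h)) (i, j)) = c 0 * h + (\<Sum>a\<in>J. c (snd a) * x a)" .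
    have 2: "sqrt (\<Sum>a\<in>J. (c (snd a))\<^sup>2) = \<sigma>" by (simp add: sum_J \<sigma>_def)
    show ?thesis unfolding 1 2 using \<sigma> by simp
  qed
  have "(\<integral>\<^sup>+g. indicator {0<..} (\<Sum>j\<in>{0..m}. c j * g (i, j)) \<partial>PiM ({i} \<times> {0..m}) coord) =
    (\<integral>\<^sup>+x. (\<integral>\<^sup>+h. indicator {0<..} (\<Sum>j\<in>{0..m}. c j * (x((i, 0) := h)) (i, j)) \<partial>coord (i, 0)) \<partial>PiM J coord)"
    unfolding split by (rule coords.product_nn_integral_insert) (use J in measurable)
  also have "\<dots> = (\<integral>\<^sup>+x. (\<integral>\<^sup>+h. indicator {0<..} (c 0 * h + \<sigma> * ((\<Sum>a\<in>J. c (snd a) * x a) / sqrt (\<Sum>a\<in>J. (c (snd a))\<^sup>2))) \<partial>coord (i, 0)) \<partial>PiM J coord)"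
    unfolding eq ..
  also have "\<dots> = (\<integral>\<^sup>+x. ennreal (std_normal_density x) * (\<integral>\<^sup>+h. indicator {0<..} (c 0 * h + \<sigma> * x) \<partial>coord (i, 0)) \<partial>lborel)"
  proof (rule distributed_nn_integral[symmetric])
    show "distributed (PiM J coord) lborel (\<lambda>x. (\<Sum>a\<in>J. c (snd a) * x a) / sqrt (\<Sum>a\<in>J. (c (snd a))\<^sup>2)) std_normal_density"
      using c J by (intro distributed_linear_form) (auto simp: J_def)
  qed measurable
  also have "\<dots> = (\<integral>\<^sup>+x. ennreal (std_normal_density x) *
      (\<integral>\<^sup>+h. ennreal (2 * std_normal_density h * indicator {0<..} h) * indicator {0<..} (c 0 * h + \<sigma> * x) \<partial>lborel) \<partial>lborel)"
    unfolding coord_def by (subst nn_integral_density) (auto simp: coord_density_def)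
  also have "\<dots> = ennreal (angle_prob (c 0 / \<sigma>))" by (rule half_plane_probability[OF \<sigma>])
  finally show ?thesis by (simp add: \<sigma>_def)
qed

lemma columns_probability:
  assumes "finite L" and c: "\<exists>j\<in>{1..m}. c j \<noteq> 0"
  shows "(\<integral>\<^sup>+g. (\<Prod>i\<in>L. indicator {0<..} (\<Sum>j\<in>{0..m}. c j * g (i, j))) \<partial>PiM (L \<times> {0..m}) coord) =
    ennreal (angle_prob (c 0 / sqrt (\<Sum>j\<in>{1..m}. (c j)\<^sup>2))) ^ card L"
  using assms(1)
proof (induction L rule: finite_induct)
  case empty
  then show ?case by (simp add: prob_space.emeasure_space_1[OF prob_space_PiM_coord])
next
  case (insert i L)
  note [measurable] = measurable_coordinate[of coord]
  let ?R = "{0..m}"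
  let ?F = "\<lambda>(l::nat) g. indicator {0<..} (\<Sum>j\<in>?R. c j * g (l, j)) :: ennreal"
  have split: "insert i L \<times> ?R = ({i} \<times> ?R) \<union> (L \<times> ?R)" by auto
  have disj: "({i} \<times> ?R) \<inter> (L \<times> ?R) = {}" using insert.hyps by auto
  have eq: "(\<Prod>l\<in>insert i L. ?F l (merge ({i} \<times> ?R) (L \<times> ?R) (x, y))) = ?F i x * (\<Prod>l\<in>L. ?F l y)" for x y
  proof -
    have "?F i (merge ({i} \<times> ?R) (L \<times> ?R) (x, y)) = ?F i x"
      by (intro arg_cong[of _ _ "indicator {0<..}"] sum.cong) (auto simp: merge_apply)
    moreover have "?F l (merge ({i} \<times> ?R) (L \<times> ?R) (x, y)) = ?F l y" if "l \<in> L" for l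
      using that disj by (intro arg_cong[of _ _ "indicator {0<..}"] sum.cong) (auto simp: merge_apply)
    ultimately show ?thesis using insert.hyps by simp
  qed
  have "(\<integral>\<^sup>+g. (\<Prod>l\<in>insert i L. ?F l g) \<partial>PiM (insert i L \<times> ?R) coord) =
      (\<integral>\<^sup>+x. (\<integral>\<^sup>+y. (\<Prod>l\<in>insert i L. ?F l (merge ({i} \<times> ?R) (L \<times> ?R) (x, y))) \<partial>PiM (L \<times> ?R) coord) \<partial>PiM ({i} \<times> ?R) coord)"
    unfolding split
  proof (rule coords.product_nn_integral_fold)
    show "(\<lambda>g. \<Prod>l\<in>insert i L. ?F l g) \<in> borel_measurable (PiM ({i} \<times> ?R \<union> L \<times> ?R) coord)" by measurable
  qed (use disj insert.hyps in auto)
  also have "\<dots> = (\<integral>\<^sup>+x. ?F i x * (\<integral>\<^sup>+y. (\<Prod>l\<in>L. ?F l y) \<partial>PiM (L \<times> ?R) coord) \<partial>PiM ({i} \<times> ?R) coord)"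
    unfolding eq by (intro nn_integral_cong nn_integral_cmult) measurable
  also have "\<dots> = (\<integral>\<^sup>+x. ?F i x \<partial>PiM ({i} \<times> ?R) coord) * (\<integral>\<^sup>+y. (\<Prod>l\<in>L. ?F l y) \<partial>PiM (L \<times> ?R) coord)"
    by (rule nn_integral_multc) measurable
  finally show ?case unfolding column_probability[OF c] insert.IH using insert.hyps by simp
qed

section \<open>Conditioning on the basis columns\<close>

text \<open>The part of optimality of \<open>{1..k}\<close> that involves no other column; it sees
  only the leading \<open>k\<close> by \<open>k\<close> block.\<close>

definition basis_ok :: "nat \<Rightarrow> (nat \<Rightarrow> nat \<Rightarrow> real) \<Rightarrow> bool" where
  "basis_ok k D \<longleftrightarrow> indep_cols D {1..k} \<and> primal D {1..k}"

lemma basis_ok_cong: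
  assumes "\<And>i j. i \<in> {1..k} \<Longrightarrow> j \<in> {1..k} \<Longrightarrow> D i j = D' i j"
  shows "basis_ok k D \<longleftrightarrow> basis_ok k D'"
proof -
  have "(\<Sum>i\<in>{1..k}. x i * D i j) = (\<Sum>i\<in>{1..k}. x i * D' i j)" if "j \<in> {1..k}" for x j
    using assms that by (intro sum.cong) auto
  then have "(\<forall>j\<in>{1..k}. (\<Sum>i\<in>{1..k}. x i * D i j) = b j) \<longleftrightarrow> (\<forall>j\<in>{1..k}. (\<Sum>i\<in>{1..k}. x i * D' i j) = b j)"
    for x b by (intro ball_cong) auto
  from this[of _ "\<lambda>_. 0"] this[of _ "\<lambda>j. if j = k then 1 else 0"] show ?thesis
    unfolding basis_ok_def indep_cols_def primal_def card_atLeastAtMost diff_Suc_1 by (simp only:)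
qed

text \<open>Two such functionals agree in the last entry, so their difference vanishes on the basis
  columns restricted to the first \<open>k\<close> rows. These span, hence the difference is
  orthogonal to itself.\<close>

lemma dual_functional_unique:
  assumes "indep_cols D {1..k}"
  shows "\<exists>c. c (Suc k) = - 1 \<and> (\<forall>i\<in>{1..k}. (\<Sum>j\<in>{1..Suc k}. c j * D i j) = 0) \<and>
    (\<forall>b. b (Suc k) = - 1 \<longrightarrow> (\<forall>i\<in>{1..k}. (\<Sum>j\<in>{1..Suc k}. b j * D i j) = 0) \<longrightarrow> (\<forall>j\<in>{1..Suc k}. b j = c j))"
proof -
  have inj: "\<forall>i\<in>{1..k}. x i = 0" if "\<forall>j\<in>{1..k}. (\<Sum>i\<in>{1..k}. x i * D i j) = 0" for x
    using assms that unfolding indep_cols_def by simp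
  obtain c0 where c0: "\<forall>i\<in>{1..k}. (\<Sum>j\<in>{1..k}. c0 j * D i j) = D i (Suc k)"
    using transposed_system_solvable[of "{1..k}" "{1..k}" D "\<lambda>i. D i (Suc k)"] inj by auto
  define c where "c = c0(Suc k := - 1)"
  have c_eq: "(\<Sum>j\<in>{1..Suc k}. c j * D i j) = (\<Sum>j\<in>{1..k}. c0 j * D i j) - D i (Suc k)" for i
    by (auto simp: c_def intro!: sum.cong)
  have "\<forall>j\<in>{1..Suc k}. b j = c j"
    if b: "b (Suc k) = - 1" "\<forall>i\<in>{1..k}. (\<Sum>j\<in>{1..Suc k}. b j * D i j) = 0" for b
  proof -
    define e where "e = (\<lambda>j. b j - c0 j)"
    have e: "\<forall>i\<in>{1..k}. (\<Sum>j\<in>{1..k}. e j * D i j) = 0"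
    proof
      fix i assume i: "i \<in> {1..k}"
      have "(\<Sum>j\<in>{1..k}. b j * D i j) = D i (Suc k)" using b i by simp
      moreover have "(\<Sum>j\<in>{1..k}. c0 j * D i j) = D i (Suc k)" using c0 i by blast
      ultimately show "(\<Sum>j\<in>{1..k}. e j * D i j) = 0"
        by (simp add: e_def left_diff_distrib sum_subtractf)
    qed
    have "e j = 0" if j: "j \<in> {1..k}" for j
    proof -
      obtain x where x: "\<forall>l\<in>{1..k}. (\<Sum>i\<in>{1..k}. x i * D i l) = e l"
        using square_system_solvable[of "{1..k}" "{1..k}" D e] inj by auto
      have "(\<Sum>l\<in>{1..k}. e l * e l) = (\<Sum>l\<in>{1..k}. e l * (\<Sum>i\<in>{1..k}. x i * D i l))"
        using x by (auto intro!: sum.cong)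
      also have "\<dots> = (\<Sum>i\<in>{1..k}. x i * (\<Sum>l\<in>{1..k}. e l * D i l))"
        by (simp only: sum_distrib_left, subst sum.swap) (simp add: mult_ac)
      also have "\<dots> = 0" using e by simp
      finally have "\<forall>l\<in>{1..k}. e l * e l = 0" by (subst (asm) sum_nonneg_eq_0_iff) auto
      then show ?thesis using j by simp
    qed
    then show ?thesis using b by (auto simp: e_def c_def)
  qed
  moreover have "\<forall>i\<in>{1..k}. (\<Sum>j\<in>{1..Suc k}. c j * D i j) = 0" using c0 unfolding c_eq by simp
  moreover have "c (Suc k) = - 1" by (simp add: c_def)
  ultimately show ?thesis by (intro exI[of _ c]) blast
qed

text \<open>Uniqueness is built into the choice, so that arrays agreeing on the block yield the same
  coefficients (\<open>dual_coeffs_cong\<close>). It covers the indices \<open>{1..Suc k}\<close>;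
  elsewhere the values are arbitrary.\<close>

definition dual_coeffs :: "nat \<Rightarrow> (nat \<Rightarrow> nat \<Rightarrow> real) \<Rightarrow> nat \<Rightarrow> real" where
  "dual_coeffs k D = (SOME c. c (Suc k) = - 1 \<and> (\<forall>i\<in>{1..k}. (\<Sum>j\<in>{1..Suc k}. c j * D i j) = 0) \<and>
    (\<forall>b. b (Suc k) = - 1 \<longrightarrow> (\<forall>i\<in>{1..k}. (\<Sum>j\<in>{1..Suc k}. b j * D i j) = 0) \<longrightarrow> (\<forall>j\<in>{1..Suc k}. b j = c j)))"

lemma dual_coeffs:
  assumes "indep_cols D {1..k}"
  shows "dual_coeffs k D (Suc k) = - 1"
    and "\<And>i. i \<in> {1..k} \<Longrightarrow> (\<Sum>j\<in>{1..Suc k}. dual_coeffs k D j * D i j) = 0"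
    and "\<And>b j. b (Suc k) = - 1 \<Longrightarrow> (\<And>i. i \<in> {1..k} \<Longrightarrow> (\<Sum>j\<in>{1..Suc k}. b j * D i j) = 0) \<Longrightarrow>
      j \<in> {1..Suc k} \<Longrightarrow> b j = dual_coeffs k D j"
  using someI_ex[OF dual_functional_unique[OF assms], folded dual_coeffs_def] by blast+

text \<open>Once the basis is fixed, the other columns are tested separately against one and the
  same functional, which makes the conditional probability a product.\<close>

lemma optimal_iff_dual_coeffs:
  assumes "k \<le> n"
  shows "optimal n D {1..k} \<longleftrightarrow>
    basis_ok k D \<and> (\<forall>i\<in>{Suc k..n}. (\<Sum>j\<in>{1..Suc k}. dual_coeffs k D j * D i j) > 0)"
proof (cases "basis_ok k D")
  case True
  then have indep: "indep_cols D {1..k}" by (simp add: basis_ok_def)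
  have diff: "{1..n} - {1..k} = {Suc k..n}" by auto
  have "dual n D {1..k} \<longleftrightarrow> (\<forall>i\<in>{Suc k..n}. (\<Sum>j\<in>{1..Suc k}. dual_coeffs k D j * D i j) > 0)"
  proof
    assume "dual n D {1..k}"
    then obtain b where b: "b (Suc k) = - 1" "\<forall>i\<in>{1..k}. (\<Sum>j\<in>{1..Suc k}. b j * D i j) = 0"
      "\<forall>i\<in>{Suc k..n}. (\<Sum>j\<in>{1..Suc k}. b j * D i j) > 0"
      unfolding dual_def card_atLeastAtMost diff diff_Suc_1' by auto
    have "b j = dual_coeffs k D j" if "j \<in> {1..Suc k}" for j
      using dual_coeffs(3)[OF indep, of b j] b that by blast
    then have "(\<Sum>j\<in>{1..Suc k}. b j * D i j) = (\<Sum>j\<in>{1..Suc k}. dual_coeffs k D j * D i j)" for i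
      by (intro sum.cong) auto
    with b(3) show "\<forall>i\<in>{Suc k..n}. (\<Sum>j\<in>{1..Suc k}. dual_coeffs k D j * D i j) > 0" by simp
  next
    assume "\<forall>i\<in>{Suc k..n}. (\<Sum>j\<in>{1..Suc k}. dual_coeffs k D j * D i j) > 0"
    then show "dual n D {1..k}" unfolding dual_def diff
      using dual_coeffs(1,2)[OF indep] by (intro exI[of _ "dual_coeffs k D"]) simp
  qed
  with True show ?thesis by (auto simp: optimal_def basis_ok_def)
qed (auto simp: optimal_def basis_ok_def)

lemma dual_coeffs_cong:
  assumes "indep_cols D {1..k}"
    and "\<And>i j. i \<in> {1..k} \<Longrightarrow> j \<in> {1..Suc k} \<Longrightarrow> D i j = D' i j" "j \<in> {1..Suc k}"
  shows "dual_coeffs k D' j = dual_coeffs k D j"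
proof (rule dual_coeffs(3)[OF assms(1) _ _ assms(3)])
  have sum_eq: "(\<Sum>i\<in>{1..k}. x i * D i l) = (\<Sum>i\<in>{1..k}. x i * D' i l)" if "l \<in> {1..k}" for x l
    using assms(2) that by (intro sum.cong) auto
  have indep: "indep_cols D' {1..k}"
    using assms(1) sum_eq unfolding indep_cols_def card_atLeastAtMost diff_Suc_1 by simp
  show "dual_coeffs k D' (Suc k) = - 1" by (rule dual_coeffs(1)[OF indep])
  fix i assume i: "i \<in> {1..k}"
  have "(\<Sum>j\<in>{1..Suc k}. dual_coeffs k D' j * D i j) = (\<Sum>j\<in>{1..Suc k}. dual_coeffs k D' j * D' i j)"
    using assms(2)[OF i] by (intro sum.cong) auto
  also have "\<dots> = 0" by (rule dual_coeffs(2)[OF indep i])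
  finally show "(\<Sum>j\<in>{1..Suc k}. dual_coeffs k D' j * D i j) = 0" .
qed

text \<open>The conditional probability that \<open>{1..k}\<close> is optimal given the vectors 0 to
  \<open>k\<close>, when \<open>p\<close> further columns have to be tested; \<open>h0\<close> and
  \<open>z\<close> are the height and the other coordinates of vector number 0.\<close>

definition col_factor :: "nat \<Rightarrow> nat \<Rightarrow> real \<Rightarrow> (nat \<Rightarrow> real) \<Rightarrow> (nat \<Rightarrow> nat \<Rightarrow> real) \<Rightarrow> ennreal" where
  "col_factor k p h0 z D =
     (if basis_ok k D
      then ennreal (angle_prob (- (\<Sum>j\<in>{1..Suc k}. dual_coeffs k D j * z j) / h0 /
             sqrt (\<Sum>j\<in>{1..Suc k}. (dual_coeffs k D j)\<^sup>2))) ^ p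
      else 0)"

lemma col_factor_cong:
  assumes D: "\<And>i j. i \<in> {1..k} \<Longrightarrow> j \<in> {1..Suc k} \<Longrightarrow> D i j = D' i j"
    and z: "\<And>j. j \<in> {1..Suc k} \<Longrightarrow> z j = z' j"
  shows "col_factor k p h0 z D = col_factor k p h0 z' D'"
proof -
  have ok: "basis_ok k D \<longleftrightarrow> basis_ok k D'" by (rule basis_ok_cong) (use D in auto)
  show ?thesis
  proof (cases "basis_ok k D")
    case True
    then have indep: "indep_cols D {1..k}" by (simp add: basis_ok_def)
    have "(\<Sum>j\<in>{1..Suc k}. dual_coeffs k D j * z j) = (\<Sum>j\<in>{1..Suc k}. dual_coeffs k D' j * z' j)"
      "(\<Sum>j\<in>{1..Suc k}. (dual_coeffs k D j)\<^sup>2) = (\<Sum>j\<in>{1..Suc k}. (dual_coeffs k D' j)\<^sup>2)"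
      using dual_coeffs_cong[OF indep D] z by (intro sum.cong; simp)+
    then show ?thesis using ok unfolding col_factor_def by (simp only:)
  qed (use ok in \<open>simp add: col_factor_def\<close>)
qed

text \<open>\<open>w\<close> holds the vectors 0 to \<open>k\<close>, which determine the
  functional; the integral over \<open>v\<close> runs over the vectors outside the basis.\<close>

lemma inner_columns:
  fixes w :: "nat \<times> nat \<Rightarrow> real"
  assumes k: "k \<le> n" and A: "A \<inter> {Suc k..n} \<times> {0..Suc k} = {}" "{0..k} \<times> {0..Suc k} \<subseteq> A"
  shows "(\<integral>\<^sup>+v. indicator {D. optimal n D {1..k}} (cols (merge A ({Suc k..n} \<times> {0..Suc k}) (w, v)))
      \<partial>PiM ({Suc k..n} \<times> {0..Suc k}) coord) = col_factor k (n - k) (w (0, 0)) (\<lambda>j. w (0, j)) (cols w)"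
proof -
  let ?O = "{Suc k..n} \<times> {0..Suc k}"
  let ?g = "\<lambda>v. merge A ?O (w, v)"
  have gw: "?g v (i, j) = w (i, j)" if "i \<le> k" "j \<le> Suc k" for v i j
    using that A(2) by (intro merge_apply(1)) auto
  have gv: "?g v (i, j) = v (i, j)" if "i \<in> {Suc k..n}" "j \<le> Suc k" for v i j
    using that A(1) by (intro merge_apply(2)) auto
  have cols_eq: "cols w i j = cols (?g v) i j" if "i \<in> {1..k}" "j \<in> {1..Suc k}" for v i j
    using that by (simp add: cols_def gw)
  have ok: "basis_ok k (cols (?g v)) \<longleftrightarrow> basis_ok k (cols w)" for v
    by (rule basis_ok_cong) (use cols_eq in auto)
  show ?thesis
  proof (cases "basis_ok k (cols w)")
    case False
    then have "indicator {D. optimal n D {1..k}} (cols (?g v)) = (0::ennreal)" for v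
      using ok[of v] unfolding optimal_def basis_ok_def by (auto simp: indicator_def)
    then show ?thesis using False by (simp add: col_factor_def)
  next
    case True
    then have indep: "indep_cols (cols w) {1..k}" by (simp add: basis_ok_def)
    define c where "c = dual_coeffs k (cols w)"
    \<comment> \<open>Reducing a column subtracts vector number 0 in proportion to the height of the
      column. The functional on reduced columns is therefore a functional on raw ones, and
      \<open>c' 0\<close> is its coefficient at the height.\<close>
    define c' where "c' = c(0 := - (\<Sum>j\<in>{1..Suc k}. c j * w (0, j)) / w (0, 0))"
    have c: "dual_coeffs k (cols (?g v)) j = c j" if "j \<in> {1..Suc k}" for v j
      unfolding c_def by (rule dual_coeffs_cong[OF indep cols_eq that])
    have c_last: "c (Suc k) = - 1" unfolding c_def by (rule dual_coeffs(1)[OF indep])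
    have form: "(\<Sum>j\<in>{1..Suc k}. dual_coeffs k (cols (?g v)) j * cols (?g v) i j) =
        (\<Sum>j\<in>{0..Suc k}. c' j * v (i, j))" if i: "i \<in> {Suc k..n}" for v i
    proof -
      have "(\<Sum>j\<in>{1..Suc k}. dual_coeffs k (cols (?g v)) j * cols (?g v) i j) =
          (\<Sum>j\<in>{1..Suc k}. c j * v (i, j) - (c j * w (0, j)) * (v (i, 0) / w (0, 0)))"
        using i by (intro sum.cong) (auto simp: c cols_def gw gv right_diff_distrib)
      also have "\<dots> = (\<Sum>j\<in>{1..Suc k}. c j * v (i, j)) - (\<Sum>j\<in>{1..Suc k}. c j * w (0, j)) * (v (i, 0) / w (0, 0))"
        by (simp only: sum_subtractf sum_distrib_right)
      also have "\<dots> = c' 0 * v (i, 0) + (\<Sum>j\<in>{1..Suc k}. c' j * v (i, j))"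
      proof -
        have "(\<Sum>j\<in>{1..Suc k}. c' j * v (i, j)) = (\<Sum>j\<in>{1..Suc k}. c j * v (i, j))"
          by (intro sum.cong) (auto simp: c'_def)
        moreover have "a - b * (x / y) = - b / y * x + a" for a b x y :: real by simp
        ultimately show ?thesis by (simp only: c'_def fun_upd_same)
      qed
      also have "\<dots> = (\<Sum>j\<in>{0..Suc k}. c' j * v (i, j))"
        by (simp add: sum.atLeast_Suc_atMost[of 0])
      finally show ?thesis .
    qed
    have "indicator {D. optimal n D {1..k}} (cols (?g v)) =
        (\<Prod>i\<in>{Suc k..n}. indicator {0<..} (\<Sum>j\<in>{0..Suc k}. c' j * v (i, j)) :: ennreal)" for v
    proof (cases "\<forall>i\<in>{Suc k..n}. (\<Sum>j\<in>{0..Suc k}. c' j * v (i, j)) > 0")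
      case pos: True
      then have "optimal n (cols (?g v)) {1..k}"
        using True ok[of v] form unfolding optimal_iff_dual_coeffs[OF k] by simp
      then show ?thesis using pos by simp
    next
      case False
      then have "\<not> optimal n (cols (?g v)) {1..k}"
        using form unfolding optimal_iff_dual_coeffs[OF k] by auto
      moreover have "(\<Prod>i\<in>{Suc k..n}. indicator {0<..} (\<Sum>j\<in>{0..Suc k}. c' j * v (i, j)) :: ennreal) = 0"
        using False by (intro prod_zero) (auto simp: indicator_def)
      ultimately show ?thesis by (simp add: indicator_def)
    qed
    then have "(\<integral>\<^sup>+v. indicator {D. optimal n D {1..k}} (cols (?g v)) \<partial>PiM ?O coord) =
        (\<integral>\<^sup>+v. (\<Prod>i\<in>{Suc k..n}. indicator {0<..} (\<Sum>j\<in>{0..Suc k}. c' j * v (i, j))) \<partial>PiM ?O coord)"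
      by simp
    also have "\<dots> = ennreal (angle_prob (c' 0 / sqrt (\<Sum>j\<in>{1..Suc k}. (c' j)\<^sup>2))) ^ card {Suc k..n}"
      by (rule columns_probability) (auto simp: c'_def c_last intro!: bexI[of _ "Suc k"])
    also have "(\<Sum>j\<in>{1..Suc k}. (c' j)\<^sup>2) = (\<Sum>j\<in>{1..Suc k}. (c j)\<^sup>2)"
      by (intro sum.cong) (auto simp: c'_def)
    also have "card {Suc k..n} = n - k" by simp
    also have "c' 0 = - (\<Sum>j\<in>{1..Suc k}. c j * w (0, j)) / w (0, 0)" by (simp add: c'_def)
    finally show ?thesis using True unfolding col_factor_def c_def by simp
  qed
qed

text \<open>Completing the square in \<open>z\<close>.\<close>

lemma gaussian_row_identity:
  fixes h :: "nat \<Rightarrow> real"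
  assumes h0: "h 0 > 0" and \<rho>: "\<rho> = sqrt (\<Sum>i\<in>{0..k}. (h i)\<^sup>2)"
    and z: "z = - (h 0 / \<rho>\<^sup>2 * (\<Sum>i\<in>{1..k}. D i * h i)) + h 0 / \<rho> * \<zeta>"
  shows "std_normal_density z * (\<Prod>i\<in>{1..k}. std_normal_density (h i / h 0 * z + 1 * D i)) =
    (1 / sqrt (2 * pi)) ^ k * exp (- ((\<Sum>i\<in>{1..k}. (D i)\<^sup>2) - (\<Sum>i\<in>{1..k}. D i * h i)\<^sup>2 / \<rho>\<^sup>2) / 2) *
      std_normal_density \<zeta>"
proof -
  define S where "S = (\<Sum>i\<in>{1..k}. D i * h i)"
  have "(\<Sum>i\<in>{0..k}. (h i)\<^sup>2) = (h 0)\<^sup>2 + (\<Sum>i\<in>{1..k}. (h i)\<^sup>2)"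
    by (simp add: sum.atLeast_Suc_atMost)
  then have \<rho>2: "\<rho>\<^sup>2 = (h 0)\<^sup>2 + (\<Sum>i\<in>{1..k}. (h i)\<^sup>2)" unfolding \<rho>
    by (subst real_sqrt_pow2) (auto intro!: add_nonneg_nonneg sum_nonneg)
  have "\<rho>\<^sup>2 > 0" unfolding \<rho>2 using h0 by (intro add_pos_nonneg sum_nonneg) auto
  moreover have "\<rho> \<ge> 0" unfolding \<rho> by (auto intro: sum_nonneg)
  ultimately have \<rho>0: "\<rho> > 0" by (metis less_eq_real_def power_zero_numeral less_irrefl)
  have "z\<^sup>2 + (\<Sum>i\<in>{1..k}. (h i / h 0 * z + 1 * D i)\<^sup>2) =
      z\<^sup>2 + ((\<Sum>i\<in>{1..k}. (h i)\<^sup>2) * (z / h 0)\<^sup>2 + 2 * (z / h 0) * S + (\<Sum>i\<in>{1..k}. (D i)\<^sup>2))"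
    unfolding S_def sum_distrib_left sum_distrib_right sum.distrib[symmetric]
    by (intro arg_cong2[of _ _ _ _ "(+)"] sum.cong refl)
      (simp add: power2_eq_square algebra_simps add_divide_distrib)
  also have "\<dots> = (z / h 0)\<^sup>2 * \<rho>\<^sup>2 + 2 * (z / h 0) * S + (\<Sum>i\<in>{1..k}. (D i)\<^sup>2)"
    unfolding \<rho>2 using h0 by (simp add: algebra_simps power_divide)
  also have "z / h 0 = (\<zeta> - S / \<rho>) / \<rho>"
    unfolding z S_def[symmetric] using h0 \<rho>0 by (simp add: field_simps power2_eq_square)
  also have "((\<zeta> - S / \<rho>) / \<rho>)\<^sup>2 * \<rho>\<^sup>2 + 2 * ((\<zeta> - S / \<rho>) / \<rho>) * S + (\<Sum>i\<in>{1..k}. (D i)\<^sup>2) =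
      \<zeta>\<^sup>2 + ((\<Sum>i\<in>{1..k}. (D i)\<^sup>2) - S\<^sup>2 / \<rho>\<^sup>2)"
    using \<rho>0 by (simp add: field_simps power2_eq_square)
  finally have expo: "z\<^sup>2 + (\<Sum>i\<in>{1..k}. (h i / h 0 * z + 1 * D i)\<^sup>2) =
      \<zeta>\<^sup>2 + ((\<Sum>i\<in>{1..k}. (D i)\<^sup>2) - S\<^sup>2 / \<rho>\<^sup>2)" .
  have "std_normal_density z * (\<Prod>i\<in>{1..k}. std_normal_density (h i / h 0 * z + 1 * D i)) =
      (1 / sqrt (2 * pi)) ^ k * (1 / sqrt (2 * pi)) *
      (exp (- z\<^sup>2 / 2) * exp (\<Sum>i\<in>{1..k}. - (h i / h 0 * z + 1 * D i)\<^sup>2 / 2))"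
    unfolding std_normal_density_def by (subst exp_sum) (simp_all add: prod.distrib prod_dividef power_divide mult.commute)
  also have "exp (- z\<^sup>2 / 2) * exp (\<Sum>i\<in>{1..k}. - (h i / h 0 * z + 1 * D i)\<^sup>2 / 2) =
      exp (- (z\<^sup>2 + (\<Sum>i\<in>{1..k}. (h i / h 0 * z + 1 * D i)\<^sup>2)) / 2)"
    unfolding exp_add[symmetric] by (simp add: sum_negf sum_divide_distrib[symmetric] add_divide_distrib)
  also have "\<dots> = exp (- ((\<Sum>i\<in>{1..k}. (D i)\<^sup>2) - S\<^sup>2 / \<rho>\<^sup>2) / 2) * exp (- \<zeta>\<^sup>2 / 2)"
    unfolding expo exp_add[symmetric] by (simp add: field_simps)
  finally show ?thesis unfolding S_def[symmetric] by (simp add: std_normal_density_def)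
qed


section \<open>Integrating out vector number 0\<close>

lemma prod_row_block: "(\<Prod>a\<in>{0} \<times> {1..Suc k}. f a) = (\<Prod>j\<in>{1..Suc k}. f (0, j))"
  for f :: "nat \<times> nat \<Rightarrow> 'a::comm_monoid_mult"
proof -
  have "{0::nat} \<times> {1..Suc k} = Pair 0 ` {1..Suc k}" by auto
  moreover have "inj_on (Pair (0::nat)) {1..Suc k}" by (auto simp: inj_on_def)
  ultimately show ?thesis by (simp only: prod.reindex o_def)
qed

lemma sum_row_block: "(\<Sum>a\<in>{0} \<times> {1..Suc k}. f a) = (\<Sum>j\<in>{1..Suc k}. f (0, j))"
  for f :: "nat \<times> nat \<Rightarrow> 'a::comm_monoid_add"
proof -
  have "{0::nat} \<times> {1..Suc k} = Pair 0 ` {1..Suc k}" by auto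
  moreover have "inj_on (Pair (0::nat)) {1..Suc k}" by (auto simp: inj_on_def)
  ultimately show ?thesis by (simp only: sum.reindex o_def)
qed

lemma prod_rect_block: "(\<Prod>a\<in>{1..k} \<times> {1..Suc k}. f a) = (\<Prod>j\<in>{1..Suc k}. \<Prod>i\<in>{1..k}. f (i, j))"
  for f :: "nat \<times> nat \<Rightarrow> 'a::comm_monoid_mult"
  by (subst prod.swap, subst prod.cartesian_product) simp

text \<open>What is left of the density once the square in \<open>z\<close> is completed: the
  Jacobian of the substitution and, for each row, the exponential of minus half the minimum of the
  quadratic form.\<close>

definition gauss_weight :: "nat \<Rightarrow> (nat \<times> nat \<Rightarrow> real) \<Rightarrow> (nat \<times> nat \<Rightarrow> real) \<Rightarrow> real" where
  "gauss_weight k h e = (let \<rho> = sqrt (\<Sum>i\<in>{0..k}. (h (i, 0))\<^sup>2) in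
     (h (0, 0) / \<rho>) ^ Suc k * (\<Prod>j\<in>{1..Suc k}. (1 / sqrt (2 * pi)) ^ k *
       exp (- ((\<Sum>i\<in>{1..k}. (e (i, j))\<^sup>2) - (\<Sum>i\<in>{1..k}. e (i, j) * h (i, 0))\<^sup>2 / \<rho>\<^sup>2) / 2)))"

definition normal_avg :: "nat \<Rightarrow> real \<Rightarrow> ennreal" where
  "normal_avg p \<rho> = (\<integral>\<^sup>+x. ennreal (std_normal_density x) * ennreal (angle_prob (x / \<rho>)) ^ p \<partial>lborel)"

text \<open>The centre \<open>m\<close> of the completed square is a combination of basis columns,
  so \<open>c\<close> annihilates it (\<open>cm\<close>). What remains of \<open>c\<close> applied
  to \<open>z\<close> is \<open>h (0, 0) / \<rho>\<close> times a normal variable of deviation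
  \<open>nc\<close>. The factors \<open>h (0, 0)\<close> and \<open>nc\<close> cancel, and the angle
  depends on the heights through \<open>\<rho>\<close> only.\<close>

lemma integrate_first_column:
  fixes h e :: "nat \<times> nat \<Rightarrow> real"
  assumes h0: "h (0, 0) > 0" and ok: "basis_ok k (\<lambda>i j. e (i, j))"
    and \<rho>_def: "\<rho> = sqrt (\<Sum>i\<in>{0..k}. (h (i, 0))\<^sup>2)"
  shows "(\<integral>\<^sup>+z. (\<Prod>a\<in>{0} \<times> {1..Suc k}. ennreal (std_normal_density (z a))) *
      (\<Prod>a\<in>{1..k} \<times> {1..Suc k}. ennreal (std_normal_density (h (fst a, 0) / h (0, 0) * z (0, snd a) + 1 * e a))) *
      col_factor k p (h (0, 0)) (\<lambda>j. z (0, j)) (\<lambda>i j. e (i, j)) \<partial>lebesgue_prod ({0} \<times> {1..Suc k})) =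
    ennreal (gauss_weight k h e) * normal_avg p \<rho>"
proof -
  let ?Z = "{0::nat} \<times> {1..Suc k}" and ?E = "{1..k} \<times> {1..Suc k}"
  define c where "c = dual_coeffs k (\<lambda>i j. e (i, j))"
  define nc where "nc = sqrt (\<Sum>j\<in>{1..Suc k}. (c j)\<^sup>2)"
  have indep: "indep_cols (\<lambda>i j. e (i, j)) {1..k}" using ok by (simp add: basis_ok_def)
  have c_last: "c (Suc k) = - 1" unfolding c_def by (rule dual_coeffs(1)[OF indep])
  have c_orth: "(\<Sum>j\<in>{1..Suc k}. c j * e (i, j)) = 0" if "i \<in> {1..k}" for i
    unfolding c_def by (rule dual_coeffs(2)[OF indep that])
  have \<rho>: "\<rho> > 0"
  proof -
    have "(\<Sum>i\<in>{0..k}. (h (i, 0))\<^sup>2) > 0" using h0 by (intro sum_pos2[of _ 0]) auto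
    then show ?thesis by (simp add: \<rho>_def)
  qed
  define m where "m = (\<lambda>j. h (0, 0) / \<rho>\<^sup>2 * (\<Sum>i\<in>{1..k}. e (i, j) * h (i, 0)))"
  define q where "q = (\<lambda>j. (1 / sqrt (2 * pi)) ^ k *
       exp (- ((\<Sum>i\<in>{1..k}. (e (i, j))\<^sup>2) - (\<Sum>i\<in>{1..k}. e (i, j) * h (i, 0))\<^sup>2 / \<rho>\<^sup>2) / 2))"
  have q: "q j \<ge> 0" for j by (simp add: q_def)
  have cm: "(\<Sum>j\<in>{1..Suc k}. c j * m j) = 0"
  proof -
    have "(\<Sum>j\<in>{1..Suc k}. c j * m j) =
        h (0, 0) / \<rho>\<^sup>2 * (\<Sum>j\<in>{1..Suc k}. \<Sum>i\<in>{1..k}. (c j * e (i, j)) * h (i, 0))"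
      unfolding m_def by (simp only: sum_distrib_left mult_ac)
    also have "(\<Sum>j\<in>{1..Suc k}. \<Sum>i\<in>{1..k}. (c j * e (i, j)) * h (i, 0)) =
        (\<Sum>i\<in>{1..k}. (\<Sum>j\<in>{1..Suc k}. c j * e (i, j)) * h (i, 0))"
      by (subst sum.swap) (simp only: sum_distrib_right)
    also have "\<dots> = 0" using c_orth by (intro sum.neutral) simp
    finally show ?thesis by simp
  qed
  define V where "V = (\<lambda>x. ennreal (angle_prob (x / \<rho>)) ^ p)"
  have [measurable]: "V \<in> borel_measurable borel" unfolding V_def by measurable
  note [measurable] = measurable_coordinate[of "\<lambda>_. lborel"] measurable_coordinate[of coord]
  let ?sub = "\<lambda>z. \<lambda>a\<in>?Z. - m (snd a) + (h (0, 0) / \<rho>) * z a"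
  let ?f = "\<lambda>z. (\<Prod>a\<in>?Z. ennreal (std_normal_density (z a))) *
      (\<Prod>a\<in>?E. ennreal (std_normal_density (h (fst a, 0) / h (0, 0) * z (0, snd a) + 1 * e a))) *
      col_factor k p (h (0, 0)) (\<lambda>j. z (0, j)) (\<lambda>i j. e (i, j))"
  have fact: "col_factor k p (h (0, 0)) (\<lambda>j. z (0, j)) (\<lambda>i j. e (i, j)) =
      ennreal (angle_prob (- (\<Sum>j\<in>{1..Suc k}. c j * z (0, j)) / h (0, 0) / nc)) ^ p" for z
    unfolding col_factor_def c_def nc_def using ok by (simp only: if_True)
  have sub_f: "?f (?sub z) = ennreal (\<Prod>j\<in>{1..Suc k}. q j) *
      ((\<Prod>a\<in>?Z. ennreal (coord_density a (z a))) * V ((\<Sum>a\<in>?Z. (- c (snd a)) * z a) / sqrt (\<Sum>a\<in>?Z. (- c (snd a))\<^sup>2)))" for z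
  proof -
    have sub: "?sub z (0, j) = - m j + (h (0, 0) / \<rho>) * z (0, j)" if "j \<in> {1..Suc k}" for j
      using that by simp
    have "(\<Prod>a\<in>?Z. ennreal (std_normal_density (?sub z a))) *
        (\<Prod>a\<in>?E. ennreal (std_normal_density (h (fst a, 0) / h (0, 0) * ?sub z (0, snd a) + 1 * e a))) =
      (\<Prod>j\<in>{1..Suc k}. ennreal (std_normal_density (?sub z (0, j)) *
        (\<Prod>i\<in>{1..k}. std_normal_density (h (i, 0) / h (0, 0) * ?sub z (0, j) + 1 * e (i, j)))))"
      unfolding prod_row_block prod_rect_block prod.distrib[symmetric]
      by (intro prod.cong refl) (simp only: fst_conv snd_conv prod_ennreal ennreal_mult normal_density_nonneg prod_nonneg)
    also have "\<dots> = (\<Prod>j\<in>{1..Suc k}. ennreal (q j * std_normal_density (z (0, j))))"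
    proof (intro prod.cong refl arg_cong[of _ _ ennreal])
      fix j assume j: "j \<in> {1..Suc k}"
      show "std_normal_density (?sub z (0, j)) *
        (\<Prod>i\<in>{1..k}. std_normal_density (h (i, 0) / h (0, 0) * ?sub z (0, j) + 1 * e (i, j))) =
        q j * std_normal_density (z (0, j))"
        unfolding q_def
        by (rule gaussian_row_identity[where h = "\<lambda>i. h (i, 0)" and D = "\<lambda>i. e (i, j)"])
          (use h0 \<rho>_def sub[OF j] in \<open>simp_all add: m_def\<close>)
    qed
    also have "\<dots> = ennreal (\<Prod>j\<in>{1..Suc k}. q j) * (\<Prod>j\<in>{1..Suc k}. ennreal (std_normal_density (z (0, j))))"
      using q by (subst prod_ennreal[symmetric]) (auto simp only: ennreal_mult normal_density_nonneg prod.distrib)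
    also have "(\<Prod>j\<in>{1..Suc k}. ennreal (std_normal_density (z (0, j)))) = (\<Prod>a\<in>?Z. ennreal (coord_density a (z a)))"
      unfolding prod_row_block by (intro prod.cong) (auto simp: coord_density_def)
    finally have 1: "(\<Prod>a\<in>?Z. ennreal (std_normal_density (?sub z a))) *
        (\<Prod>a\<in>?E. ennreal (std_normal_density (h (fst a, 0) / h (0, 0) * ?sub z (0, snd a) + 1 * e a))) =
        ennreal (\<Prod>j\<in>{1..Suc k}. q j) * (\<Prod>a\<in>?Z. ennreal (coord_density a (z a)))" .
    have "(\<Sum>j\<in>{1..Suc k}. c j * ?sub z (0, j)) = (\<Sum>j\<in>{1..Suc k}. (h (0, 0) / \<rho>) * (c j * z (0, j)) - c j * m j)"
      by (intro sum.cong refl) (simp only: sub, simp add: algebra_simps)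
    also have "\<dots> = (h (0, 0) / \<rho>) * (\<Sum>j\<in>{1..Suc k}. c j * z (0, j))"
      unfolding sum_subtractf cm by (simp only: sum_distrib_left diff_zero)
    finally have eq: "(\<Sum>j\<in>{1..Suc k}. c j * ?sub z (0, j)) = (h (0, 0) / \<rho>) * (\<Sum>j\<in>{1..Suc k}. c j * z (0, j))" .
    have "- (h (0, 0) / \<rho> * S) / h (0, 0) / nc = - S / nc / \<rho>" for S
      using h0 \<rho> by (simp add: field_simps)
    then have "- (\<Sum>j\<in>{1..Suc k}. c j * ?sub z (0, j)) / h (0, 0) / nc =
        - (\<Sum>j\<in>{1..Suc k}. c j * z (0, j)) / nc / \<rho>"
      unfolding eq .
    moreover have "(\<Sum>a\<in>?Z. (- c (snd a)) * z a) = - (\<Sum>j\<in>{1..Suc k}. c j * z (0, j))"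
      unfolding sum_row_block by (simp only: snd_conv mult_minus_left sum_negf)
    moreover have "sqrt (\<Sum>a\<in>?Z. (- c (snd a))\<^sup>2) = nc"
      unfolding sum_row_block nc_def by (simp only: snd_conv power2_minus)
    ultimately have 2: "col_factor k p (h (0, 0)) (\<lambda>j. ?sub z (0, j)) (\<lambda>i j. e (i, j)) =
        V ((\<Sum>a\<in>?Z. (- c (snd a)) * z a) / sqrt (\<Sum>a\<in>?Z. (- c (snd a))\<^sup>2))"
      unfolding fact V_def by (simp only:)
    show ?thesis unfolding 1 2 by (simp only: mult.assoc)
  qed
  have "(\<integral>\<^sup>+z. ?f z \<partial>lebesgue_prod ?Z) =
      (\<Prod>a\<in>?Z. ennreal \<bar>h (0, 0) / \<rho>\<bar>) * (\<integral>\<^sup>+z. ?f (?sub z) \<partial>lebesgue_prod ?Z)"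
  proof (rule nn_integral_lebesgue_prod_affine)
    show "?f \<in> borel_measurable (lebesgue_prod ?Z)" unfolding fact by measurable
  qed (use h0 \<rho> in auto)
  also have "(\<Prod>a\<in>?Z. ennreal \<bar>h (0, 0) / \<rho>\<bar>) = ennreal ((h (0, 0) / \<rho>) ^ Suc k)"
  proof -
    have "card ?Z = Suc k" by simp
    then have "(\<Prod>a\<in>?Z. ennreal \<bar>h (0, 0) / \<rho>\<bar>) = ennreal \<bar>h (0, 0) / \<rho>\<bar> ^ Suc k"
      by (simp only: prod_constant)
    also have "\<dots> = ennreal (\<bar>h (0, 0) / \<rho>\<bar> ^ Suc k)" by (rule ennreal_power) simp
    finally show ?thesis using h0 \<rho> by simp
  qed
  also have "(\<integral>\<^sup>+z. ?f (?sub z) \<partial>lebesgue_prod ?Z) = ennreal (\<Prod>j\<in>{1..Suc k}. q j) *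
     (\<integral>\<^sup>+z. (\<Prod>a\<in>?Z. ennreal (coord_density a (z a))) * V ((\<Sum>a\<in>?Z. (- c (snd a)) * z a) / sqrt (\<Sum>a\<in>?Z. (- c (snd a))\<^sup>2)) \<partial>lebesgue_prod ?Z)"
    unfolding sub_f by (rule nn_integral_cmult) measurable
  also have "(\<integral>\<^sup>+z. (\<Prod>a\<in>?Z. ennreal (coord_density a (z a))) * V ((\<Sum>a\<in>?Z. (- c (snd a)) * z a) / sqrt (\<Sum>a\<in>?Z. (- c (snd a))\<^sup>2)) \<partial>lebesgue_prod ?Z) =
     (\<integral>\<^sup>+z. V ((\<Sum>a\<in>?Z. (- c (snd a)) * z a) / sqrt (\<Sum>a\<in>?Z. (- c (snd a))\<^sup>2)) \<partial>PiM ?Z coord)"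
    by (rule nn_integral_PiM_coord[symmetric]) (simp, measurable)
  also have "\<dots> = (\<integral>\<^sup>+x. ennreal (std_normal_density x) * V x \<partial>lborel)"
  proof (rule distributed_nn_integral[symmetric])
    show "distributed (PiM ?Z coord) lborel (\<lambda>z. (\<Sum>a\<in>?Z. (- c (snd a)) * z a) / sqrt (\<Sum>a\<in>?Z. (- c (snd a))\<^sup>2)) std_normal_density"
      using c_last by (intro distributed_linear_form) (auto intro!: bexI[of _ "Suc k"])
  qed simp
  finally have "(\<integral>\<^sup>+z. ?f z \<partial>lebesgue_prod ?Z) =
      ennreal ((h (0, 0) / \<rho>) ^ Suc k) * (ennreal (\<Prod>j\<in>{1..Suc k}. q j) * normal_avg p \<rho>)"
    by (simp only: V_def normal_avg_def)
  also have "\<dots> = ennreal ((h (0, 0) / \<rho>) ^ Suc k * (\<Prod>j\<in>{1..Suc k}. q j)) * normal_avg p \<rho>"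
    using h0 \<rho> q by (subst ennreal_mult) (auto intro!: prod_nonneg simp only: mult.assoc divide_nonneg_nonneg less_imp_le zero_le_power)
  also have "(h (0, 0) / \<rho>) ^ Suc k * (\<Prod>j\<in>{1..Suc k}. q j) = gauss_weight k h e"
    unfolding gauss_weight_def Let_def q_def \<rho>_def[symmetric] ..
  finally show ?thesis .
qed


text \<open>The total weight, for given heights, of the reduced basis columns that satisfy the basis
  condition.\<close>

definition head_kernel :: "nat \<Rightarrow> (nat \<times> nat \<Rightarrow> real) \<Rightarrow> ennreal" where
  "head_kernel k h = (\<integral>\<^sup>+e. indicator {D. basis_ok k D} (\<lambda>i j. e (i, j)) * ennreal (gauss_weight k h e)
     \<partial>lebesgue_prod ({1..k} \<times> {1..Suc k}))"

lemma sigma_finite_lebesgue_prod: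
  assumes "finite A" shows "sigma_finite_measure (lebesgue_prod A)"
proof -
  interpret finite_product_sigma_finite "\<lambda>_. lborel :: real measure" A
    by unfold_locales (fact assms)
  show ?thesis by (rule sigma_finite_measure_axioms)
qed

text \<open>For fixed first row \<open>h\<close>, translating the remaining columns makes the indicator of the basis
  event independent of the first column, which can then be integrated out.\<close>

lemma integrate_rows:
  fixes h :: "nat \<times> nat \<Rightarrow> real" and k p :: nat
  defines "H \<equiv> {0..k} \<times> {0::nat}" and "Z \<equiv> {0::nat} \<times> {1..Suc k}" and "E \<equiv> {1..k} \<times> {1..Suc k}"
  defines "W \<equiv> \<lambda>w. col_factor k p (w (0, 0)) (\<lambda>j. w (0, j)) (cols w)"
  assumes W: "W \<in> borel_measurable (PiM (H \<union> (Z \<union> E)) coord)"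
    and h: "h \<in> space (PiM H coord)" "h (0, 0) > 0"
  shows "(\<integral>\<^sup>+x. W (merge H (Z \<union> E) (h, x)) \<partial>PiM (Z \<union> E) coord) =
    head_kernel k h * normal_avg p (sqrt (\<Sum>i\<in>{0..k}. (h (i, 0))\<^sup>2))"
proof -
  define \<rho> where "\<rho> = sqrt (\<Sum>i\<in>{0..k}. (h (i, 0))\<^sup>2)"
  have fin: "finite H" "finite Z" "finite E" by (auto simp: H_def Z_def E_def)
  have disj: "H \<inter> (Z \<union> E) = {}" "Z \<inter> E = {}" by (auto simp: H_def Z_def E_def)
  note coordm [measurable] = measurable_coordinate[of "\<lambda>_. lborel"] measurable_coordinate[of coord]
  let ?dZ = "\<lambda>z. \<Prod>a\<in>Z. ennreal (std_normal_density (z a))"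
  let ?dE = "\<lambda>e. \<Prod>a\<in>E. ennreal (std_normal_density (e a))"
  let ?f = "\<lambda>x. W (merge H (Z \<union> E) (h, x))"
  have "(\<lambda>x. merge H (Z \<union> E) (h, x)) \<in> measurable (PiM (Z \<union> E) coord) (PiM (H \<union> (Z \<union> E)) coord)"
    by (rule measurable_compose[OF measurable_Pair1'[OF h(1)] measurable_merge])
  then have "?f \<in> borel_measurable (PiM (Z \<union> E) coord)" by (rule measurable_compose[OF _ W])
  then have f [measurable]: "?f \<in> borel_measurable (lebesgue_prod (Z \<union> E))"
    by (simp add: measurable_PiM_coord_iff)
  let ?G = "\<lambda>x. (\<Prod>a\<in>Z \<union> E. ennreal (std_normal_density (x a))) * ?f x"
  have G [measurable]: "?G \<in> borel_measurable (lebesgue_prod (Z \<union> E))" by measurable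
  have "(\<integral>\<^sup>+x. ?f x \<partial>PiM (Z \<union> E) coord) =
      (\<integral>\<^sup>+x. (\<Prod>a\<in>Z \<union> E. ennreal (coord_density a (x a))) * ?f x \<partial>lebesgue_prod (Z \<union> E))"
    by (rule nn_integral_PiM_coord) (use fin f in auto)
  also have "\<dots> = (\<integral>\<^sup>+x. ?G x \<partial>lebesgue_prod (Z \<union> E))"
    by (intro nn_integral_cong arg_cong2[of _ _ _ _ "(*)"] prod.cong refl)
      (auto simp: coord_density_def Z_def E_def)
  also have "\<dots> = (\<integral>\<^sup>+z. (\<integral>\<^sup>+e. ?G (merge Z E (z, e)) \<partial>lebesgue_prod E) \<partial>lebesgue_prod Z)"
    by (rule lborels.product_nn_integral_fold[OF disj(2) fin(2,3) G])
  also have "\<dots> = (\<integral>\<^sup>+z. (\<integral>\<^sup>+e. ?G (merge Z E (z, \<lambda>a\<in>E. h (fst a, 0) / h (0, 0) * z (0, snd a) + 1 * e a)) \<partial>lebesgue_prod E) \<partial>lebesgue_prod Z)"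
  proof (rule nn_integral_cong)
    fix z assume z: "z \<in> space (lebesgue_prod Z)"
    have "(\<lambda>e. merge Z E (z, e)) \<in> measurable (lebesgue_prod E) (lebesgue_prod (Z \<union> E))"
      by (rule measurable_compose[OF measurable_Pair1'[OF z] measurable_merge])
    then have meas: "(\<lambda>e. ?G (merge Z E (z, e))) \<in> borel_measurable (lebesgue_prod E)"
      by (rule measurable_compose[OF _ G])
    show "(\<integral>\<^sup>+e. ?G (merge Z E (z, e)) \<partial>lebesgue_prod E) =
        (\<integral>\<^sup>+e. ?G (merge Z E (z, \<lambda>a\<in>E. h (fst a, 0) / h (0, 0) * z (0, snd a) + 1 * e a)) \<partial>lebesgue_prod E)"
      by (subst nn_integral_lebesgue_prod_affine[OF fin(3) meas, where s = "\<lambda>_. 1" and t = "\<lambda>a. h (fst a, 0) / h (0, 0) * z (0, snd a)"])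
        simp_all
  qed
  also have "\<dots> = (\<integral>\<^sup>+e. (\<integral>\<^sup>+z. ?G (merge Z E (z, \<lambda>a\<in>E. h (fst a, 0) / h (0, 0) * z (0, snd a) + 1 * e a)) \<partial>lebesgue_prod Z) \<partial>lebesgue_prod E)"
  proof (rule pair_sigma_finite.Fubini')
    show "pair_sigma_finite (lebesgue_prod E) (lebesgue_prod Z)"
      using sigma_finite_lebesgue_prod fin by (simp add: pair_sigma_finite_def)
    have "(\<lambda>x. \<lambda>a\<in>E. h (fst a, 0) / h (0, 0) * snd x (0, snd a) + 1 * fst x a) \<in>
        measurable (lebesgue_prod E \<Otimes>\<^sub>M lebesgue_prod Z) (lebesgue_prod E)"
    proof (rule measurable_restrict)
      fix a assume "a \<in> E"
      have [measurable]: "(\<lambda>x. snd x (0, snd a)) \<in> borel_measurable (lebesgue_prod E \<Otimes>\<^sub>M lebesgue_prod Z)"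
        "(\<lambda>x. fst x a) \<in> borel_measurable (lebesgue_prod E \<Otimes>\<^sub>M lebesgue_prod Z)"
        using measurable_compose[OF measurable_snd coordm(1)] measurable_compose[OF measurable_fst coordm(1)] by auto
      show "(\<lambda>x. h (fst a, 0) / h (0, 0) * snd x (0, snd a) + 1 * fst x a) \<in>
          measurable (lebesgue_prod E \<Otimes>\<^sub>M lebesgue_prod Z) lborel" by simp
    qed
    from measurable_compose[OF measurable_compose[OF measurable_Pair[OF measurable_snd this] measurable_merge] G]
    show "(\<lambda>(e, z). ?G (merge Z E (z, \<lambda>a\<in>E. h (fst a, 0) / h (0, 0) * z (0, snd a) + 1 * e a))) \<in>
        borel_measurable (lebesgue_prod E \<Otimes>\<^sub>M lebesgue_prod Z)"
      by (simp only: case_prod_unfold)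
  qed
  also have "\<dots> = (\<integral>\<^sup>+e. indicator {D. basis_ok k D} (\<lambda>i j. e (i, j)) * ennreal (gauss_weight k h e) * normal_avg p \<rho> \<partial>lebesgue_prod E)"
  proof (rule nn_integral_cong)
    fix e :: "nat \<times> nat \<Rightarrow> real"
    let ?e = "\<lambda>z. \<lambda>a\<in>E. h (fst a, 0) / h (0, 0) * z (0, snd a) + 1 * e a"
    have G_eq: "?G (merge Z E (z, ?e z)) = (\<Prod>a\<in>Z. ennreal (std_normal_density (z a))) *
      (\<Prod>a\<in>E. ennreal (std_normal_density (h (fst a, 0) / h (0, 0) * z (0, snd a) + 1 * e a))) *
      col_factor k p (h (0, 0)) (\<lambda>j. z (0, j)) (\<lambda>i j. e (i, j))" for z
    proof -
      let ?x = "merge Z E (z, ?e z)"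
      let ?w = "merge H (Z \<union> E) (h, ?x)"
      have wH: "?w (i, 0) = h (i, 0)" if "i \<le> k" for i
        using that by (intro merge_apply(1)) (auto simp: H_def)
      have xZ: "?x (0, j) = z (0, j)" if "j \<in> {1..Suc k}" for j
        using that by (intro merge_apply(1)) (auto simp: Z_def)
      have xE: "?x a = h (fst a, 0) / h (0, 0) * z (0, snd a) + 1 * e a" if "a \<in> E" for a
        using that disj by (subst merge_apply(2)) auto
      have wZ: "?w (0, j) = z (0, j)" if j: "j \<in> {1..Suc k}" for j
      proof -
        have "?w (0, j) = ?x (0, j)" using j disj by (intro merge_apply(2)) (auto simp: Z_def)
        then show ?thesis using xZ[OF j] by simp
      qed
      have wE: "?w (i, j) = h (i, 0) / h (0, 0) * z (0, j) + e (i, j)" if ij: "i \<in> {1..k}" "j \<in> {1..Suc k}" for i j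
      proof -
        have "?w (i, j) = ?x (i, j)" using ij disj by (intro merge_apply(2)) (auto simp: E_def)
        then show ?thesis using xE[of "(i, j)"] ij by (simp add: E_def)
      qed
      have "(\<Prod>a\<in>Z \<union> E. ennreal (std_normal_density (?x a))) =
          (\<Prod>a\<in>Z. ennreal (std_normal_density (?x a))) * (\<Prod>a\<in>E. ennreal (std_normal_density (?x a)))"
        using fin disj by (intro prod.union_disjoint) auto
      also have "(\<Prod>a\<in>Z. ennreal (std_normal_density (?x a))) = (\<Prod>a\<in>Z. ennreal (std_normal_density (z a)))"
        using merge_apply(1)[of _ Z E z] by (intro prod.cong) auto
      also have "(\<Prod>a\<in>E. ennreal (std_normal_density (?x a))) =
          (\<Prod>a\<in>E. ennreal (std_normal_density (h (fst a, 0) / h (0, 0) * z (0, snd a) + 1 * e a)))"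
        using xE by (intro prod.cong) auto
      finally have 1: "(\<Prod>a\<in>Z \<union> E. ennreal (std_normal_density (?x a))) =
          (\<Prod>a\<in>Z. ennreal (std_normal_density (z a))) *
          (\<Prod>a\<in>E. ennreal (std_normal_density (h (fst a, 0) / h (0, 0) * z (0, snd a) + 1 * e a)))" .
      \<comment> \<open>The translation was chosen so that reducing the assembled array gives back
        \<open>e\<close> on the basis block.\<close>
      have "?f ?x = col_factor k p (h (0, 0)) (\<lambda>j. z (0, j)) (\<lambda>i j. e (i, j))"
        unfolding W_def wH[OF le0]
        by (rule col_factor_cong) (use wE wH wZ in \<open>simp_all add: cols_def\<close>)
      then show ?thesis unfolding 1 by simp
    qed
    show "(\<integral>\<^sup>+z. ?G (merge Z E (z, ?e z)) \<partial>lebesgue_prod Z) =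
        indicator {D. basis_ok k D} (\<lambda>i j. e (i, j)) * ennreal (gauss_weight k h e) * normal_avg p \<rho>"
    proof (cases "basis_ok k (\<lambda>i j. e (i, j))")
      case True
      then show ?thesis unfolding G_eq unfolding Z_def E_def
        by (subst integrate_first_column[OF h(2) True \<rho>_def]) simp
    next
      case False
      then show ?thesis unfolding G_eq by (simp add: col_factor_def)
    qed
  qed
  also have "\<dots> = head_kernel k h * normal_avg p \<rho>"
    unfolding head_kernel_def E_def[symmetric]
  proof (rule nn_integral_multc)
    have arr [measurable]: "(\<lambda>e. \<lambda>i j. e (i, j)) \<in> borel_measurable (lebesgue_prod E)"
      by (intro measurable_coordinatewise_then_product coordm) simp
    have [measurable]: "{D. basis_ok k D} \<in> sets borel"
    proof -
      have "{D. basis_ok k D} = {D. indep_cols D {1..k}} \<inter> {D. primal D {1..k}}" by (auto simp: basis_ok_def)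
      then show ?thesis using borel_indep_cols[of "{1..k}"] borel_primal[of "{1..k}"] by auto
    qed
    show "(\<lambda>e. indicator {D. basis_ok k D} (\<lambda>i j. e (i, j)) * ennreal (gauss_weight k h e)) \<in> borel_measurable (lebesgue_prod E)"
      unfolding gauss_weight_def Let_def by measurable
  qed
  finally show ?thesis by (simp only: \<rho>_def)
qed

section \<open>Separating the angle from the heights\<close>

definition row_norm :: "nat \<Rightarrow> (nat \<times> nat \<Rightarrow> real) \<Rightarrow> real" where
  "row_norm k h = sqrt (\<Sum>i\<in>{0..k}. (h (i, 0))\<^sup>2)"

definition pos_weight :: "nat \<Rightarrow> (nat \<times> nat \<Rightarrow> real) \<Rightarrow> real" where
  "pos_weight k h = (\<Prod>i\<in>{0..k}. 2 / sqrt (2 * pi) * indicator {0<..} (h (i, 0)))"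

text \<open>This is the constant \<open>c k\<close>: an integral over the heights of the vectors 0
  to \<open>k\<close> and over the reduced basis columns, in which \<open>n\<close> does not
  occur.\<close>

definition basis_const :: "nat \<Rightarrow> ennreal" where
  "basis_const k = (\<integral>\<^sup>+h. ennreal (pos_weight k h * (row_norm k h * exp (- (row_norm k h)\<^sup>2 / 2) / sqrt (2 * pi))) *
     head_kernel k h \<partial>lebesgue_prod ({0..k} \<times> {0}))"

text \<open>In the variable \<open>x = pi / 2 + arctan t\<close> one has
  \<open>angle_prob t = x / pi\<close> and \<open>sin x = 1 / sqrt (1 + t\<^sup>2)\<close>. Of the
  \<open>k + 2\<close> equal factors, \<open>k\<close> give the power of the sine and two give
  \<open>dx\<close>.\<close>

definition angle_integral :: "nat \<Rightarrow> nat \<Rightarrow> ennreal" where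
  "angle_integral k p = (\<integral>\<^sup>+t. ennreal (angle_prob t ^ p * (1 / sqrt (1 + t\<^sup>2)) ^ (k + 2)) \<partial>lborel)"

lemma sigma_finite_PiM_coord: "sigma_finite_measure (PiM A coord)"
  by (rule prob_space_imp_sigma_finite[OF prob_space_PiM_coord])

lemma prod_head_block: "(\<Prod>a\<in>{0..k} \<times> {0}. f a) = (\<Prod>i\<in>{0..k}. f (i, 0))"
  for f :: "nat \<times> nat \<Rightarrow> 'a::comm_monoid_mult"
proof -
  have "{0..k} \<times> {0::nat} = (\<lambda>i. (i, 0)) ` {0..k}" by auto
  moreover have "inj_on (\<lambda>i. (i, 0::nat)) {0..k}" by (auto simp: inj_on_def)
  ultimately show ?thesis by (simp only: prod.reindex o_def)
qed

lemma row_norm_sq: "(row_norm k h)\<^sup>2 = (\<Sum>i\<in>{0..k}. (h (i, 0))\<^sup>2)"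
  unfolding row_norm_def by (rule real_sqrt_pow2) (auto intro: sum_nonneg)

lemma row_norm_nonneg: "row_norm k h \<ge> 0"
  unfolding row_norm_def by (auto intro: sum_nonneg)

lemma prod_head_density:
  "(\<Prod>a\<in>{0..k} \<times> {0}. coord_density a (h a)) = pos_weight k h * exp (- (row_norm k h)\<^sup>2 / 2)"
proof -
  have "(\<Prod>a\<in>{0..k} \<times> {0}. coord_density a (h a)) =
      (\<Prod>i\<in>{0..k}. (2 / sqrt (2 * pi) * indicator {0<..} (h (i, 0))) * exp (- (h (i, 0))\<^sup>2 / 2))"
    unfolding prod_head_block by (intro prod.cong) (auto simp: coord_density_def std_normal_density_def)
  also have "\<dots> = pos_weight k h * (\<Prod>i\<in>{0..k}. exp (- (h (i, 0))\<^sup>2 / 2))"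
    unfolding pos_weight_def by (rule prod.distrib)
  also have "(\<Prod>i\<in>{0..k}. exp (- (h (i, 0))\<^sup>2 / 2)) = exp (- (row_norm k h)\<^sup>2 / 2)"
    unfolding row_norm_sq by (subst exp_sum[symmetric]) (simp_all add: sum_negf sum_divide_distrib)
  finally show ?thesis .
qed

lemma pos_weight_nonneg: "pos_weight k h \<ge> 0"
  unfolding pos_weight_def by (intro prod_nonneg) auto

lemma pos_weight_eq_0: "h (0, 0) \<le> 0 \<Longrightarrow> pos_weight k h = 0"
  unfolding pos_weight_def by (intro prod_zero) (auto intro!: bexI[of _ 0])

lemma row_norm_pos: "h (0, 0) > 0 \<Longrightarrow> row_norm k h > 0"
  unfolding row_norm_def by (intro real_sqrt_gt_zero sum_pos2[of _ 0]) auto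

text \<open>Heights enter the weight only through their ratios to the norm.\<close>

lemma gauss_weight_scale:
  assumes s: "s > 0" and h': "\<And>i. i \<le> k \<Longrightarrow> h' (i, 0) = s * h (i, 0)"
  shows "gauss_weight k h' e = gauss_weight k h e"
proof -
  have "(\<Sum>i\<in>{0..k}. (h' (i, 0))\<^sup>2) = s\<^sup>2 * (\<Sum>i\<in>{0..k}. (h (i, 0))\<^sup>2)"
    unfolding sum_distrib_left using h' by (intro sum.cong) (auto simp: power_mult_distrib)
  then have \<rho>: "sqrt (\<Sum>i\<in>{0..k}. (h' (i, 0))\<^sup>2) = s * sqrt (\<Sum>i\<in>{0..k}. (h (i, 0))\<^sup>2)"
    using s by (simp add: real_sqrt_mult)
  have 1: "h' (0, 0) / (s * r) = h (0, 0) / r" for r using s h'[of 0] by simp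
  have 2: "(\<Sum>i\<in>{1..k}. e (i, j) * h' (i, 0))\<^sup>2 / (s * r)\<^sup>2 = (\<Sum>i\<in>{1..k}. e (i, j) * h (i, 0))\<^sup>2 / r\<^sup>2" for j r
  proof -
    have "(\<Sum>i\<in>{1..k}. e (i, j) * h' (i, 0)) = s * (\<Sum>i\<in>{1..k}. e (i, j) * h (i, 0))"
      unfolding sum_distrib_left using h' by (intro sum.cong) auto
    then show ?thesis using s by (simp add: power_mult_distrib)
  qed
  show ?thesis unfolding gauss_weight_def \<rho> Let_def 1 2 ..
qed

lemma borel_basis_ok: "{D. basis_ok k D} \<in> sets borel"
proof -
  have "{D. basis_ok k D} = {D. indep_cols D {1..k}} \<inter> {D. primal D {1..k}}" by (auto simp: basis_ok_def)
  then show ?thesis using borel_indep_cols[of "{1..k}"] borel_primal[of "{1..k}"] by auto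
qed

lemma measurable_head_kernel: "head_kernel k \<in> borel_measurable (lebesgue_prod ({0..k} \<times> {0}))"
proof -
  let ?H = "{0..k} \<times> {0::nat}" and ?E = "{1..k} \<times> {1..Suc k}"
  interpret E: sigma_finite_measure "lebesgue_prod ?E" by (rule sigma_finite_lebesgue_prod) simp
  let ?M = "lebesgue_prod ?H \<Otimes>\<^sub>M lebesgue_prod ?E"
  have coords [measurable]: "(\<lambda>x. fst x a) \<in> borel_measurable ?M" "(\<lambda>x. snd x a) \<in> borel_measurable ?M" for a
    using measurable_compose[OF measurable_fst measurable_coordinate[of "\<lambda>_. lborel"]]
      measurable_compose[OF measurable_snd measurable_coordinate[of "\<lambda>_. lborel"]] by auto
  have arr [measurable]: "(\<lambda>x. \<lambda>i j. snd x (i, j)) \<in> borel_measurable ?M"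
    by (intro measurable_coordinatewise_then_product coords)
  note [measurable] = borel_basis_ok
  have "(\<lambda>x. indicator {D. basis_ok k D} (\<lambda>i j. snd x (i, j)) * ennreal (gauss_weight k (fst x) (snd x))) \<in> borel_measurable ?M"
    unfolding gauss_weight_def Let_def by measurable
  then show ?thesis unfolding head_kernel_def[abs_def]
    by (intro E.borel_measurable_nn_integral) (simp only: case_prod_unfold)
qed

lemma measurable_row_norm [measurable]: "row_norm k \<in> borel_measurable (lebesgue_prod A)"
proof -
  have [measurable]: "(\<lambda>h. h a) \<in> borel_measurable (lebesgue_prod A)" for a
    by (rule measurable_coordinate) simp
  show ?thesis unfolding row_norm_def[abs_def] by measurable
qed

lemma measurable_pos_weight [measurable]: "pos_weight k \<in> borel_measurable (lebesgue_prod A)"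
proof -
  have [measurable]: "(\<lambda>h. h a) \<in> borel_measurable (lebesgue_prod A)" for a
    by (rule measurable_coordinate) simp
  show ?thesis unfolding pos_weight_def[abs_def] by measurable
qed

lemma normal_avg_substitute:
  assumes "\<rho> > 0"
  shows "normal_avg p \<rho> = (\<integral>\<^sup>+t. ennreal (\<rho> * std_normal_density (\<rho> * t)) * ennreal (angle_prob t) ^ p \<partial>lborel)"
proof -
  have "normal_avg p \<rho> = ennreal \<bar>\<rho>\<bar> * (\<integral>\<^sup>+t. ennreal (std_normal_density (0 + \<rho> * t)) * ennreal (angle_prob ((0 + \<rho> * t) / \<rho>)) ^ p \<partial>lborel)"
    unfolding normal_avg_def using assms by (intro nn_integral_real_affine) auto
  also have "\<dots> = (\<integral>\<^sup>+t. ennreal \<bar>\<rho>\<bar> * (ennreal (std_normal_density (0 + \<rho> * t)) * ennreal (angle_prob ((0 + \<rho> * t) / \<rho>)) ^ p) \<partial>lborel)"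
    by (rule nn_integral_cmult[symmetric]) measurable
  also have "\<dots> = (\<integral>\<^sup>+t. ennreal (\<rho> * std_normal_density (\<rho> * t)) * ennreal (angle_prob t) ^ p \<partial>lborel)"
    using assms by (intro nn_integral_cong) (simp add: ennreal_mult mult.assoc)
  finally show ?thesis .
qed

text \<open>The substitution \<open>x = \<rho> * t\<close> in \<open>normal_avg\<close> merges the
  Gaussian factors into one exponential of \<open>- (1 + t\<^sup>2) * \<rho>\<^sup>2 / 2\<close>.
  Rescaling the heights by \<open>s = 1 / sqrt (1 + t\<^sup>2)\<close> removes \<open>t\<close> from
  the exponent; the \<open>k + 1\<close> coordinates and the factor \<open>\<rho>\<close> of the
  substitution contribute \<open>s ^ (k + 2)\<close>.\<close>

lemma head_integral:
  "(\<integral>\<^sup>+h. (\<Prod>a\<in>{0..k} \<times> {0}. ennreal (coord_density a (h a))) * (head_kernel k h * normal_avg p (row_norm k h))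
     \<partial>lebesgue_prod ({0..k} \<times> {0})) = basis_const k * angle_integral k p"
proof -
  let ?H = "{0..k} \<times> {0::nat}"
  note [measurable] = measurable_head_kernel[of k]
  define X where "X = (\<lambda>h t. ennreal (pos_weight k h * (row_norm k h * exp (- ((1 + t\<^sup>2) * (row_norm k h)\<^sup>2) / 2) / sqrt (2 * pi))) *
    head_kernel k h)"
  have "(\<integral>\<^sup>+h. (\<Prod>a\<in>?H. ennreal (coord_density a (h a))) * (head_kernel k h * normal_avg p (row_norm k h)) \<partial>lebesgue_prod ?H) =
    (\<integral>\<^sup>+h. (\<integral>\<^sup>+t. X h t * ennreal (angle_prob t) ^ p \<partial>lborel) \<partial>lebesgue_prod ?H)"
  proof (rule nn_integral_cong)
    fix h :: "nat \<times> nat \<Rightarrow> real"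
    have dens: "(\<Prod>a\<in>?H. ennreal (coord_density a (h a))) = ennreal (pos_weight k h * exp (- (row_norm k h)\<^sup>2 / 2))"
      unfolding prod_head_density[symmetric] by (rule prod_ennreal) simp
    show "(\<Prod>a\<in>?H. ennreal (coord_density a (h a))) * (head_kernel k h * normal_avg p (row_norm k h)) =
        (\<integral>\<^sup>+t. X h t * ennreal (angle_prob t) ^ p \<partial>lborel)"
    proof (cases "h (0, 0) > 0")
      case False
      then show ?thesis unfolding dens X_def by (simp add: pos_weight_eq_0)
    next
      case True
      define r where "r = row_norm k h"
      have r: "r > 0" using row_norm_pos[where h = h, OF True] by (simp add: r_def)
      have "(\<Prod>a\<in>?H. ennreal (coord_density a (h a))) * (head_kernel k h * normal_avg p (row_norm k h)) =
          (ennreal (pos_weight k h * exp (- r\<^sup>2 / 2)) * head_kernel k h) *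
          (\<integral>\<^sup>+t. ennreal (r * std_normal_density (r * t)) * ennreal (angle_prob t) ^ p \<partial>lborel)"
        unfolding dens r_def[symmetric] normal_avg_substitute[OF r] by (simp only: mult.assoc)
      also have "\<dots> = (\<integral>\<^sup>+t. (ennreal (pos_weight k h * exp (- r\<^sup>2 / 2)) * head_kernel k h) *
          (ennreal (r * std_normal_density (r * t)) * ennreal (angle_prob t) ^ p) \<partial>lborel)"
        by (rule nn_integral_cmult[symmetric]) measurable
      also have "\<dots> = (\<integral>\<^sup>+t. X h t * ennreal (angle_prob t) ^ p \<partial>lborel)"
      proof (rule nn_integral_cong)
        fix t :: real
        have "pos_weight k h * exp (- r\<^sup>2 / 2) * (r * std_normal_density (r * t)) =
            pos_weight k h * (r * exp (- ((1 + t\<^sup>2) * r\<^sup>2) / 2) / sqrt (2 * pi))"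
          by (simp add: std_normal_density_def exp_add[symmetric] power_mult_distrib algebra_simps add_divide_distrib)
        moreover have "ennreal (pos_weight k h * exp (- r\<^sup>2 / 2)) * ennreal (r * std_normal_density (r * t)) =
            ennreal (pos_weight k h * exp (- r\<^sup>2 / 2) * (r * std_normal_density (r * t)))"
          using r pos_weight_nonneg[of k h] by (intro ennreal_mult[symmetric]) auto
        ultimately have eq: "ennreal (pos_weight k h * exp (- r\<^sup>2 / 2)) * ennreal (r * std_normal_density (r * t)) =
            ennreal (pos_weight k h * (r * exp (- ((1 + t\<^sup>2) * r\<^sup>2) / 2) / sqrt (2 * pi)))" by (simp only:)
        have "(a * K) * (b * v) = (a * b) * K * v" for a b K v :: ennreal by (simp only: mult_ac)
        then show "(ennreal (pos_weight k h * exp (- r\<^sup>2 / 2)) * head_kernel k h) *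
          (ennreal (r * std_normal_density (r * t)) * ennreal (angle_prob t) ^ p) = X h t * ennreal (angle_prob t) ^ p"
          unfolding X_def r_def[symmetric] eq[symmetric] .
      qed
      finally show ?thesis .
    qed
  qed
  also have "\<dots> = (\<integral>\<^sup>+t. (\<integral>\<^sup>+h. X h t * ennreal (angle_prob t) ^ p \<partial>lebesgue_prod ?H) \<partial>lborel)"
  proof (rule pair_sigma_finite.Fubini')
    show "pair_sigma_finite lborel (lebesgue_prod ?H)"
      using sigma_finite_lebesgue_prod[of ?H] lborel.sigma_finite_measure_axioms by (simp add: pair_sigma_finite_def)
    show "(\<lambda>(t, h). X h t * ennreal (angle_prob t) ^ p) \<in> borel_measurable (lborel \<Otimes>\<^sub>M lebesgue_prod ?H)"
      unfolding X_def by measurable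
  qed
  also have "\<dots> = (\<integral>\<^sup>+t. basis_const k * ennreal (angle_prob t ^ p * (1 / sqrt (1 + t\<^sup>2)) ^ (k + 2)) \<partial>lborel)"
  proof (rule nn_integral_cong)
    fix t :: real
    define s where "s = 1 / sqrt (1 + t\<^sup>2)"
    have pos: "1 + t\<^sup>2 > 0" by (simp add: add_pos_nonneg)
    have s: "s > 0" using pos by (simp add: s_def)
    have s2: "(1 + t\<^sup>2) * s\<^sup>2 = 1" using pos by (simp add: s_def power_divide)
    let ?sub = "\<lambda>h. \<lambda>a\<in>?H. 0 + s * h a"
    have meas: "(\<lambda>h. X h t) \<in> borel_measurable (lebesgue_prod ?H)" unfolding X_def by measurable
    have sub: "X (?sub h) t = ennreal s * (ennreal (pos_weight k h * (row_norm k h * exp (- (row_norm k h)\<^sup>2 / 2) / sqrt (2 * pi))) *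
        head_kernel k h)" for h
    proof -
      have h': "?sub h (i, 0) = s * h (i, 0)" if "i \<le> k" for i using that by simp
      have "(\<Sum>i\<in>{0..k}. (?sub h (i, 0))\<^sup>2) = s\<^sup>2 * (\<Sum>i\<in>{0..k}. (h (i, 0))\<^sup>2)"
        unfolding sum_distrib_left using h' by (intro sum.cong) (auto simp: power_mult_distrib)
      then have norm: "row_norm k (?sub h) = s * row_norm k h"
        unfolding row_norm_def using s by (simp add: real_sqrt_mult)
      have weight: "pos_weight k (?sub h) = pos_weight k h"
        unfolding pos_weight_def using h' s by (intro prod.cong) (auto simp: indicator_def zero_less_mult_iff)
      have kernel: "head_kernel k (?sub h) = head_kernel k h"
        unfolding head_kernel_def by (intro nn_integral_cong arg_cong2[of _ _ _ _ "(*)"] refl arg_cong[of _ _ ennreal]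
          gauss_weight_scale[OF s] h')
      have expo: "(1 + t\<^sup>2) * (s * row_norm k h)\<^sup>2 = (row_norm k h)\<^sup>2"
        using s2 by (simp add: power_mult_distrib mult.assoc[symmetric])
      have "X (?sub h) t = ennreal (s * (pos_weight k h * (row_norm k h * exp (- (row_norm k h)\<^sup>2 / 2) / sqrt (2 * pi)))) *
          head_kernel k h"
        unfolding X_def norm weight kernel expo by (simp add: mult_ac)
      also have "\<dots> = ennreal s * ennreal (pos_weight k h * (row_norm k h * exp (- (row_norm k h)\<^sup>2 / 2) / sqrt (2 * pi))) *
          head_kernel k h"
        using s pos_weight_nonneg[of k h] row_norm_nonneg[of k h] by (subst ennreal_mult) auto
      finally show ?thesis by (simp only: mult.assoc)
    qed
    have "(\<integral>\<^sup>+h. X h t * ennreal (angle_prob t) ^ p \<partial>lebesgue_prod ?H) =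
        (\<integral>\<^sup>+h. X h t \<partial>lebesgue_prod ?H) * ennreal (angle_prob t) ^ p"
      by (rule nn_integral_multc) (rule meas)
    also have "(\<integral>\<^sup>+h. X h t \<partial>lebesgue_prod ?H) = (\<Prod>a\<in>?H. ennreal \<bar>s\<bar>) * (\<integral>\<^sup>+h. X (?sub h) t \<partial>lebesgue_prod ?H)"
      by (rule nn_integral_lebesgue_prod_affine[OF _ meas]) (use s in auto)
    also have "(\<integral>\<^sup>+h. X (?sub h) t \<partial>lebesgue_prod ?H) = ennreal s * basis_const k"
      unfolding sub basis_const_def by (rule nn_integral_cmult) measurable
    also have "(\<Prod>a\<in>?H. ennreal \<bar>s\<bar>) = ennreal (s ^ Suc k)"
    proof -
      have "card ?H = Suc k" by simp
      then have "(\<Prod>a\<in>?H. ennreal \<bar>s\<bar>) = ennreal \<bar>s\<bar> ^ Suc k" by (simp only: prod_constant)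
      then show ?thesis using s by (simp only: ennreal_power abs_of_pos less_imp_le)
    qed
    also have "ennreal (s ^ Suc k) * (ennreal s * basis_const k) * ennreal (angle_prob t) ^ p =
        basis_const k * (ennreal (angle_prob t) ^ p * (ennreal (s ^ Suc k) * ennreal s))"
      by (simp only: mult_ac)
    also have "ennreal (angle_prob t) ^ p * (ennreal (s ^ Suc k) * ennreal s) = ennreal (angle_prob t ^ p * s ^ (k + 2))"
    proof -
      have "ennreal (s ^ Suc k) * ennreal s = ennreal (s ^ (k + 2))"
        using s by (subst ennreal_mult[symmetric]) (auto simp: mult_ac)
      moreover have "ennreal (angle_prob t) ^ p = ennreal (angle_prob t ^ p)"
        by (rule ennreal_power[OF angle_prob_nonneg])
      ultimately show ?thesis using s angle_prob_nonneg[of t] by (simp add: ennreal_mult)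
    qed
    finally show "(\<integral>\<^sup>+h. X h t * ennreal (angle_prob t) ^ p \<partial>lebesgue_prod ?H) =
        basis_const k * ennreal (angle_prob t ^ p * (1 / sqrt (1 + t\<^sup>2)) ^ (k + 2))"
      unfolding s_def .
  qed
  also have "\<dots> = basis_const k * angle_integral k p"
    unfolding angle_integral_def by (rule nn_integral_cmult) measurable
  finally show ?thesis .
qed

theorem optimal_probability:
  assumes k: "k \<le> n"
  shows "(\<integral>\<^sup>+g. indicator {D. optimal n D {1..k}} (cols g) \<partial>PiM ({0..n} \<times> {0..Suc k}) coord) =
    basis_const k * angle_integral k (n - k)"
proof -
  \<comment> \<open>The array is cut into the heights of the vectors 0 to \<open>k\<close>, the rest
    of vector 0, the rest of the basis vectors, and all other vectors. \<open>O'\<close> is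
    integrated first, then \<open>Z\<close> and \<open>E\<close> for fixed heights, and
    \<open>H\<close> last.\<close>
  define H where "H = {0..k} \<times> {0::nat}"
  define Z where "Z = {0::nat} \<times> {1..Suc k}"
  define E where "E = {1..k} \<times> {1..Suc k}"
  define O' where "O' = {Suc k..n} \<times> {0..Suc k}"
  define W where "W = (\<lambda>w. col_factor k (n - k) (w (0, 0)) (\<lambda>j. w (0, j)) (cols w))"
  have fin: "finite H" "finite Z" "finite E" "finite O'" by (auto simp: H_def Z_def E_def O'_def)
  have disj: "H \<inter> (Z \<union> E) = {}" "(H \<union> (Z \<union> E)) \<inter> O' = {}"
    by (auto simp: H_def Z_def E_def O'_def)
  have split: "{0..n} \<times> {0..Suc k} = (H \<union> (Z \<union> E)) \<union> O'"
    using k by (auto simp: H_def Z_def E_def O'_def)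
  let ?F = "\<lambda>g. indicator {D. optimal n D {1..k}} (cols g) :: ennreal"
  have F: "?F \<in> borel_measurable (PiM A coord)" for A
  proof -
    have "(indicator {D. optimal n D {1..k}} :: _ \<Rightarrow> ennreal) \<in> borel_measurable borel"
      using borel_optimal[of "{1..k}" n] by simp
    from measurable_compose[OF measurable_cols this] show ?thesis by simp
  qed
  have inner: "(\<integral>\<^sup>+v. ?F (merge (H \<union> (Z \<union> E)) O' (w, v)) \<partial>PiM O' coord) = W w" for w
    unfolding O'_def W_def
    by (rule inner_columns[OF k disj(2)[unfolded O'_def]]) (auto simp: H_def Z_def E_def)
  have W: "W \<in> borel_measurable (PiM (H \<union> (Z \<union> E)) coord)"
  proof -
    interpret sigma_finite_measure "PiM O' coord" by (rule sigma_finite_PiM_coord)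
    have "(\<lambda>x. ?F (merge (H \<union> (Z \<union> E)) O' x)) \<in> borel_measurable (PiM (H \<union> (Z \<union> E)) coord \<Otimes>\<^sub>M PiM O' coord)"
      by (rule measurable_compose[OF measurable_merge F])
    then have "(\<lambda>w. \<integral>\<^sup>+v. ?F (merge (H \<union> (Z \<union> E)) O' (w, v)) \<partial>PiM O' coord) \<in> borel_measurable (PiM (H \<union> (Z \<union> E)) coord)"
      by (intro borel_measurable_nn_integral) (simp only: case_prod_unfold prod.collapse)
    then show ?thesis unfolding inner .
  qed
  have "(\<integral>\<^sup>+g. ?F g \<partial>PiM ({0..n} \<times> {0..Suc k}) coord) =
      (\<integral>\<^sup>+w. (\<integral>\<^sup>+v. ?F (merge (H \<union> (Z \<union> E)) O' (w, v)) \<partial>PiM O' coord) \<partial>PiM (H \<union> (Z \<union> E)) coord)"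
    unfolding split by (rule coords.product_nn_integral_fold) (use disj fin F in auto)
  also have "\<dots> = (\<integral>\<^sup>+w. W w \<partial>PiM (H \<union> (Z \<union> E)) coord)" unfolding inner ..
  also have "\<dots> = (\<integral>\<^sup>+h. (\<integral>\<^sup>+x. W (merge H (Z \<union> E) (h, x)) \<partial>PiM (Z \<union> E) coord) \<partial>PiM H coord)"
    by (rule coords.product_nn_integral_fold) (use disj fin W in auto)
  also have "\<dots> = (\<integral>\<^sup>+h. (\<Prod>a\<in>H. ennreal (coord_density a (h a))) *
      (\<integral>\<^sup>+x. W (merge H (Z \<union> E) (h, x)) \<partial>PiM (Z \<union> E) coord) \<partial>lebesgue_prod H)"
  proof (rule nn_integral_PiM_coord[OF fin(1)])
    interpret sigma_finite_measure "PiM (Z \<union> E) coord" by (rule sigma_finite_PiM_coord)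
    have "(\<lambda>x. W (merge H (Z \<union> E) x)) \<in> borel_measurable (PiM H coord \<Otimes>\<^sub>M PiM (Z \<union> E) coord)"
      by (rule measurable_compose[OF measurable_merge W])
    then have "(\<lambda>h. \<integral>\<^sup>+x. W (merge H (Z \<union> E) (h, x)) \<partial>PiM (Z \<union> E) coord) \<in> borel_measurable (PiM H coord)"
      by (intro borel_measurable_nn_integral) (simp only: case_prod_unfold prod.collapse)
    then show "(\<lambda>h. \<integral>\<^sup>+x. W (merge H (Z \<union> E) (h, x)) \<partial>PiM (Z \<union> E) coord) \<in> borel_measurable (lebesgue_prod H)"
      by (simp add: measurable_PiM_coord_iff)
  qed
  also have "\<dots> = (\<integral>\<^sup>+h. (\<Prod>a\<in>H. ennreal (coord_density a (h a))) *
      (head_kernel k h * normal_avg (n - k) (row_norm k h)) \<partial>lebesgue_prod H)"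
  proof (rule nn_integral_cong)
    fix h assume h: "h \<in> space (lebesgue_prod H)"
    show "(\<Prod>a\<in>H. ennreal (coord_density a (h a))) * (\<integral>\<^sup>+x. W (merge H (Z \<union> E) (h, x)) \<partial>PiM (Z \<union> E) coord) =
        (\<Prod>a\<in>H. ennreal (coord_density a (h a))) * (head_kernel k h * normal_avg (n - k) (row_norm k h))"
    proof (cases "h (0, 0) > 0")
      case True
      have "(\<integral>\<^sup>+x. W (merge H (Z \<union> E) (h, x)) \<partial>PiM (Z \<union> E) coord) =
          head_kernel k h * normal_avg (n - k) (row_norm k h)"
        unfolding row_norm_def W_def H_def Z_def E_def
        by (rule integrate_rows) (use W h True in \<open>simp_all add: W_def H_def Z_def E_def space_PiM\<close>)
      then show ?thesis by simp
    next
      case False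
      have "(\<Prod>a\<in>H. ennreal (coord_density a (h a))) = 0"
      proof (rule prod_zero)
        show "\<exists>a\<in>H. ennreal (coord_density a (h a)) = 0"
          using False by (intro bexI[of _ "(0, 0)"]) (auto simp: H_def coord_density_def)
      qed (rule fin)
      then show ?thesis by (simp only: mult_zero_left)
    qed
  qed
  also have "\<dots> = basis_const k * angle_integral k (n - k)" unfolding H_def by (rule head_integral)
  finally show ?thesis .
qed

section \<open>Symmetry and genericity of the random columns\<close>

lemma measurable_indicator_cols:
  assumes "S \<in> sets borel"
  shows "(\<lambda>g. indicator S (cols g) :: ennreal) \<in> borel_measurable (PiM A coord)"
  by (rule measurable_compose[OF measurable_cols]) (use assms in auto)

lemma sets_cols_Collect:
  assumes "{D. Q D} \<in> sets borel"
  shows "{g \<in> space (PiM A coord). Q (cols g)} \<in> sets (PiM A coord)"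
proof -
  have "{g \<in> space (PiM A coord). Q (cols g)} = cols -` {D. Q D} \<inter> space (PiM A coord)" by auto
  then show ?thesis using measurable_sets[OF measurable_cols assms, of coord A] by simp
qed

lemma emeasure_cols_Collect:
  assumes "{D. Q D} \<in> sets borel"
  shows "emeasure (PiM A coord) {g \<in> space (PiM A coord). Q (cols g)} =
    (\<integral>\<^sup>+g. indicator {D. Q D} (cols g) \<partial>PiM A coord)"
  by (subst nn_integral_indicator[symmetric, OF sets_cols_Collect[OF assms]])
    (auto intro!: nn_integral_cong simp: indicator_def)

text \<open>An event about reduced columns can be computed on any block of entries that decides
  it.\<close>

lemma nn_integral_cols_restrict:
  assumes "B \<subseteq> A" "finite A" "S \<in> sets borel"
    and S: "\<And>g. cols (restrict g B) \<in> S \<longleftrightarrow> cols g \<in> S"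
  shows "(\<integral>\<^sup>+g. indicator S (cols g) \<partial>PiM A coord) = (\<integral>\<^sup>+g. indicator S (cols g) \<partial>PiM B coord)"
proof -
  have "(\<integral>\<^sup>+g. indicator S (cols g) \<partial>PiM B coord) =
      (\<integral>\<^sup>+g. indicator S (cols g) \<partial>distr (PiM A coord) (PiM B coord) (\<lambda>f. restrict f B))"
    using coords.distr_restrict[OF assms(1,2)] by simp
  also have "\<dots> = (\<integral>\<^sup>+g. indicator S (cols (restrict g B)) \<partial>PiM A coord)"
    by (rule nn_integral_distr)
      (use assms in \<open>auto intro!: measurable_restrict_subset measurable_indicator_cols\<close>)
  also have "\<dots> = (\<integral>\<^sup>+g. indicator S (cols g) \<partial>PiM A coord)"
    using S by (intro nn_integral_cong) (simp add: indicator_def)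
  finally show ?thesis ..
qed

lemma optimal_cong:
  assumes I: "I \<subseteq> {1..n}" and D: "\<And>i j. i \<in> {1..n} \<Longrightarrow> j \<in> {1..Suc (card I)} \<Longrightarrow> D i j = D' i j"
  shows "optimal n D I \<longleftrightarrow> optimal n D' I"
proof -
  have 1: "(\<Sum>i\<in>I. x i * D i j) = (\<Sum>i\<in>I. x i * D' i j)" if "j \<in> {1..card I}" for x j
    using D I that by (intro sum.cong) (auto simp: subset_iff)
  have 2: "(\<Sum>j\<in>{1..Suc (card I)}. c j * D i j) = (\<Sum>j\<in>{1..Suc (card I)}. c j * D' i j)" if "i \<in> {1..n}" for c i
    using D that by (intro sum.cong) auto
  have "indep_cols D I \<longleftrightarrow> indep_cols D' I"
    unfolding indep_cols_def using 1 by simp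
  moreover have "primal D I \<longleftrightarrow> primal D' I"
  proof -
    have "(\<forall>j\<in>{1..card I}. (\<Sum>i\<in>I. x i * D i j) = b j) \<longleftrightarrow> (\<forall>j\<in>{1..card I}. (\<Sum>i\<in>I. x i * D' i j) = b j)" for x b
      by (intro ball_cong) (auto simp: 1)
    then show ?thesis unfolding primal_def by (simp only:)
  qed
  moreover have "dual n D I \<longleftrightarrow> dual n D' I"
  proof -
    have "(\<forall>i\<in>I. (\<Sum>j\<in>{1..Suc (card I)}. c j * D i j) = 0) \<longleftrightarrow> (\<forall>i\<in>I. (\<Sum>j\<in>{1..Suc (card I)}. c j * D' i j) = 0)"
      "(\<forall>i\<in>{1..n} - I. (\<Sum>j\<in>{1..Suc (card I)}. c j * D i j) > 0) \<longleftrightarrow> (\<forall>i\<in>{1..n} - I. (\<Sum>j\<in>{1..Suc (card I)}. c j * D' i j) > 0)" for c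
      using 2 I by (intro ball_cong refl; metis DiffD1 subsetD)+
    then show ?thesis unfolding dual_def by (simp only:)
  qed
  ultimately show ?thesis by (simp add: optimal_def)
qed

lemma optimal_permute:
  assumes \<pi>: "bij_betw \<pi> {1..n} {1..n}" and I: "I \<subseteq> {1..n}"
  shows "optimal n (\<lambda>i. D (\<pi> i)) I \<longleftrightarrow> optimal n D (\<pi> ` I)"
proof -
  define \<psi> where "\<psi> = inv_into {1..n} \<pi>"
  have inj: "inj_on \<pi> {1..n}" and im: "\<pi> ` {1..n} = {1..n}" using \<pi> by (auto simp: bij_betw_def)
  have injI: "inj_on \<pi> I" using inj I by (rule inj_on_subset)
  have \<psi>: "\<psi> (\<pi> i) = i" if "i \<in> {1..n}" for i using that inj by (simp add: \<psi>_def)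
  have card: "card (\<pi> ` I) = card I" by (rule card_image[OF injI])
  have sum1: "(\<Sum>i\<in>\<pi> ` I. x i * D i j) = (\<Sum>i\<in>I. x (\<pi> i) * D (\<pi> i) j)" for x j
    by (simp add: sum.reindex[OF injI])
  have sum2: "(\<Sum>i\<in>I. x i * D (\<pi> i) j) = (\<Sum>i\<in>\<pi> ` I. x (\<psi> i) * D i j)" for x j
    unfolding sum1 using \<psi> I by (intro sum.cong) auto
  have diff: "{1..n} - \<pi> ` I = \<pi> ` ({1..n} - I)"
    using inj_on_image_set_diff[OF inj, of "{1..n}" I] im I by auto
  have "indep_cols (\<lambda>i. D (\<pi> i)) I \<longleftrightarrow> indep_cols D (\<pi> ` I)"
  proof
    assume L: "indep_cols (\<lambda>i. D (\<pi> i)) I"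
    show "indep_cols D (\<pi> ` I)" unfolding indep_cols_def card sum1
      using L unfolding indep_cols_def by (auto dest: spec[of _ "\<lambda>i. _ (\<pi> i)"])
  next
    assume R: "indep_cols D (\<pi> ` I)"
    show "indep_cols (\<lambda>i. D (\<pi> i)) I" unfolding indep_cols_def
    proof (intro allI impI ballI)
      fix x i assume x: "\<forall>j\<in>{1..card I}. (\<Sum>i\<in>I. x i * D (\<pi> i) j) = 0" and i: "i \<in> I"
      have "x (\<psi> (\<pi> i)) = 0"
        by (rule indep_colsD[OF R, of "\<lambda>i. x (\<psi> i)"]) (use x i in \<open>auto simp: card sum2\<close>)
      then show "x i = 0" using \<psi> i I by auto
    qed
  qed
  moreover have "primal (\<lambda>i. D (\<pi> i)) I \<longleftrightarrow> primal D (\<pi> ` I)"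
  proof
    assume "primal (\<lambda>i. D (\<pi> i)) I"
    then obtain x where "\<forall>i\<in>I. x i > 0"
      "\<forall>j\<in>{1..card I}. (\<Sum>i\<in>I. x i * D (\<pi> i) j) = (if j = card I then 1 else 0)" unfolding primal_def by blast
    then show "primal D (\<pi> ` I)" unfolding primal_def card sum2
      using \<psi> I by (intro exI[of _ "\<lambda>i. x (\<psi> i)"]) auto
  next
    assume "primal D (\<pi> ` I)"
    then obtain x where "\<forall>i\<in>\<pi> ` I. x i > 0"
      "\<forall>j\<in>{1..card I}. (\<Sum>i\<in>I. x (\<pi> i) * D (\<pi> i) j) = (if j = card I then 1 else 0)"
      unfolding primal_def card sum1 by blast
    then show "primal (\<lambda>i. D (\<pi> i)) I" unfolding primal_def
      by (intro exI[of _ "\<lambda>i. x (\<pi> i)"]) auto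
  qed
  moreover have "dual n (\<lambda>i. D (\<pi> i)) I \<longleftrightarrow> dual n D (\<pi> ` I)"
    unfolding dual_def card diff by simp
  ultimately show ?thesis by (simp add: optimal_def)
qed

lemma exists_perm_image:
  assumes "I \<subseteq> {1..n::nat}"
  shows "\<exists>\<pi>. bij_betw \<pi> {1..n} {1..n} \<and> \<pi> ` {1..card I} = I"
proof -
  have fin: "finite I" using assms by (rule finite_subset) auto
  have le: "card I \<le> n" using card_mono[OF _ assms] by simp
  obtain f where f: "bij_betw f {1..card I} I"
    using finite_same_card_bij[of "{1..card I}" I] fin by auto
  obtain g where g: "bij_betw g {Suc (card I)..n} ({1..n} - I)"
    using finite_same_card_bij[of "{Suc (card I)..n}" "{1..n} - I"] fin assms
    by (auto simp: card_Diff_subset)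
  define \<pi> where "\<pi> = (\<lambda>i. if i \<in> {1..card I} then f i else g i)"
  have "bij_betw \<pi> ({1..card I} \<union> {Suc (card I)..n}) (I \<union> ({1..n} - I))"
    unfolding \<pi>_def by (rule bij_betw_disjoint_Un[OF f g]) auto
  moreover have "{1..card I} \<union> {Suc (card I)..n} = {1..n}" "I \<union> ({1..n} - I) = {1..n}"
    using le assms by auto
  moreover have "\<pi> ` {1..card I} = I" using f by (auto simp: \<pi>_def bij_betw_def)
  ultimately show ?thesis by metis
qed

text \<open>After dropping the rows beyond \<open>Suc k\<close>, exchangeability of the vectors 1 to
  \<open>n\<close> allows \<open>I\<close> to be relabelled as \<open>{1..k}\<close>. Vector number
  0 keeps its place because the reduction refers to it.\<close>

lemma optimal_probability_subset:
  assumes I: "I \<subseteq> {1..n}"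
  shows "(\<integral>\<^sup>+g. indicator {D. optimal n D I} (cols g) \<partial>PiM ({0..n} \<times> {0..Suc n}) coord) =
    basis_const (card I) * angle_integral (card I) (n - card I)"
proof -
  define k where "k = card I"
  have finI: "finite I" using I by (rule finite_subset) auto
  have k: "k \<le> n" using card_mono[OF _ I] by (simp add: k_def)
  obtain \<pi> where \<pi>: "bij_betw \<pi> {1..n} {1..n}" "\<pi> ` {1..k} = I"
    using exists_perm_image[OF I] unfolding k_def by blast
  let ?A = "{0..n} \<times> {0..Suc k}"
  have borel: "{D. optimal n D I} \<in> sets borel" "{D. optimal n D {1..k}} \<in> sets borel"
    using borel_optimal finI by auto
  define f where "f = (\<lambda>a. (if fst a = 0 then 0 else \<pi> (fst a), snd a) :: nat \<times> nat)"
  have \<pi>_range: "\<pi> i \<in> {1..n}" if "i \<in> {1..n}" for i using \<pi>(1) that by (auto simp: bij_betw_def)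
  have f_inj: "inj_on f ?A"
  proof (rule inj_onI)
    fix a b assume ab: "a \<in> ?A" "b \<in> ?A" "f a = f b"
    have eq: "(if fst a = 0 then 0 else \<pi> (fst a)) = (if fst b = 0 then 0 else \<pi> (fst b))" "snd a = snd b"
      using ab(3) by (simp_all add: f_def)
    have pos: "\<pi> (fst c) \<noteq> 0" if "c \<in> ?A" "fst c \<noteq> 0" for c :: "nat \<times> nat"
      using \<pi>_range[of "fst c"] that by (auto simp: mem_Times_iff)
    have "fst a = fst b"
    proof (cases "fst a = 0 \<or> fst b = 0")
      case True
      then show ?thesis using eq(1) pos[OF ab(1)] pos[OF ab(2)] by metis
    next
      case False
      then have "\<pi> (fst a) = \<pi> (fst b)" "fst a \<in> {1..n}" "fst b \<in> {1..n}"
        using eq(1) ab(1,2) by (auto simp: mem_Times_iff)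
      then show ?thesis using bij_betw_imp_inj_on[OF \<pi>(1)] by (meson inj_onD)
    qed
    then show "a = b" using eq(2) by (simp add: prod_eq_iff)
  qed
  have f_range: "f \<in> ?A \<rightarrow> ?A"
  proof
    fix a assume "a \<in> ?A"
    then show "f a \<in> ?A" using \<pi>_range[of "fst a"] by (auto simp: f_def mem_Times_iff)
  qed
  have coord_f: "coord (f a) = coord a" for a
    by (simp add: coord_def coord_density_def[abs_def] f_def)
  have "(\<integral>\<^sup>+g. indicator {D. optimal n D I} (cols g) \<partial>PiM ({0..n} \<times> {0..Suc n}) coord) =
      (\<integral>\<^sup>+g. indicator {D. optimal n D I} (cols g) \<partial>PiM ?A coord)"
  proof (rule nn_integral_cols_restrict)
    show "?A \<subseteq> {0..n} \<times> {0..Suc n}" using k by auto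
    show "cols (restrict g ?A) \<in> {D. optimal n D I} \<longleftrightarrow> cols g \<in> {D. optimal n D I}" for g
      unfolding mem_Collect_eq by (rule optimal_cong[OF I]) (auto simp: cols_def k_def)
  qed (use borel in auto)
  also have "\<dots> = (\<integral>\<^sup>+g. indicator {D. optimal n D {1..k}} (cols (\<lambda>a\<in>?A. g (f a))) \<partial>PiM ?A coord)"
  proof (intro nn_integral_cong)
    fix g :: "nat \<times> nat \<Rightarrow> real"
    have "optimal n (cols (\<lambda>a\<in>?A. g (f a))) {1..k} \<longleftrightarrow> optimal n (\<lambda>i. cols g (\<pi> i)) {1..k}"
      using k by (intro optimal_cong) (auto simp: cols_def f_def)
    also have "\<dots> \<longleftrightarrow> optimal n (cols g) (\<pi> ` {1..k})" using k by (intro optimal_permute[OF \<pi>(1)]) auto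
    finally have "optimal n (cols (\<lambda>a\<in>?A. g (f a))) {1..k} \<longleftrightarrow> optimal n (cols g) I"
      unfolding \<pi>(2) .
    then show "indicator {D. optimal n D I} (cols g) =
        (indicator {D. optimal n D {1..k}} (cols (\<lambda>a\<in>?A. g (f a))) :: ennreal)"
      by (simp add: indicator_def)
  qed
  also have "\<dots> = (\<integral>\<^sup>+g. indicator {D. optimal n D {1..k}} (cols g)
      \<partial>distr (PiM ?A coord) (PiM ?A (\<lambda>a. coord (f a))) (\<lambda>g. \<lambda>a\<in>?A. g (f a)))"
  proof (rule nn_integral_distr[symmetric])
    show "(\<lambda>g. \<lambda>a\<in>?A. g (f a)) \<in> measurable (PiM ?A coord) (PiM ?A (\<lambda>a. coord (f a)))"
    proof (rule measurable_restrict)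
      fix a assume "a \<in> ?A"
      then have "f a \<in> ?A" using f_range by blast
      then show "(\<lambda>g. g (f a)) \<in> measurable (PiM ?A coord) (coord (f a))"
        by (rule measurable_component_singleton)
    qed
    show "(\<lambda>g. indicator {D. optimal n D {1..k}} (cols g) :: ennreal) \<in> borel_measurable (distr (PiM ?A coord) (PiM ?A (\<lambda>a. coord (f a))) (\<lambda>g. \<lambda>a\<in>?A. g (f a)))"
      using measurable_indicator_cols[OF borel(2), of ?A] by (simp add: coord_f)
  qed
  also have "distr (PiM ?A coord) (PiM ?A (\<lambda>a. coord (f a))) (\<lambda>g. \<lambda>a\<in>?A. g (f a)) = PiM ?A (\<lambda>a. coord (f a))"
    by (rule distr_PiM_reindex[OF prob_space_coord f_inj f_range])
  also have "PiM ?A (\<lambda>a. coord (f a)) = PiM ?A coord" by (simp add: coord_f)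
  also have "(\<integral>\<^sup>+g. indicator {D. optimal n D {1..k}} (cols g) \<partial>PiM ?A coord) = basis_const k * angle_integral k (n - k)"
    by (rule optimal_probability[OF k])
  finally show ?thesis by (simp add: k_def)
qed

section \<open>Reflection of a row\<close>

lemma feas_neg_iff_flip: "feas_neg n k D \<longleftrightarrow> feas_pos n k (\<lambda>i j. if j = k then - D i j else D i j)"
proof -
  have "comb n (\<lambda>i j. if j = k then - D i j else D i j) x j = (if j = k then - comb n D x j else comb n D x j)" for x j
    by (simp add: comb_def sum_negf)
  then have "(\<forall>j\<in>{1..<k}. comb n (\<lambda>i j. if j = k then - D i j else D i j) x j = 0) \<longleftrightarrow> (\<forall>j\<in>{1..<k}. comb n D x j = 0)"
    "comb n (\<lambda>i j. if j = k then - D i j else D i j) x k = - comb n D x k" for x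
    by auto
  then show ?thesis unfolding feas_neg_def feas_pos_def by simp
qed

lemma feas_pos_cong:
  assumes "\<And>i j. i \<in> {1..n} \<Longrightarrow> j \<in> {1..k} \<Longrightarrow> D i j = D' i j" "k \<ge> 1"
  shows "feas_pos n k D \<longleftrightarrow> feas_pos n k D'"
proof -
  have "comb n D x j = comb n D' x j" if "j \<in> {1..k}" for x j
    unfolding comb_def using assms(1) that by (intro sum.cong) auto
  then have "(\<forall>j\<in>{1..<k}. comb n D x j = 0) \<longleftrightarrow> (\<forall>j\<in>{1..<k}. comb n D' x j = 0)" "comb n D x k = comb n D' x k" for x
    using assms(2) by auto
  then show ?thesis unfolding feas_pos_def by simp
qed

text \<open>Negating coordinate \<open>k\<close> of every vector, number 0 included, negates row
  \<open>k\<close> of the reduced columns and fixes the other rows. Since \<open>k\<close> is at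
  least 1, the negated coordinates have an even density.\<close>

lemma feas_neg_probability:
  assumes k: "k \<in> {1..m}"
  shows "(\<integral>\<^sup>+g. indicator {D. feas_neg n k D} (cols g) \<partial>PiM ({0..n} \<times> {0..m}) coord) =
    (\<integral>\<^sup>+g. indicator {D. feas_pos n k D} (cols g) \<partial>PiM ({0..n} \<times> {0..m}) coord)"
proof -
  let ?A = "{0..n} \<times> {0..m}"
  define s where "s = (\<lambda>a::nat \<times> nat. if snd a = k then - 1 else (1::real))"
  let ?flip = "\<lambda>g. \<lambda>a\<in>?A. 0 + s a * g a"
  have meas: "(\<lambda>g. indicator {D. feas_pos n k D} (cols g) :: ennreal) \<in> borel_measurable (lebesgue_prod ?A)"
    "(\<lambda>g. indicator {D. feas_neg n k D} (cols g) :: ennreal) \<in> borel_measurable (lebesgue_prod ?A)"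
    using measurable_indicator_cols[OF borel_feas_pos] measurable_indicator_cols[OF borel_feas_neg]
    by (simp_all add: measurable_PiM_coord_iff)
  have [measurable]: "(\<lambda>h. h a) \<in> borel_measurable (lebesgue_prod ?A)" for a
    by (rule measurable_coordinate) simp
  have "(\<integral>\<^sup>+g. indicator {D. feas_pos n k D} (cols g) \<partial>PiM ?A coord) =
      (\<integral>\<^sup>+g. (\<Prod>a\<in>?A. ennreal (coord_density a (g a))) * indicator {D. feas_pos n k D} (cols g) \<partial>lebesgue_prod ?A)"
    by (rule nn_integral_PiM_coord) (use meas in auto)
  also have "\<dots> = (\<Prod>a\<in>?A. ennreal \<bar>s a\<bar>) *
      (\<integral>\<^sup>+g. (\<Prod>a\<in>?A. ennreal (coord_density a (?flip g a))) * indicator {D. feas_pos n k D} (cols (?flip g)) \<partial>lebesgue_prod ?A)"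
    by (rule nn_integral_lebesgue_prod_affine) (use meas in \<open>auto simp: s_def\<close>)
  also have "(\<Prod>a\<in>?A. ennreal \<bar>s a\<bar>) = 1" by (intro prod.neutral) (auto simp: s_def)
  also have "1 * (\<integral>\<^sup>+g. (\<Prod>a\<in>?A. ennreal (coord_density a (?flip g a))) * indicator {D. feas_pos n k D} (cols (?flip g)) \<partial>lebesgue_prod ?A) =
      (\<integral>\<^sup>+g. (\<Prod>a\<in>?A. ennreal (coord_density a (g a))) * indicator {D. feas_neg n k D} (cols g) \<partial>lebesgue_prod ?A)"
    unfolding mult_1_left
  proof (intro nn_integral_cong arg_cong2[of _ _ _ _ "(*)"] prod.cong refl)
    fix g :: "nat \<times> nat \<Rightarrow> real"
    show "ennreal (coord_density a (?flip g a)) = ennreal (coord_density a (g a))" if "a \<in> ?A" for a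
      using that k by (auto simp: s_def coord_density_def std_normal_density_even)
    have "feas_pos n k (cols (?flip g)) \<longleftrightarrow> feas_pos n k (\<lambda>i j. if j = k then - cols g i j else cols g i j)"
      using k by (intro feas_pos_cong) (auto simp: cols_def s_def)
    then show "indicator {D. feas_pos n k D} (cols (?flip g)) = (indicator {D. feas_neg n k D} (cols g) :: ennreal)"
      by (simp add: indicator_def feas_neg_iff_flip)
  qed
  also have "\<dots> = (\<integral>\<^sup>+g. indicator {D. feas_neg n k D} (cols g) \<partial>PiM ?A coord)"
    by (rule nn_integral_PiM_coord[symmetric]) (use meas in auto)
  finally show ?thesis ..
qed


section \<open>Almost sure genericity\<close>

lemma borel_dependent_column: "{D :: nat \<Rightarrow> nat \<Rightarrow> real. \<exists>x. x a = 1 \<and> (\<forall>j\<in>R. (\<Sum>i\<in>I. x i * D i j) = 0)} \<in> sets borel"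
  if "finite I" for I :: "nat set" and R :: "nat set" and a :: nat
proof (rule borel_parametric_Collect)
  let ?P = "\<lambda>(N::nat) x (D :: nat \<Rightarrow> nat \<Rightarrow> real). x a = 1 \<and> (\<forall>j\<in>R. (\<Sum>i\<in>I. x i * D i j) = (0::real))"
  show "closed {p. ?P N (fst p) (snd p)}" for N
    by (intro closed_Collect_conj closed_Collect_ball closed_Collect_eq continuous_on_sum continuous_intros)
  show "(\<exists>x. x a = 1 \<and> (\<forall>j\<in>R. (\<Sum>i\<in>I. x i * D i j) = 0)) \<longleftrightarrow>
    (\<exists>N x. (\<forall>i. \<bar>x i\<bar> \<le> real N) \<and> ?P N x D)" for D :: "nat \<Rightarrow> nat \<Rightarrow> real"
  proof
    assume "\<exists>x. x a = 1 \<and> (\<forall>j\<in>R. (\<Sum>i\<in>I. x i * D i j) = 0)"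
    then obtain x where x: "x a = 1" "\<forall>j\<in>R. (\<Sum>i\<in>I. x i * D i j) = 0" by blast
    from exists_parameter_bound[of "insert a I" 1 x] that obtain N where N: "\<forall>i\<in>insert a I. \<bar>x i\<bar> \<le> real N" by auto
    define y where "y = (\<lambda>i. if i \<in> insert a I then x i else 0)"
    have "\<forall>i. \<bar>y i\<bar> \<le> real N" unfolding y_def by (rule truncated_parameter) (use N in blast)
    moreover have "(\<Sum>i\<in>I. y i * D i j) = (\<Sum>i\<in>I. x i * D i j)" for j
      by (intro sum.cong) (auto simp: y_def)
    moreover have "y a = 1" using x by (simp add: y_def)
    ultimately show "\<exists>N x. (\<forall>i. \<bar>x i\<bar> \<le> real N) \<and> ?P N x D"
      using x(2) by (intro exI[of _ N] exI[of _ y]) simp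
  qed blast
qed

lemma borel_dependent_row: "{D :: nat \<Rightarrow> nat \<Rightarrow> real. \<exists>c. c b = 1 \<and> (\<forall>i\<in>I. (\<Sum>j\<in>R. c j * D i j) = 0)} \<in> sets borel"
  if "finite R" for I :: "nat set" and R :: "nat set" and b :: nat
proof (rule borel_parametric_Collect)
  let ?P = "\<lambda>(N::nat) c (D :: nat \<Rightarrow> nat \<Rightarrow> real). c b = 1 \<and> (\<forall>i\<in>I. (\<Sum>j\<in>R. c j * D i j) = (0::real))"
  show "closed {p. ?P N (fst p) (snd p)}" for N
    by (intro closed_Collect_conj closed_Collect_ball closed_Collect_eq continuous_on_sum continuous_intros)
  show "(\<exists>c. c b = 1 \<and> (\<forall>i\<in>I. (\<Sum>j\<in>R. c j * D i j) = 0)) \<longleftrightarrow>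
    (\<exists>N c. (\<forall>i. \<bar>c i\<bar> \<le> real N) \<and> ?P N c D)" for D :: "nat \<Rightarrow> nat \<Rightarrow> real"
  proof
    assume "\<exists>c. c b = 1 \<and> (\<forall>i\<in>I. (\<Sum>j\<in>R. c j * D i j) = 0)"
    then obtain c where c: "c b = 1" "\<forall>i\<in>I. (\<Sum>j\<in>R. c j * D i j) = 0" by blast
    from exists_parameter_bound[of "insert b R" 1 c] that obtain N where N: "\<forall>i\<in>insert b R. \<bar>c i\<bar> \<le> real N" by auto
    define y where "y = (\<lambda>i. if i \<in> insert b R then c i else 0)"
    have "\<forall>i. \<bar>y i\<bar> \<le> real N" unfolding y_def by (rule truncated_parameter) (use N in blast)
    moreover have "(\<Sum>j\<in>R. y j * D i j) = (\<Sum>j\<in>R. c j * D i j)" for i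
      by (intro sum.cong) (auto simp: y_def)
    moreover have "y b = 1" using c by (simp add: y_def)
    ultimately show "\<exists>N c. (\<forall>i. \<bar>c i\<bar> \<le> real N) \<and> ?P N c D"
      using c(2) by (intro exI[of _ N] exI[of _ y]) simp
  qed blast
qed

lemma emeasure_coord_singleton: "emeasure (coord a) {y} = 0"
proof -
  have "emeasure (coord a) {y} = (\<integral>\<^sup>+x. ennreal (coord_density a x) * indicator {y} x \<partial>lborel)"
    unfolding coord_def by (rule emeasure_density) auto
  also have "\<dots> = (\<integral>\<^sup>+x. 0 \<partial>(lborel :: real measure))"
    using AE_lborel_singleton[of y] by (intro nn_integral_cong_AE) (auto elim!: eventually_mono)
  finally show ?thesis by simp
qed

text \<open>Degeneracy fixes the entry at \<open>(a, b)\<close> once all other coordinates are given: a functional \<open>c\<close>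
  vanishing on the other columns, with \<open>c b \<noteq> 0\<close>, must also vanish on column \<open>a\<close>.\<close>

lemma AE_indep_cols:
  assumes I: "I \<subseteq> {1..n}" and m: "n \<le> m"
  shows "AE g in PiM ({0..n} \<times> {0..m}) coord. indep_cols (cols g) I"
proof -
  let ?A = "{0..n} \<times> {0..m}" and ?R = "{1..card I}"
  have fin: "finite I" using I by (rule finite_subset) auto
  have card: "card I \<le> n" using card_mono[OF _ I] by simp
  \<comment> \<open>The coefficients at \<open>a\<close> and \<open>b\<close> are normalised to 1,
    so that being nonzero becomes a closed condition on the parameter.\<close>
  define Bad where "Bad = (\<lambda>a b. {D. \<exists>x. x a = (1::real) \<and> (\<forall>j\<in>?R. (\<Sum>i\<in>I. x i * D i j) = 0)} \<inter>
    {D. \<exists>c. c b = (1::real) \<and> (\<forall>i\<in>I - {a}. (\<Sum>j\<in>?R. c j * D i j) = 0)})"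
  have borel: "Bad a b \<in> sets borel" for a b
    unfolding Bad_def using borel_dependent_column[OF fin] borel_dependent_row[of ?R] by auto
  have null: "(\<integral>\<^sup>+g. indicator (Bad a b) (cols g) \<partial>PiM ?A coord) = 0" if ab: "a \<in> I" "b \<in> ?R" for a b
  proof -
    define A' where "A' = ?A - {(a, b)}"
    have A: "?A = insert (a, b) A'" "finite A'" "(a, b) \<notin> A'"
      using ab I card m by (auto simp: A'_def)
    have single: "\<exists>y0. \<forall>y. cols (g((a, b) := y)) \<in> Bad a b \<longrightarrow> y = y0" for g
    proof -
      let ?D = "\<lambda>y. cols (g((a, b) := y))"
      have a0: "a \<noteq> 0" "b \<noteq> 0" using ab I by auto
      have other: "?D y i j = ?D y' i j" if "i \<noteq> a \<or> j \<noteq> b" for y y' i j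
        using that a0 by (auto simp: cols_def)
      have at: "?D y a b = y - g (a, 0) / g (0, 0) * g (0, b)" for y
        using a0 by (simp add: cols_def)
      have "y = y'" if y: "?D y \<in> Bad a b" and y': "?D y' \<in> Bad a b" for y y'
      proof -
        obtain c where c: "c b = 1" "\<forall>i\<in>I - {a}. (\<Sum>j\<in>?R. c j * ?D y i j) = 0"
          using y unfolding Bad_def by blast
        have orth: "(\<Sum>j\<in>?R. c j * ?D z a j) = 0" if z: "?D z \<in> Bad a b" for z
        proof -
          obtain x where x: "x a = 1" "\<forall>j\<in>?R. (\<Sum>i\<in>I. x i * ?D z i j) = 0"
            using z unfolding Bad_def by blast
          have "0 = (\<Sum>j\<in>?R. c j * (\<Sum>i\<in>I. x i * ?D z i j))" using x by simp
          also have "\<dots> = (\<Sum>i\<in>I. x i * (\<Sum>j\<in>?R. c j * ?D z i j))"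
            by (simp only: sum_distrib_left, subst sum.swap) (simp add: mult_ac)
          also have "\<dots> = x a * (\<Sum>j\<in>?R. c j * ?D z a j) + (\<Sum>i\<in>I - {a}. x i * (\<Sum>j\<in>?R. c j * ?D z i j))"
            using ab fin by (intro sum.remove) auto
          also have "(\<Sum>i\<in>I - {a}. x i * (\<Sum>j\<in>?R. c j * ?D z i j)) = 0"
          proof (rule sum.neutral, rule ballI)
            fix i assume i: "i \<in> I - {a}"
            have "(\<Sum>j\<in>?R. c j * ?D z i j) = (\<Sum>j\<in>?R. c j * ?D y i j)"
              using i other[of i _ z y] by (intro sum.cong) auto
            then show "x i * (\<Sum>j\<in>?R. c j * ?D z i j) = 0" using c(2) i by simp
          qed
          finally show ?thesis unfolding x(1) by linarith
        qed
        have split: "(\<Sum>j\<in>?R. c j * ?D z a j) = ?D z a b + (\<Sum>j\<in>?R - {b}. c j * ?D z a j)" for z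
          using ab c(1) by (subst sum.remove[of _ b]) auto
        have "(\<Sum>j\<in>?R - {b}. c j * ?D y a j) = (\<Sum>j\<in>?R - {b}. c j * ?D y' a j)"
          using other[of a _ y y'] by (intro sum.cong) auto
        then have "?D y a b = ?D y' a b" using orth[OF y] orth[OF y'] unfolding split by linarith
        then show ?thesis by (simp add: at)
      qed
      then show ?thesis by metis
    qed
    have "(\<integral>\<^sup>+g. indicator (Bad a b) (cols g) \<partial>PiM ?A coord) =
        (\<integral>\<^sup>+g. (\<integral>\<^sup>+y. indicator (Bad a b) (cols (g((a, b) := y))) \<partial>coord (a, b)) \<partial>PiM A' coord)"
      unfolding A(1) by (rule coords.product_nn_integral_insert[OF A(2,3) measurable_indicator_cols[OF borel]])
    also have "\<dots> = (\<integral>\<^sup>+g. 0 \<partial>PiM A' coord)"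
    proof (rule nn_integral_cong)
      fix g :: "nat \<times> nat \<Rightarrow> real"
      obtain y0 where y0: "\<And>y. cols (g((a, b) := y)) \<in> Bad a b \<Longrightarrow> y = y0" using single[of g] by blast
      have "(\<integral>\<^sup>+y. indicator (Bad a b) (cols (g((a, b) := y))) \<partial>coord (a, b)) \<le> (\<integral>\<^sup>+y. indicator {y0} y \<partial>coord (a, b))"
        using y0 by (intro nn_integral_mono) (auto simp: indicator_def)
      also have "\<dots> = 0" by (subst nn_integral_indicator) (auto simp: emeasure_coord_singleton)
      finally show "(\<integral>\<^sup>+y. indicator (Bad a b) (cols (g((a, b) := y))) \<partial>coord (a, b)) = 0" by simp
    qed
    finally show ?thesis by simp
  qed
  have "AE g in PiM ?A coord. cols g \<notin> Bad a b" if "a \<in> I" "b \<in> ?R" for a b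
  proof -
    have "AE g in PiM ?A coord. (indicator (Bad a b) (cols g) :: ennreal) = 0"
      using null[OF that] measurable_indicator_cols[OF borel] by (subst (asm) nn_integral_0_iff_AE) auto
    then show ?thesis by (rule eventually_mono) (simp add: indicator_def split: if_splits)
  qed
  then have "AE g in PiM ?A coord. \<forall>a\<in>I. \<forall>b\<in>?R. cols g \<notin> Bad a b"
    using fin by (intro AE_finite_allI) auto
  then show ?thesis
  proof (rule eventually_mono)
    fix g assume good: "\<forall>a\<in>I. \<forall>b\<in>?R. cols g \<notin> Bad a b"
    show "indep_cols (cols g) I"
    proof (rule ccontr)
      assume "\<not> ?thesis"
      then obtain x a where x: "\<forall>j\<in>?R. (\<Sum>i\<in>I. x i * cols g i j) = 0" "a \<in> I" "x a \<noteq> 0"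
        unfolding indep_cols_def by blast
      \<comment> \<open>Without \<open>a\<close> there are fewer columns than rows, so a nonzero
        functional vanishes on them. Hence every dependent array lies in some
        \<open>Bad a b\<close>.\<close>
      have "card (I - {a}) < card ?R" using card_Diff1_less[OF fin x(2)] by (simp only: card_atLeastAtMost diff_Suc_1)
      from homogeneous_system_nontrivial[OF _ _ this, of "\<lambda>j i. cols g i j"] fin
      obtain c where c: "\<exists>j\<in>?R. c j \<noteq> 0" "\<forall>i\<in>I - {a}. (\<Sum>j\<in>?R. c j * cols g i j) = 0" by auto
      then obtain b where b: "b \<in> ?R" "c b \<noteq> 0" by blast
      have "\<exists>x. x a = (1::real) \<and> (\<forall>j\<in>?R. (\<Sum>i\<in>I. x i * cols g i j) = 0)"
        using x by (intro exI[of _ "\<lambda>i. x i / x a"]) (simp add: sum_divide_distrib[symmetric])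
      moreover have "\<exists>c. c b = (1::real) \<and> (\<forall>i\<in>I - {a}. (\<Sum>j\<in>?R. c j * cols g i j) = 0)"
        using b c(2) by (intro exI[of _ "\<lambda>j. c j / c b"]) (simp add: sum_divide_distrib[symmetric])
      ultimately have "cols g \<in> Bad a b" unfolding Bad_def by blast
      then show False using good x(2) b(1) by blast
    qed
  qed
qed

lemma AE_generic:
  assumes "n \<le> m"
  shows "AE g in PiM ({0..n} \<times> {0..m}) coord. generic n (cols g)"
proof -
  have "AE g in PiM ({0..n} \<times> {0..m}) coord. \<forall>I\<in>Pow {1..n}. indep_cols (cols g) I"
    by (rule AE_finite_allI) (use AE_indep_cols assms in auto)
  then show ?thesis by (rule eventually_mono) (auto simp: generic_def)
qed

section \<open>Recursion in the dimension\<close>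

text \<open>Rows up to \<open>Suc n\<close> accommodate every dimension in play: a basis has at most
  \<open>n\<close> columns, and its dual functional reaches one row further.\<close>

definition event_prob :: "nat \<Rightarrow> ((nat \<Rightarrow> nat \<Rightarrow> real) \<Rightarrow> bool) \<Rightarrow> real" where
  "event_prob n Q = measure (PiM ({0..n} \<times> {0..Suc n}) coord) {g \<in> space (PiM ({0..n} \<times> {0..Suc n}) coord). Q (cols g)}"

lemma event_prob_eq_nn_integral:
  assumes "{D. Q D} \<in> sets borel"
  shows "event_prob n Q = enn2real (\<integral>\<^sup>+g. indicator {D. Q D} (cols g) \<partial>PiM ({0..n} \<times> {0..Suc n}) coord)"
  unfolding event_prob_def measure_def emeasure_cols_Collect[OF assms] ..

lemma event_prob_cong_generic:
  assumes "{D. Q D} \<in> sets borel" "{D. Q' D} \<in> sets borel" "\<And>D. generic n D \<Longrightarrow> Q D \<longleftrightarrow> Q' D"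
  shows "event_prob n Q = event_prob n Q'"
proof -
  have "AE g in PiM ({0..n} \<times> {0..Suc n}) coord. generic n (cols g)" by (rule AE_generic) simp
  then have "AE g in PiM ({0..n} \<times> {0..Suc n}) coord. g \<in> {g \<in> space (PiM ({0..n} \<times> {0..Suc n}) coord). Q (cols g)} \<longleftrightarrow>
      g \<in> {g \<in> space (PiM ({0..n} \<times> {0..Suc n}) coord). Q' (cols g)}"
    by (rule eventually_mono) (use assms(3) in auto)
  then show ?thesis unfolding event_prob_def
    by (rule measure_eq_AE) (use sets_cols_Collect assms in auto)
qed

lemma event_prob_or:
  assumes "{D. Q D} \<in> sets borel" "{D. Q' D} \<in> sets borel"
  shows "event_prob n (\<lambda>D. Q D \<or> Q' D) + event_prob n (\<lambda>D. Q D \<and> Q' D) = event_prob n Q + event_prob n Q'"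
proof -
  interpret prob_space "PiM ({0..n} \<times> {0..Suc n}) coord" by (rule prob_space_PiM_coord)
  let ?S = "\<lambda>Q. {g \<in> space (PiM ({0..n} \<times> {0..Suc n}) coord). Q (cols g)}"
  have "?S (\<lambda>D. Q D \<or> Q' D) = ?S Q \<union> ?S Q'" "?S (\<lambda>D. Q D \<and> Q' D) = ?S Q \<inter> ?S Q'" by auto
  moreover have "prob (?S Q \<union> ?S Q') = prob (?S Q) + prob (?S Q' - ?S Q)"
    by (intro finite_measure_Union' sets_cols_Collect assms)
  moreover have "prob (?S Q' - ?S Q) = prob (?S Q') - prob (?S Q' \<inter> ?S Q)"
    by (intro finite_measure_Diff' sets_cols_Collect assms)
  ultimately show ?thesis unfolding event_prob_def by (simp add: Int_commute)
qed

lemma event_prob_not: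
  assumes "{D. Q D} \<in> sets borel"
  shows "event_prob n (\<lambda>D. \<not> Q D) = 1 - event_prob n Q"
proof -
  interpret prob_space "PiM ({0..n} \<times> {0..Suc n}) coord" by (rule prob_space_PiM_coord)
  show ?thesis unfolding event_prob_def using prob_neg[OF sets_cols_Collect[OF assms, of "{0..n} \<times> {0..Suc n}"]] by simp
qed

lemma event_prob_finite_disjoint:
  assumes "finite J" "\<And>I. I \<in> J \<Longrightarrow> {D. Q I D} \<in> sets borel"
    and "\<And>D I I'. I \<in> J \<Longrightarrow> I' \<in> J \<Longrightarrow> generic n D \<Longrightarrow> Q I D \<Longrightarrow> Q I' D \<Longrightarrow> I = I'"
  shows "event_prob n (\<lambda>D. \<exists>I\<in>J. Q I D) = (\<Sum>I\<in>J. event_prob n (Q I))"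
  using assms
proof (induction J rule: finite_induct)
  case empty
  then show ?case by (simp add: event_prob_def)
next
  case (insert I J)
  have borel: "{D. Q I D} \<in> sets borel" "{D. \<exists>I\<in>J. Q I D} \<in> sets borel"
  proof -
    have "{D. \<exists>I\<in>J. Q I D} = (\<Union>I\<in>J. {D. Q I D})" by auto
    then show "{D. \<exists>I\<in>J. Q I D} \<in> sets borel" using insert by auto
  qed (use insert in auto)
  have "event_prob n (\<lambda>D. Q I D \<and> (\<exists>I\<in>J. Q I D)) = event_prob n (\<lambda>D. False)"
  proof (rule event_prob_cong_generic)
    have "{D. Q I D \<and> (\<exists>I\<in>J. Q I D)} = {D. Q I D} \<inter> {D. \<exists>I\<in>J. Q I D}" by auto
    then show "{D. Q I D \<and> (\<exists>I\<in>J. Q I D)} \<in> sets borel" using borel by auto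
    show "(Q I D \<and> (\<exists>I\<in>J. Q I D)) = False" if "generic n D" for D
      using insert.prems(2) insert.hyps(2) that by blast
  qed auto
  then have "event_prob n (\<lambda>D. Q I D \<and> (\<exists>I\<in>J. Q I D)) = 0" by (simp add: event_prob_def)
  moreover have "event_prob n (\<lambda>D. \<exists>I\<in>J. Q I D) = (\<Sum>I\<in>J. event_prob n (Q I))"
    using insert.prems by (intro insert.IH) blast+
  moreover have "event_prob n (\<lambda>D. \<exists>I\<in>insert I J. Q I D) = event_prob n (\<lambda>D. Q I D \<or> (\<exists>I\<in>J. Q I D))"
    by simp
  ultimately show ?case using event_prob_or[OF borel, of n] insert.hyps by simp
qed

lemma event_prob_optimal:
  assumes "I \<subseteq> {1..n}"
  shows "event_prob n (\<lambda>D. optimal n D I) =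
    enn2real (basis_const (card I)) * enn2real (angle_integral (card I) (n - card I))"
proof -
  have "finite I" using assms by (rule finite_subset) auto
  then show ?thesis
    using event_prob_eq_nn_integral[OF borel_optimal] optimal_probability_subset[OF assms]
    by (simp add: enn2real_mult)
qed

text \<open>For a generic array \<open>feas_pos n k\<close> splits into
  \<open>feas_pos n (Suc k)\<close> and the events that a given set of \<open>k\<close> columns is
  the optimal basis. The latter are disjoint by \<open>optimal_unique\<close> and equally
  likely.\<close>

lemma event_prob_feas_pos_step:
  assumes k: "k \<ge> 1"
  shows "event_prob n (feas_pos n k) - event_prob n (feas_pos n (Suc k)) =
    (n choose k) * (enn2real (basis_const k) * enn2real (angle_integral k (n - k)))"
proof -
  define J where "J = {I. I \<subseteq> {1..n} \<and> card I = k}"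
  have J: "finite J" "card J = n choose k" using n_subsets[of "{1..n}" k] by (auto simp: J_def)
  have fin: "finite I" if "I \<in> J" for I using that by (auto simp: J_def intro: finite_subset)
  have bT: "{D. \<exists>I\<in>J. optimal n D I} \<in> sets borel"
  proof -
    have "{D. \<exists>I\<in>J. optimal n D I} = (\<Union>I\<in>J. {D. optimal n D I})" by auto
    then show ?thesis using J(1) borel_optimal fin by auto
  qed
  have sum: "event_prob n (\<lambda>D. \<exists>I\<in>J. optimal n D I) = (\<Sum>I\<in>J. event_prob n (\<lambda>D. optimal n D I))"
  proof (rule event_prob_finite_disjoint[OF J(1) borel_optimal[OF fin]])
    show "I = I'" if "I \<in> J" "I' \<in> J" "generic n D" "optimal n D I" "optimal n D I'" for D I I'
      using optimal_unique[OF that(3) _ _ _ that(4,5)] that(1,2) by (simp add: J_def)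
  qed
  have ne: "I \<noteq> {}" if "I \<in> J" for I using that k by (auto simp: J_def)
  have "event_prob n (feas_pos n k) = event_prob n (\<lambda>D. (\<exists>I\<in>J. optimal n D I) \<or> feas_pos n (Suc k) D)"
  proof (rule event_prob_cong_generic)
    have "{D. (\<exists>I\<in>J. optimal n D I) \<or> feas_pos n (Suc k) D} = {D. \<exists>I\<in>J. optimal n D I} \<union> {D. feas_pos n (Suc k) D}" by auto
    then show "{D. (\<exists>I\<in>J. optimal n D I) \<or> feas_pos n (Suc k) D} \<in> sets borel" using bT borel_feas_pos by auto
    fix D assume gen: "generic n D"
    obtain k' where k': "k = Suc k'" using k by (cases k) auto
    show "feas_pos n k D \<longleftrightarrow> (\<exists>I\<in>J. optimal n D I) \<or> feas_pos n (Suc k) D"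
    proof
      assume pos: "feas_pos n k D"
      show "(\<exists>I\<in>J. optimal n D I) \<or> feas_pos n (Suc k) D"
        using exists_optimal[OF gen k pos] unfolding J_def by blast
    next
      assume "(\<exists>I\<in>J. optimal n D I) \<or> feas_pos n (Suc k) D"
      then show "feas_pos n k D"
      proof
        assume "\<exists>I\<in>J. optimal n D I"
        then obtain I where I: "I \<in> J" "optimal n D I" by blast
        then show ?thesis using optimal_imp_feas_pos(1)[OF gen _ I(2) ne[OF I(1)]] by (simp add: J_def)
      qed (use feas_pos_antimono[OF gen, of k'] k' in simp)
    qed
  qed (rule borel_feas_pos)
  moreover have "event_prob n (\<lambda>D. (\<exists>I\<in>J. optimal n D I) \<and> feas_pos n (Suc k) D) = event_prob n (\<lambda>D. False)"
  proof (rule event_prob_cong_generic)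
    have "{D. (\<exists>I\<in>J. optimal n D I) \<and> feas_pos n (Suc k) D} = {D. \<exists>I\<in>J. optimal n D I} \<inter> {D. feas_pos n (Suc k) D}" by auto
    then show "{D. (\<exists>I\<in>J. optimal n D I) \<and> feas_pos n (Suc k) D} \<in> sets borel" using bT borel_feas_pos by auto
    show "((\<exists>I\<in>J. optimal n D I) \<and> feas_pos n (Suc k) D) = False" if "generic n D" for D
    proof -
      have "\<not> feas_pos n (Suc k) D" if I: "I \<in> J" "optimal n D I" for I
        using optimal_imp_feas_pos(2)[OF \<open>generic n D\<close> _ I(2) ne[OF I(1)]] I(1) by (simp add: J_def)
      then show ?thesis by blast
    qed
  qed auto
  then have "event_prob n (\<lambda>D. (\<exists>I\<in>J. optimal n D I) \<and> feas_pos n (Suc k) D) = 0" by (simp add: event_prob_def)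
  moreover have "(\<Sum>I\<in>J. event_prob n (\<lambda>D. optimal n D I)) =
      (n choose k) * (enn2real (basis_const k) * enn2real (angle_integral k (n - k)))"
  proof -
    have "(\<Sum>I\<in>J. event_prob n (\<lambda>D. optimal n D I)) =
        (\<Sum>I\<in>J. enn2real (basis_const k) * enn2real (angle_integral k (n - k)))"
      using event_prob_optimal by (intro sum.cong) (auto simp: J_def)
    then show ?thesis by (simp add: J(2))
  qed
  ultimately show ?thesis using event_prob_or[OF bT borel_feas_pos[of n "Suc k"], of n] sum by simp
qed

text \<open>The analogue for \<open>k = 0\<close>, with the empty set as the only candidate.\<close>

lemma event_prob_feas_pos_1:
  "1 - event_prob n (feas_pos n 1) = enn2real (basis_const 0) * enn2real (angle_integral 0 n)"
proof -
  have "1 - event_prob n (feas_pos n 1) = event_prob n (\<lambda>D. \<not> feas_pos n 1 D)"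
    using event_prob_not[OF borel_feas_pos] by simp
  also have "\<dots> = event_prob n (\<lambda>D. optimal n D {})"
  proof (rule event_prob_cong_generic)
    have "{D. \<not> feas_pos n 1 D} = - {D. feas_pos n 1 D}" by auto
    then show "{D. \<not> feas_pos n 1 D} \<in> sets borel" using borel_feas_pos[of n 1] by (simp only: borel_comp)
  qed (use borel_optimal optimal_empty_iff in auto)
  also have "\<dots> = enn2real (basis_const 0) * enn2real (angle_integral 0 n)"
    using event_prob_optimal[of "{}" n] by simp
  finally show ?thesis .
qed

text \<open>The events in dimensions \<open>d\<close> and \<open>Suc d\<close> are the union and the
  intersection of the two signs of row \<open>Suc d\<close>, and both signs are equally
  likely.\<close>

lemma event_prob_feas_zero_add:
  assumes "d < Suc n"
  shows "event_prob n (feas_zero n d) + event_prob n (feas_zero n (Suc d)) = 2 * event_prob n (feas_pos n (Suc d))"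
proof -
  have "event_prob n (feas_zero n d) = event_prob n (\<lambda>D. feas_pos n (Suc d) D \<or> feas_neg n (Suc d) D)"
  proof (rule event_prob_cong_generic)
    have "{D. feas_pos n (Suc d) D \<or> feas_neg n (Suc d) D} = {D. feas_pos n (Suc d) D} \<union> {D. feas_neg n (Suc d) D}" by auto
    then show "{D. feas_pos n (Suc d) D \<or> feas_neg n (Suc d) D} \<in> sets borel" using borel_feas_pos borel_feas_neg by auto
  qed (use borel_feas_zero feas_zero_iff_or in auto)
  moreover have "event_prob n (feas_zero n (Suc d)) = event_prob n (\<lambda>D. feas_pos n (Suc d) D \<and> feas_neg n (Suc d) D)"
  proof (rule event_prob_cong_generic)
    have "{D. feas_pos n (Suc d) D \<and> feas_neg n (Suc d) D} = {D. feas_pos n (Suc d) D} \<inter> {D. feas_neg n (Suc d) D}" by auto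
    then show "{D. feas_pos n (Suc d) D \<and> feas_neg n (Suc d) D} \<in> sets borel" using borel_feas_pos borel_feas_neg by auto
  qed (use borel_feas_zero feas_zero_Suc_iff_and in auto)
  moreover have "event_prob n (feas_neg n (Suc d)) = event_prob n (feas_pos n (Suc d))"
    unfolding event_prob_eq_nn_integral[OF borel_feas_neg] event_prob_eq_nn_integral[OF borel_feas_pos]
    using assms by (subst feas_neg_probability) auto
  ultimately show ?thesis using event_prob_or[OF borel_feas_pos[of n "Suc d"] borel_feas_neg[of n "Suc d"], of n] by simp
qed

lemma event_prob_feas_zero_eq_0:
  assumes "n \<le> d" shows "event_prob n (feas_zero n d) = 0"
proof -
  have "event_prob n (feas_zero n d) = event_prob n (\<lambda>D. False)"
    by (rule event_prob_cong_generic) (use borel_feas_zero not_feas_zero assms in auto)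
  then show ?thesis by (simp add: event_prob_def)
qed

lemma event_prob_feas_zero_0:
  assumes "n \<ge> 1" shows "event_prob n (feas_zero n 0) = 1"
proof -
  interpret prob_space "PiM ({0..n} \<times> {0..Suc n}) coord" by (rule prob_space_PiM_coord)
  have "feas_zero n 0 D" for D
    unfolding feas_zero_def using assms by (intro exI[of _ "\<lambda>_. 1"]) auto
  then show ?thesis by (simp add: event_prob_def prob_space)
qed

section \<open>The angle integral as a moment of the sine\<close>

lemma exists_antiderivative:
  assumes "continuous_on UNIV f"
  shows "\<exists>F. \<forall>x\<in>{a<..<b}. (F has_real_derivative f x) (at (x::real))"
proof -
  obtain F where F: "\<And>x. x \<in> {a..b} \<Longrightarrow> (F has_vector_derivative (f x)) (at x within {a..b})"
    using antiderivative_continuous[OF continuous_on_subset[OF assms subset_UNIV]] by blast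
  have "(F has_real_derivative f x) (at x)" if x: "x \<in> {a<..<b}" for x
  proof -
    have "at x within {a..b} = at x" by (rule at_within_interior) (use x in simp)
    then show ?thesis using F[of x] x by (simp add: has_real_derivative_iff_has_vector_derivative)
  qed
  then show ?thesis by blast
qed

lemma angle_integral_eq:
  "angle_integral k p = ennreal (integral {0..pi} (\<lambda>x. sin x ^ k * x ^ p) / pi ^ p)"
proof -
  define f where "f = (\<lambda>x::real. (x / pi) ^ p * sin x ^ k)"
  have cont: "continuous_on UNIV f" unfolding f_def by (intro continuous_intros) auto
  \<comment> \<open>The interval extends beyond 0 and pi, so that \<open>F\<close> is continuous at
    the two limits of \<open>pi / 2 + arctan t\<close>.\<close>
  obtain F where F: "\<And>x. x \<in> {-1<..<4} \<Longrightarrow> (F has_real_derivative f x) (at x)"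
    using exists_antiderivative[OF cont] by blast
  have pi4: "pi < 4" using pi_less_4 by simp
  define u where "u = (\<lambda>t. angle_prob t ^ p * (1 / sqrt (1 + t\<^sup>2)) ^ (k + 2))"
  have u_nonneg: "u t \<ge> 0" for t using angle_prob_nonneg[of t] by (simp add: u_def)
  have [measurable]: "u \<in> borel_measurable borel" unfolding u_def by measurable
  have u_eq: "u t = f (pi / 2 + arctan t) * inverse (1 + t\<^sup>2)" for t
  proof -
    have pos: "1 + t\<^sup>2 > 0" by (simp add: add_pos_nonneg)
    have "(1 / sqrt (1 + t\<^sup>2))\<^sup>2 = inverse (1 + t\<^sup>2)" using pos by (simp add: power_divide inverse_eq_divide)
    moreover have "sin (pi / 2 + arctan t) = 1 / sqrt (1 + t\<^sup>2)" by (simp add: sin_add cos_arctan)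
    moreover have "(pi / 2 + arctan t) / pi = angle_prob t" by (simp add: angle_prob_def add_divide_distrib)
    ultimately show ?thesis unfolding u_def f_def power_add by simp
  qed
  have range: "pi / 2 + arctan t \<in> {-1<..<4}" for t
    using arctan_lbound[of t] arctan_ubound[of t] pi4 by auto
  have DG: "((\<lambda>t. F (pi / 2 + arctan t)) has_real_derivative u t) (at t)" for t
  proof -
    have "((\<lambda>t. pi / 2 + arctan t) has_real_derivative inverse (1 + t\<^sup>2)) (at t)"
      by (auto intro!: derivative_eq_intros)
    from DERIV_chain2[OF F[OF range] this] show ?thesis by (simp add: u_eq)
  qed
  have isF: "isCont F x" if "x \<in> {-1<..<4}" for x using F[OF that] by (rule DERIV_isCont)
  have "-1 < pi" using pi_gt_zero by linarith
  then have "pi / 2 + pi / 2 \<in> {-1<..<4}" using pi4 by simp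
  then have lim_top: "((\<lambda>t. F (pi / 2 + arctan t)) \<longlongrightarrow> F (pi / 2 + pi / 2)) at_top"
    by (intro isCont_tendsto_compose[OF isF] tendsto_add tendsto_const tendsto_arctan_at_top)
  have "pi / 2 + - (pi / 2) \<in> {-1<..<4}" by simp
  then have lim_bot: "((\<lambda>t. F (pi / 2 + arctan t)) \<longlongrightarrow> F (pi / 2 + - (pi / 2))) at_bot"
    by (intro isCont_tendsto_compose[OF isF] tendsto_add tendsto_const tendsto_arctan_at_bot)
  have top: "(\<integral>\<^sup>+t. ennreal (u t) * indicator {0..} t \<partial>lborel) = ennreal (F pi - F (pi / 2))"
    using nn_integral_FTC_atLeast[of u 0 "\<lambda>t. F (pi / 2 + arctan t)" "F (pi / 2 + pi / 2)"] DG u_nonneg lim_top by simp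
  \<comment> \<open>The fundamental theorem is applied on \<open>{0..}\<close>, so the negative
    half-line is reflected.\<close>
  have bot: "(\<integral>\<^sup>+t. ennreal (u (- t)) * indicator {0..} t \<partial>lborel) = ennreal (F (pi / 2) - F 0)"
  proof -
    have "((\<lambda>t. - F (pi / 2 + arctan (- t))) has_real_derivative u (- t)) (at t)" for t
    proof -
      have "(uminus has_real_derivative - 1) (at t)" using DERIV_minus[OF DERIV_ident] .
      from DERIV_minus[OF DERIV_chain'[where g = "\<lambda>t. F (pi / 2 + arctan t)", OF this DG[of "- t"]]]
      show ?thesis by simp
    qed
    moreover have "((\<lambda>t. - F (pi / 2 + arctan (- t))) \<longlongrightarrow> - F (pi / 2 + - (pi / 2))) at_top"
      by (rule tendsto_minus[OF filterlim_compose[OF lim_bot filterlim_uminus_at_bot_at_top]])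
    ultimately show ?thesis
      using nn_integral_FTC_atLeast[of "\<lambda>t. u (- t)" 0 "\<lambda>t. - F (pi / 2 + arctan (- t))" "- F (pi / 2 + - (pi / 2))"] u_nonneg
      by simp
  qed
  have "angle_integral k p = (\<integral>\<^sup>+t. ennreal (u t) * indicator {0..} t + ennreal (u t) * indicator {..<0} t \<partial>lborel)"
  proof -
    have "angle_integral k p = (\<integral>\<^sup>+t. ennreal (u t) \<partial>lborel)"
      by (simp only: angle_integral_def u_def)
    also have "\<dots> = (\<integral>\<^sup>+t. ennreal (u t) * indicator {0..} t + ennreal (u t) * indicator {..<0} t \<partial>lborel)"
      by (intro nn_integral_cong) (auto simp: indicator_def)
    finally show ?thesis .
  qed
  also have "\<dots> = (\<integral>\<^sup>+t. ennreal (u t) * indicator {0..} t \<partial>lborel) + (\<integral>\<^sup>+t. ennreal (u t) * indicator {..<0} t \<partial>lborel)"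
    by (rule nn_integral_add) measurable
  also have "(\<integral>\<^sup>+t. ennreal (u t) * indicator {..<0} t \<partial>lborel) = (\<integral>\<^sup>+t. ennreal (u (- t)) * indicator {0<..} t \<partial>lborel)"
    by (subst nn_integral_real_affine[where c = "-1" and t = 0]) (auto intro!: nn_integral_cong simp: indicator_def)
  also have "\<dots> = (\<integral>\<^sup>+t. ennreal (u (- t)) * indicator {0..} t \<partial>lborel)"
    using AE_lborel_singleton[of "0::real"] by (intro nn_integral_cong_AE) (auto elim!: eventually_mono simp: indicator_def)
  also have "(\<integral>\<^sup>+t. ennreal (u t) * indicator {0..} t \<partial>lborel) + (\<integral>\<^sup>+t. ennreal (u (- t)) * indicator {0..} t \<partial>lborel) =
      ennreal (F pi - F (pi / 2)) + ennreal (F (pi / 2) - F 0)" unfolding top bot ..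
  also have "ennreal (F pi - F (pi / 2)) + ennreal (F (pi / 2) - F 0) = ennreal (F pi - F 0)"
  proof -
    have mono: "F x \<le> F y" if "0 \<le> x" "x \<le> y" "y \<le> pi" for x y
    proof (rule DERIV_nonneg_imp_nondecreasing[OF that(2)])
      fix z assume z: "x \<le> z" "z \<le> y"
      then have "z \<in> {-1<..<4}" "f z \<ge> 0" using that pi4 by (auto simp: f_def sin_ge_zero)
      then show "\<exists>y. (F has_real_derivative y) (at z) \<and> 0 \<le> y" using F by blast
    qed
    have "F (pi / 2) \<le> F pi" "F 0 \<le> F (pi / 2)" by (rule mono; simp)+
    then show ?thesis by (subst ennreal_plus[symmetric]) auto
  qed
  finally have "angle_integral k p = ennreal (F pi - F 0)" .
  moreover have "(f has_integral (F pi - F 0)) {0..pi}"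
  proof (rule fundamental_theorem_of_calculus)
    fix x assume "x \<in> {0..pi}"
    then have "(F has_real_derivative f x) (at x within {0..pi})"
      using pi4 by (intro has_field_derivative_at_within[OF F]) auto
    then show "(F has_vector_derivative f x) (at x within {0..pi})"
      by (simp add: has_real_derivative_iff_has_vector_derivative)
  qed simp
  then have "integral {0..pi} f = F pi - F 0" by (rule integral_unique)
  moreover have "integral {0..pi} f = integral {0..pi} (\<lambda>x. sin x ^ k * x ^ p) / pi ^ p"
    unfolding f_def by (subst integral_divide[symmetric]) (intro integral_cong, simp add: power_divide mult.commute)
  ultimately show ?thesis by simp
qed

section \<open>Solving the triangular system\<close>

definition sin_moment :: "nat \<Rightarrow> nat \<Rightarrow> real" where
  "sin_moment k p = integral {0..pi} (\<lambda>x. sin x ^ k * x ^ p)"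

lemma sin_moment_integrable: "(\<lambda>x. sin x ^ k * x ^ p) integrable_on {0..pi::real}"
  by (intro integrable_continuous_real continuous_intros)

lemma sin_moment_0: "sin_moment 0 p = pi ^ Suc p / Suc p"
proof -
  have "((\<lambda>x. x ^ Suc p / Suc p) has_real_derivative x ^ p) (at x within S)" for x :: real and S
  proof -
    have "((\<lambda>x. x ^ Suc p / Suc p) has_real_derivative (Suc p * x ^ p) / Suc p) (at x within S)"
      by (rule DERIV_cdivide) (rule derivative_eq_intros refl | simp)+
    then show ?thesis by simp
  qed
  then have "((\<lambda>x::real. x ^ p) has_integral (pi ^ Suc p / Suc p - 0 ^ Suc p / Suc p)) {0..pi}"
    by (intro fundamental_theorem_of_calculus)
      (auto simp flip: has_real_derivative_iff_has_vector_derivative)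
  then show ?thesis by (simp add: sin_moment_def integral_unique)
qed

text \<open>Two integrations by parts. For \<open>k = 1\<close> the boundary term does not vanish.\<close>

lemma sin_moment_recurrence:
  "(Suc k)\<^sup>2 * sin_moment (Suc k) p =
     Suc k * real k * sin_moment (k - 1) p - real p * real (p - 1) * sin_moment (Suc k) (p - 2) +
     (if k = 0 then pi ^ p + 0 ^ p else 0)"
proof -
  \<comment> \<open>\<open>F\<close> collects the boundary terms of both integrations. At the
    endpoints something survives for \<open>k = 0\<close> only, where \<open>0 ^ p\<close> is 1 if
    \<open>p = 0\<close>. When \<open>p - 1\<close> or \<open>p - 2\<close> is truncated, the
    coefficient in front of the power is 0.\<close>
  define F where "F = (\<lambda>x::real. - (Suc k * (sin x ^ k * cos x * x ^ p)) + p * (sin x ^ Suc k * x ^ (p - 1)))"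
  define f where "f = (\<lambda>x::real. (Suc k)\<^sup>2 * (sin x ^ Suc k * x ^ p) -
      Suc k * real k * (sin x ^ (k - 1) * x ^ p) + real p * real (p - 1) * (sin x ^ Suc k * x ^ (p - 2)))"
  have deriv: "(F has_real_derivative f x) (at x within S)" for x S
  proof -
    have "(F has_real_derivative
        - (Suc k * ((real k * sin x ^ (k - 1) * cos x) * cos x * x ^ p + sin x ^ k * (- sin x) * x ^ p +
           sin x ^ k * cos x * (real p * x ^ (p - 1)))) +
        p * ((Suc k * sin x ^ k * cos x) * x ^ (p - 1) + sin x ^ Suc k * (real (p - 1) * x ^ (p - 2))))
        (at x within S)"
      unfolding F_def
      by (rule derivative_eq_intros refl | simp add: numeral_2_eq_2)+ (simp add: algebra_simps)
    also have "- (Suc k * ((real k * sin x ^ (k - 1) * cos x) * cos x * x ^ p + sin x ^ k * (- sin x) * x ^ p +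
           sin x ^ k * cos x * (real p * x ^ (p - 1)))) +
        p * ((Suc k * sin x ^ k * cos x) * x ^ (p - 1) + sin x ^ Suc k * (real (p - 1) * x ^ (p - 2))) =
        Suc k * (sin x ^ Suc k * x ^ p) - Suc k * (real k * sin x ^ (k - 1) * (cos x)\<^sup>2 * x ^ p) +
        real p * real (p - 1) * (sin x ^ Suc k * x ^ (p - 2))"
      by (simp add: algebra_simps power2_eq_square)
    also have "real k * sin x ^ (k - 1) * (cos x)\<^sup>2 = real k * sin x ^ (k - 1) - real k * sin x ^ Suc k"
      unfolding cos_squared_eq by (cases k) (simp_all add: power2_eq_square algebra_simps)
    also have "Suc k * (sin x ^ Suc k * x ^ p) -
        Suc k * ((real k * sin x ^ (k - 1) - real k * sin x ^ Suc k) * x ^ p) +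
        real p * real (p - 1) * (sin x ^ Suc k * x ^ (p - 2)) = f x"
      by (simp add: f_def algebra_simps power2_eq_square)
    finally show ?thesis .
  qed
  have "(f has_integral (F pi - F 0)) {0..pi}"
    using deriv by (intro fundamental_theorem_of_calculus)
      (auto simp flip: has_real_derivative_iff_has_vector_derivative)
  moreover have "(f has_integral ((Suc k)\<^sup>2 * sin_moment (Suc k) p -
      Suc k * real k * sin_moment (k - 1) p + real p * real (p - 1) * sin_moment (Suc k) (p - 2))) {0..pi}"
    unfolding f_def sin_moment_def
    by (intro has_integral_add has_integral_diff has_integral_mult_right integrable_integral sin_moment_integrable)
  ultimately have "(Suc k)\<^sup>2 * sin_moment (Suc k) p - Suc k * real k * sin_moment (k - 1) p +
      real p * real (p - 1) * sin_moment (Suc k) (p - 2) = F pi - F 0"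
    using has_integral_unique by blast
  moreover have "F pi - F 0 = (if k = 0 then pi ^ p + 0 ^ p else 0)"
    by (cases k) (auto simp: F_def power_0_left)
  ultimately show ?thesis by linarith
qed

text \<open>The value 0 for \<open>k > n\<close> makes the systems triangular and lets the
  generating series in \<open>n\<close> start at degree \<open>k\<close>.\<close>

definition beta :: "nat \<Rightarrow> nat \<Rightarrow> real" where
  "beta n k = (if k \<le> n then sin_moment k (n - k) / (fact k * fact (n - k)) else 0)"

lemma B_num_eq_beta: "k \<le> n \<Longrightarrow> B_num (n + 1) (k + 1) = beta n k"
  by (simp add: B_num_def beta_def sin_moment_def)

lemma beta_0: "beta n 0 = pi ^ Suc n / fact (Suc n)"
  by (simp add: beta_def sin_moment_0 mult.commute)

lemma falling_factorial_2_div_fact: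
  "real p * real (p - 1) / fact p = (if p \<ge> 2 then 1 / fact (p - 2) else 0)"
proof (cases "p \<ge> 2")
  case True
  then obtain q where p: "p = Suc (Suc q)" by (metis Suc_le_D numeral_2_eq_2 le_Suc_eq Suc_le_mono)
  have "(fact p :: real) = (real p * real (p - 1)) * fact (p - 2)" by (simp add: p)
  moreover have "real p * real (p - 1) \<noteq> 0" by (simp add: p)
  ultimately show ?thesis using True by simp
next
  case False
  then have "p = 0 \<or> p = 1" by auto
  then show ?thesis by auto
qed

lemma beta_1:
  "beta n 1 + (if n \<ge> 2 then beta (n - 2) 1 else 0) =
     (if n \<ge> 1 then (pi ^ (n - 1) + 0 ^ (n - 1)) / fact (n - 1) else 0)"
proof (cases "n \<ge> 1")
  case True
  then obtain p where n: "n = Suc p" by (cases n) auto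
  have "sin_moment 1 p + real p * real (p - 1) * sin_moment 1 (p - 2) = pi ^ p + 0 ^ p"
    using sin_moment_recurrence[of 0 p] by simp
  moreover have "real p * real (p - 1) / fact p = (if n \<ge> 3 then 1 / fact (p - 2) else 0)"
    unfolding falling_factorial_2_div_fact by (simp add: n)
  moreover have "(sin_moment 1 p + real p * real (p - 1) * sin_moment 1 (p - 2)) / fact p =
      sin_moment 1 p / fact p + (real p * real (p - 1) / fact p) * sin_moment 1 (p - 2)"
    by (simp add: add_divide_distrib)
  ultimately have "(sin_moment 1 p) / fact p + (if n \<ge> 3 then sin_moment 1 (p - 2) / fact (p - 2) else 0) =
     (pi ^ p + 0 ^ p) / fact p"
    by simp
  moreover have "beta (n - 2) 1 = (if n \<ge> 3 then sin_moment 1 (p - 2) / fact (p - 2) else 0)"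
    by (auto simp: beta_def n numeral_eq_Suc)
  moreover have "beta n 1 = sin_moment 1 p / fact p" by (simp add: beta_def n)
  ultimately show ?thesis using True by (auto simp: n numeral_eq_Suc)
qed (auto simp: beta_def)

text \<open>This is \<open>sin_moment_recurrence\<close> divided by the factorials of
  \<open>beta\<close>; they absorb \<open>k * (k - 1)\<close> and \<open>p * (p - 1)\<close>,
  turning them into shifts of the indices by 2.\<close>

lemma beta_recurrence:
  assumes "k \<ge> 2"
  shows "(real k)\<^sup>2 * beta n k + (if n \<ge> 2 then beta (n - 2) k else 0) =
    (if n \<ge> 2 then beta (n - 2) (k - 2) else 0)"
proof (cases "k \<le> n")
  case True
  define p where "p = n - k"
  have n: "n = k + p" using True by (simp add: p_def)
  obtain l where l: "k = Suc (Suc l)" using assms by (metis Suc_le_D numeral_2_eq_2 le_Suc_eq Suc_le_mono)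
  have rec: "(real k)\<^sup>2 * sin_moment k p + real p * real (p - 1) * sin_moment k (p - 2) =
      real k * real (k - 1) * sin_moment (k - 2) p"
    using sin_moment_recurrence[of "Suc l" p] by (simp add: l)
  have 1: "real p * real (p - 1) / fact p = (if p \<ge> 2 then 1 / fact (p - 2) else 0)"
    by (rule falling_factorial_2_div_fact)
  have 2: "real k * real (k - 1) / fact k = 1 / fact (k - 2)"
    using falling_factorial_2_div_fact[of k] assms by simp
  have "((real k)\<^sup>2 * sin_moment k p + real p * real (p - 1) * sin_moment k (p - 2)) / (fact k * fact p) =
      (real k)\<^sup>2 * (sin_moment k p / (fact k * fact p)) +
      (real p * real (p - 1) / fact p) * (sin_moment k (p - 2) / fact k)"
    by (simp add: add_divide_distrib)
  moreover have "real k * real (k - 1) * sin_moment (k - 2) p / (fact k * fact p) =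
      (real k * real (k - 1) / fact k) * (sin_moment (k - 2) p / fact p)" by simp
  ultimately have "(real k)\<^sup>2 * (sin_moment k p / (fact k * fact p)) +
      (if p \<ge> 2 then sin_moment k (p - 2) / (fact k * fact (p - 2)) else 0) =
      sin_moment (k - 2) p / (fact (k - 2) * fact p)"
    unfolding rec 1 2 by (auto simp: mult.commute)
  moreover have "beta n k = sin_moment k p / (fact k * fact p)" by (simp add: beta_def n)
  moreover have "beta (n - 2) k = (if p \<ge> 2 then sin_moment k (p - 2) / (fact k * fact (p - 2)) else 0)"
    using assms by (auto simp: beta_def n)
  moreover have "beta (n - 2) (k - 2) = sin_moment (k - 2) p / (fact (k - 2) * fact p)"
    by (simp add: beta_def n l)
  moreover have "n \<ge> 2" using assms n by simp
  ultimately show ?thesis by simp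
next
  case False
  then show ?thesis using assms by (auto simp: beta_def)
qed

section \<open>Generating functions\<close>

definition beta_fps :: "nat \<Rightarrow> complex fps" where
  "beta_fps k = Abs_fps (\<lambda>n. of_real (beta n k))"

definition exp_pi :: "complex fps" where "exp_pi = fps_exp (of_real pi)"

text \<open>The factors accumulated by the two-step recursion of \<open>beta_fps\<close>. For
  \<open>k = 0\<close> this is \<open>Q_series (Suc m)\<close> with denominators cleared: in
  \<open>t = 1 / x\<close> the factor \<open>j\<^sup>2 + t\<^sup>2\<close> is
  \<open>t\<^sup>2\<close> times \<open>1 + j\<^sup>2 x\<^sup>2\<close>.\<close>

definition quad_prod :: "nat \<Rightarrow> nat \<Rightarrow> complex fps" where
  "quad_prod k m = (\<Prod>j | j \<in> {k<..m} \<and> j mod 2 = m mod 2. of_nat (j\<^sup>2) + fps_X\<^sup>2)"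

lemma exp_pi_nth: "exp_pi $ n = of_real (pi ^ n / fact n)"
  unfolding exp_pi_def fps_exp_nth by simp

lemma beta_fps_recurrence:
  assumes "k \<ge> 2"
  shows "(of_nat (k\<^sup>2) + fps_X\<^sup>2) * beta_fps k = fps_X\<^sup>2 * beta_fps (k - 2)"
proof (rule fps_ext)
  fix n
  have "((of_nat (k\<^sup>2) + fps_X\<^sup>2) * beta_fps k) $ n =
     of_real ((real k)\<^sup>2 * beta n k + (if n \<ge> 2 then beta (n - 2) k else 0))"
    by (simp add: distrib_right fps_X_power_mult_nth beta_fps_def flip: fps_of_nat)
  also have "\<dots> = (fps_X\<^sup>2 * beta_fps (k - 2)) $ n"
    unfolding beta_recurrence[OF assms] by (simp add: fps_X_power_mult_nth beta_fps_def)
  finally show "((of_nat (k\<^sup>2) + fps_X\<^sup>2) * beta_fps k) $ n = (fps_X\<^sup>2 * beta_fps (k - 2)) $ n" .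
qed

lemma fps_X_times_beta_fps_0: "fps_X * beta_fps 0 = exp_pi - 1"
proof (rule fps_ext)
  show "(fps_X * beta_fps 0) $ n = (exp_pi - 1) $ n" for n
    by (cases n) (simp_all add: beta_fps_def exp_pi_nth beta_0 del: fact_Suc power_Suc)
qed

text \<open>The start of the odd chain. The series \<open>exp_pi + 1\<close> generates the boundary
  terms \<open>pi ^ p + 0 ^ p\<close> of the integration by parts.\<close>

lemma beta_fps_1: "(1 + fps_X\<^sup>2) * beta_fps 1 = fps_X * (exp_pi + 1)"
proof (rule fps_ext)
  fix n
  have "((1 + fps_X\<^sup>2) * beta_fps 1) $ n =
      of_real (beta n 1 + (if n \<ge> 2 then beta (n - 2) 1 else 0))"
    by (simp add: distrib_right fps_X_power_mult_nth beta_fps_def)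
  also have "\<dots> = (fps_X * (exp_pi + 1)) $ n"
    unfolding beta_1 by (auto simp: exp_pi_nth power_0_left add_divide_distrib)
  finally show "((1 + fps_X\<^sup>2) * beta_fps 1) $ n = (fps_X * (exp_pi + 1)) $ n" .
qed

lemma quad_prod_trivial: "m \<le> k \<Longrightarrow> quad_prod k m = 1"
  unfolding quad_prod_def by (rule prod.neutral) auto

lemma quad_prod_step:
  assumes "m \<ge> 2" "k \<le> m - 2"
  shows "quad_prod k m = (of_nat (m\<^sup>2) + fps_X\<^sup>2) * quad_prod k (m - 2)"
proof -
  have "{j. j \<in> {k<..m} \<and> j mod 2 = m mod 2} = insert m {j. j \<in> {k<..m - 2} \<and> j mod 2 = (m - 2) mod 2}"
    using assms by (auto simp: mod2_eq_if split: if_splits) (presburger+)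
  then have "quad_prod k m = (\<Prod>j\<in>insert m {j. j \<in> {k<..m - 2} \<and> j mod 2 = (m - 2) mod 2}. of_nat (j\<^sup>2) + fps_X\<^sup>2)"
    by (simp only: quad_prod_def)
  also have "\<dots> = (of_nat (m\<^sup>2) + fps_X\<^sup>2) * quad_prod k (m - 2)"
    unfolding quad_prod_def using assms(1) by (intro prod.insert) auto
  finally show ?thesis .
qed

lemma quad_prod_split:
  assumes "k \<le> m" "k mod 2 = m mod 2"
  shows "quad_prod 0 m = quad_prod 0 k * quad_prod k m"
proof -
  have "{j. j \<in> {0<..m} \<and> j mod 2 = m mod 2} =
      {j. j \<in> {0<..k} \<and> j mod 2 = k mod 2} \<union> {j. j \<in> {k<..m} \<and> j mod 2 = m mod 2}"
    using assms by auto
  then have "quad_prod 0 m = (\<Prod>j\<in>{j. j \<in> {0<..k} \<and> j mod 2 = k mod 2} \<union> {j. j \<in> {k<..m} \<and> j mod 2 = m mod 2}.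
      of_nat (j\<^sup>2) + fps_X\<^sup>2)"
    by (simp only: quad_prod_def)
  also have "\<dots> = quad_prod 0 k * quad_prod k m"
    unfolding quad_prod_def by (intro prod.union_disjoint) auto
  finally show ?thesis .
qed

text \<open>There are \<open>(m - k) / 2\<close> quadratic factors.\<close>

lemma quad_prod_nth_eq_0:
  assumes "k \<le> m" "n > m - k" "k mod 2 = m mod 2"
  shows "quad_prod k m $ n = 0"
  using assms
proof (induction m arbitrary: n rule: less_induct)
  case (less m)
  show ?case
  proof (cases "m = k")
    case False
    then have m: "k + 2 \<le> m" using less.prems(1,3) by presburger
    then have "quad_prod k m $ n = of_nat (m\<^sup>2) * quad_prod k (m - 2) $ n +
        (if n \<ge> 2 then quad_prod k (m - 2) $ (n - 2) else 0)"
      by (subst quad_prod_step) (auto simp: distrib_right fps_X_power_mult_nth simp flip: fps_of_nat)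
    moreover have "k mod 2 = (m - 2) mod 2"
      using m less.prems(3) by (simp add: le_mod_geq)
    with m less.prems have "quad_prod k (m - 2) $ n = 0" "quad_prod k (m - 2) $ (n - 2) = 0"
      by (intro less.IH; simp)+
    ultimately show ?thesis by simp
  qed (use less.prems in \<open>simp add: quad_prod_trivial\<close>)
qed

text \<open>Clearing denominators with \<open>quad_prod 0 (K - 2)\<close> turns all terms with \<open>k < K\<close> into
  polynomials of degree less than \<open>K\<close>, which isolates the coefficient \<open>X K\<close>.\<close>

lemma triangular_coefficient:
  fixes X :: "nat \<Rightarrow> real" and U V :: "complex fps"
  assumes K: "K \<ge> 1" and U: "U $ 0 \<noteq> 0"
    and beta: "\<And>k. k \<in> {1..K} \<Longrightarrow> k mod 2 = K mod 2 \<Longrightarrow> beta_fps k * quad_prod 0 k = fps_X ^ k * U"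
    and sys: "\<And>n. n \<le> K \<Longrightarrow>
      (\<Sum>k | k \<in> {1..K} \<and> k mod 2 = K mod 2. of_real (X k) * beta_fps k $ n) = (V * U) $ n"
  shows "of_real (X K) = of_nat (K\<^sup>2) * (V * quad_prod 0 (K - 2)) $ K"
proof -
  define S where "S = {k. k \<in> {1..K} \<and> k mod 2 = K mod 2}"
  have S: "finite S" "K \<in> S" using K by (auto simp: S_def)
  define c where "c = (of_nat (K\<^sup>2) + fps_X\<^sup>2 :: complex fps)"
  have c0: "c $ 0 = of_nat (K\<^sup>2)" by (simp add: c_def flip: fps_of_nat)
  define W where "W = (\<Sum>k\<in>S - {K}. fps_const (of_real (X k)) * (fps_X ^ k * quad_prod k (K - 2)))"
  have K2: "k \<le> K - 2 \<and> k mod 2 = (K - 2) mod 2" if "k \<in> S - {K}" for k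
  proof -
    have "k < K" "k mod 2 = K mod 2" using that by (auto simp: S_def)
    then have "k + 2 \<le> K" by presburger
    then show ?thesis using \<open>k mod 2 = K mod 2\<close> by (simp add: le_mod_geq)
  qed
  have prod_K: "quad_prod 0 K = (if K = 1 then c else c * quad_prod 0 (K - 2))"
  proof (cases "K = 1")
    case True
    have "{j. j \<in> {0<..1} \<and> j mod 2 = 1 mod 2} = {1::nat}" by auto
    then have "quad_prod 0 1 = c" unfolding quad_prod_def by (simp add: c_def True)
    then show ?thesis using True by simp
  next
    case False
    then show ?thesis using quad_prod_step[of K 0] K by (simp add: c_def)
  qed
  have prod_K': "quad_prod 0 K = c * quad_prod 0 (K - 2)"
    using prod_K by (auto simp: quad_prod_trivial)
  define H where "H = (\<Sum>k\<in>S. fps_const (of_real (X k)) * beta_fps k) - V * U"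
  have H: "H $ n = 0" if "n \<le> K" for n
    using sys[OF that] by (simp add: H_def fps_sum_nth S_def)
  have "H * quad_prod 0 K =
      (\<Sum>k\<in>S. fps_const (of_real (X k)) * (beta_fps k * quad_prod 0 K)) - V * U * quad_prod 0 K"
    by (simp add: H_def left_diff_distrib sum_distrib_right mult.assoc)
  also have "(\<Sum>k\<in>S. fps_const (of_real (X k)) * (beta_fps k * quad_prod 0 K)) =
      fps_const (of_real (X K)) * (fps_X ^ K * U) +
      (\<Sum>k\<in>S - {K}. fps_const (of_real (X k)) * (beta_fps k * quad_prod 0 K))"
    using S beta[of K] K by (subst sum.remove[of _ K]) auto
  also have "(\<Sum>k\<in>S - {K}. fps_const (of_real (X k)) * (beta_fps k * quad_prod 0 K)) = U * c * W"
    unfolding W_def sum_distrib_left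
  proof (rule sum.cong)
    fix k assume k: "k \<in> S - {K}"
    have "quad_prod 0 K = quad_prod 0 k * (c * quad_prod k (K - 2))"
      using quad_prod_split[of k "K - 2"] K2[OF k] prod_K' by simp
    moreover have "beta_fps k * quad_prod 0 k = fps_X ^ k * U" using k by (intro beta) (auto simp: S_def)
    ultimately have "beta_fps k * quad_prod 0 K = fps_X ^ k * U * (c * quad_prod k (K - 2))"
      by (simp add: mult.assoc[symmetric])
    then show "fps_const (of_real (X k)) * (beta_fps k * quad_prod 0 K) =
        U * c * (fps_const (of_real (X k)) * (fps_X ^ k * quad_prod k (K - 2)))" by (simp add: mult_ac)
  qed simp
  finally have eq: "H * quad_prod 0 K =
      U * (fps_const (of_real (X K)) * fps_X ^ K + c * (W - V * quad_prod 0 (K - 2)))"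
    unfolding prod_K' by (simp add: algebra_simps)
  \<comment> \<open>\<open>U\<close> is invertible, so the vanishing of \<open>H\<close> up to
    degree \<open>K\<close> passes to \<open>R\<close>.\<close>
  define R where "R = fps_const (of_real (X K)) * fps_X ^ K + c * (W - V * quad_prod 0 (K - 2))"
  have "R = inverse U * (H * quad_prod 0 K)"
    unfolding eq R_def using U by (simp add: mult.assoc[symmetric] inverse_mult_eq_1)
  then have R: "R $ n = 0" if "n \<le> K" for n
  proof -
    have "R = H * (quad_prod 0 K * inverse U)"
      using \<open>R = inverse U * (H * quad_prod 0 K)\<close> by (simp add: mult_ac)
    then show ?thesis using H that by (simp add: fps_mult_nth)
  qed
  define Y where "Y = W - V * quad_prod 0 (K - 2)"
  have cK: "of_nat (K\<^sup>2) \<noteq> (0::complex)" using K by simp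
  \<comment> \<open>Division by \<open>c\<close> isolates \<open>Y\<close>. As \<open>c\<close> has
    constant term \<open>K\<^sup>2\<close>, the coefficient of \<open>fps_X ^ K * inverse c\<close>
    at \<open>K\<close> is \<open>1 / K\<^sup>2\<close>; this is the origin of the factor
    \<open>K\<^sup>2\<close> in the result.\<close>
  have "inverse c * R = fps_const (of_real (X K)) * (fps_X ^ K * inverse c) + Y"
  proof -
    have "inverse c * c = 1" by (rule inverse_mult_eq_1) (use c0 cK in simp)
    then have "inverse c * (c * Y) = Y" by (simp only: mult.assoc[symmetric] mult_1)
    then show ?thesis unfolding R_def Y_def[symmetric] by (simp add: distrib_left mult_ac)
  qed
  moreover have "(inverse c * R) $ K = 0" using R by (simp add: fps_mult_nth)
  ultimately have "of_real (X K) * inverse (of_nat (K\<^sup>2)) + Y $ K = 0"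
    using c0 by (metis (no_types, lifting) fps_add_nth fps_X_power_mult_nth fps_inverse_nth_0 diff_self_eq_0 fps_mult_left_const_nth less_irrefl)
  moreover have "W $ K = 0" unfolding W_def fps_sum_nth
  proof (rule sum.neutral, rule ballI)
    fix k assume k: "k \<in> S - {K}"
    then have "k < K" by (auto simp: S_def)
    then have "quad_prod k (K - 2) $ (K - k) = 0"
      using K2[OF k] by (intro quad_prod_nth_eq_0) auto
    with \<open>k < K\<close> show "(fps_const (of_real (X k)) * (fps_X ^ k * quad_prod k (K - 2))) $ K = 0"
      by (simp add: fps_X_power_mult_nth)
  qed
  ultimately have "of_real (X K) * inverse (of_nat (K\<^sup>2)) = (V * quad_prod 0 (K - 2)) $ K"
    by (simp add: Y_def)
  then show ?thesis using cK by (simp add: field_simps)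
qed

text \<open>Each use of \<open>beta_fps_recurrence\<close> trades a factor of
  \<open>quad_prod\<close> for \<open>fps_X\<^sup>2\<close> until \<open>k = 0\<close> is reached;
  the odd chain ends at \<open>k = 1\<close> with \<open>beta_fps_1\<close>.\<close>

lemma beta_fps_even: "k mod 2 = 0 \<Longrightarrow> beta_fps k * quad_prod 0 k = fps_X ^ k * beta_fps 0"
proof (induction k rule: less_induct)
  case (less k)
  show ?case
  proof (cases "k = 0")
    case False
    with less.prems have k: "k \<ge> 2" by auto
    then have "beta_fps k * quad_prod 0 k = fps_X\<^sup>2 * beta_fps (k - 2) * quad_prod 0 (k - 2)"
      using quad_prod_step[of k 0] beta_fps_recurrence[of k] by (simp add: mult_ac)
    also have "\<dots> = fps_X\<^sup>2 * (beta_fps (k - 2) * quad_prod 0 (k - 2))" by (simp only: mult.assoc)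
    also have "beta_fps (k - 2) * quad_prod 0 (k - 2) = fps_X ^ (k - 2) * beta_fps 0"
      using k less.prems by (intro less.IH) (auto simp: le_mod_geq[symmetric])
    also have "fps_X\<^sup>2 * (fps_X ^ (k - 2) * U) = fps_X ^ k * U" for U :: "complex fps"
    proof -
      have "(fps_X :: complex fps) ^ k = fps_X\<^sup>2 * fps_X ^ (k - 2)"
        using k by (metis le_add_diff_inverse power_add less_imp_le)
      then show ?thesis by (simp only: mult.assoc)
    qed
    finally show ?thesis .
  qed (simp add: quad_prod_trivial)
qed

lemma beta_fps_odd: "k mod 2 = 1 \<Longrightarrow> beta_fps k * quad_prod 0 k = fps_X ^ k * (exp_pi + 1)"
proof (induction k rule: less_induct)
  case (less k)
  show ?case
  proof (cases "k = 1")
    case True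
    have "{j. j \<in> {0<..1} \<and> j mod 2 = 1 mod 2} = {1::nat}" by auto
    then have "quad_prod 0 1 = 1 + fps_X\<^sup>2" unfolding quad_prod_def by simp
    then show ?thesis using beta_fps_1 True by (simp add: mult.commute)
  next
    case False
    with less.prems have k: "k > 2" by presburger
    then have "beta_fps k * quad_prod 0 k = fps_X\<^sup>2 * beta_fps (k - 2) * quad_prod 0 (k - 2)"
      using quad_prod_step[of k 0] beta_fps_recurrence[of k] by (simp add: mult_ac)
    also have "\<dots> = fps_X\<^sup>2 * (beta_fps (k - 2) * quad_prod 0 (k - 2))" by (simp only: mult.assoc)
    also have "beta_fps (k - 2) * quad_prod 0 (k - 2) = fps_X ^ (k - 2) * (exp_pi + 1)"
      using k less.prems by (intro less.IH) (auto simp: le_mod_geq[symmetric])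
    also have "fps_X\<^sup>2 * (fps_X ^ (k - 2) * U) = fps_X ^ k * U" for U :: "complex fps"
    proof -
      have "(fps_X :: complex fps) ^ k = fps_X\<^sup>2 * fps_X ^ (k - 2)"
        using k by (metis le_add_diff_inverse power_add less_imp_le)
      then show ?thesis by (simp only: mult.assoc)
    qed
    finally show ?thesis .
  qed
qed

section \<open>Expansions of tanh and coth\<close>

text \<open>The Taylor series of \<open>tanh (pi * t / 2)\<close>, written through
  \<open>exp (pi * t)\<close>.\<close>

definition tanh_fps :: "complex fps" where
  "tanh_fps = (exp_pi - 1) * inverse (exp_pi + 1)"

text \<open>The Taylor series of \<open>t * coth (pi * t / 2)\<close>.\<close>

definition t_coth_fps :: "complex fps" where
  "t_coth_fps = (exp_pi + 1) * inverse (beta_fps 0)"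

lemma exp_pi_plus_1_nth_0: "(exp_pi + 1) $ 0 = 2"
  by (simp add: exp_pi_nth)

lemma beta_fps_0_nth_0: "beta_fps 0 $ 0 = of_real pi"
  by (simp add: beta_fps_def beta_0)

lemma exp_pi_expansion: "(\<lambda>t. exp (of_real pi * t)) has_fps_expansion exp_pi"
  unfolding exp_pi_def by (rule has_fps_expansion_exp)

lemma tanh_half_eq: "tanh (z / 2) = (exp z - 1) * inverse (exp z + 1)" for z :: complex
proof -
  have "exp z = exp (z / 2) * exp (z / 2)" by (simp flip: exp_add)
  moreover have "exp (z / 2) * exp (- (z / 2)) = 1" by (simp flip: exp_add)
  ultimately show ?thesis
    by (simp add: tanh_def sinh_def cosh_def scaleR_conv_of_real divide_simps exp_minus)
      (simp add: field_simps)?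
qed

lemma tanh_series_eq: "tanh_series = fps_to_fls tanh_fps"
  unfolding tanh_series_def
proof (rule laurent_expansion_0_eqI)
  have "(\<lambda>t. (exp (of_real pi * t) - 1) * inverse (exp (of_real pi * t) + 1)) has_fps_expansion tanh_fps"
    unfolding tanh_fps_def using exp_pi_plus_1_nth_0
    by (intro fps_expansion_intros exp_pi_expansion) auto
  then show "(\<lambda>t. tanh (of_real pi * t / 2)) has_laurent_expansion fps_to_fls tanh_fps"
    unfolding tanh_half_eq by (rule has_laurent_expansion_fps)
qed

lemma coth_half_eq: "cosh (z / 2) / sinh (z / 2) = (exp z + 1) / (exp z - 1)" for z :: complex
proof -
  have "exp z = exp (z / 2) * exp (z / 2)" by (simp flip: exp_add)
  moreover have "exp (z / 2) * exp (- (z / 2)) = 1" by (simp flip: exp_add)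
  ultimately show ?thesis
    by (simp add: sinh_def cosh_def scaleR_conv_of_real divide_simps exp_minus)
      (simp add: field_simps)?
qed

text \<open>The pole of coth at 0 comes from \<open>exp_pi - 1 = fps_X * beta_fps 0\<close>, where
  \<open>beta_fps 0\<close> is invertible; one factor \<open>t\<close> removes it.\<close>

lemma coth_series_eq: "fls_X * coth_series = fps_to_fls t_coth_fps"
proof -
  have nz: "exp_pi - 1 \<noteq> 0" "beta_fps 0 \<noteq> 0"
    using beta_fps_0_nth_0 by (auto simp: fps_X_times_beta_fps_0[symmetric])
  have "(\<lambda>t. (exp (of_real pi * t) + 1) / (exp (of_real pi * t) - 1)) has_laurent_expansion
      fps_to_fls (exp_pi + 1) / fps_to_fls (exp_pi - 1)"
    by (intro has_laurent_expansion_divide has_laurent_expansion_fps fps_expansion_intros exp_pi_expansion)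
  then have "coth_series = fps_to_fls (exp_pi + 1) / fps_to_fls (exp_pi - 1)"
    unfolding coth_series_def coth_half_eq by (rule laurent_expansion_0_eqI)
  also have "fps_to_fls (exp_pi - 1) = fls_X * fps_to_fls (beta_fps 0)"
    unfolding fps_X_times_beta_fps_0[symmetric] fls_times_fps_to_fls by simp
  also have "exp_pi + 1 = t_coth_fps * beta_fps 0"
    unfolding t_coth_fps_def using beta_fps_0_nth_0
    by (simp add: mult.assoc inverse_mult_eq_1)
  also have "fps_to_fls (t_coth_fps * beta_fps 0) / (fls_X * fps_to_fls (beta_fps 0)) = fps_to_fls t_coth_fps / fls_X"
    using nz by (simp add: fls_times_fps_to_fls)
  finally have "fls_X * coth_series = fls_X * (fps_to_fls t_coth_fps / fls_X)"
    by (rule arg_cong)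
  also have "\<dots> = fps_to_fls t_coth_fps"
    unfolding times_divide_eq_right by (rule nonzero_mult_div_cancel_left) simp
  finally show ?thesis .
qed

text \<open>There are \<open>Suc k div 2\<close> factors, and each needs \<open>t\<^sup>2\<close> to
  pass from \<open>1 + j\<^sup>2 x\<^sup>2\<close> to \<open>j\<^sup>2 + t\<^sup>2\<close>.\<close>

lemma fps_to_fls_quad_prod:
  "fps_to_fls (quad_prod 0 k) = Q_series (Suc k) * fls_X ^ (2 * (Suc k div 2))"
proof (induction k rule: less_induct)
  case (less k)
  consider "k = 0" | "k = 1" | "k \<ge> 2" by linarith
  then show ?case
  proof cases
    case 1
    have "{j::nat. Suc 0 \<le> j \<and> j < Suc 0 \<and> j mod 2 \<noteq> Suc 0 mod 2} = {}" by auto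
    then show ?thesis using 1 by (simp add: quad_prod_trivial Q_series_def)
  next
    case 2
    have "{j. j \<in> {0<..1} \<and> j mod 2 = 1 mod 2} = {1::nat}" by auto
    then have "quad_prod 0 1 = 1 + fps_X\<^sup>2" unfolding quad_prod_def by simp
    moreover have "{j. j \<in> {1..<2} \<and> j mod 2 \<noteq> 2 mod 2} = {1::nat}" by auto
    then have "Q_series 2 = 1 + fls_X_inv\<^sup>2" unfolding Q_series_def by simp
    moreover have "fls_X_inv\<^sup>2 * fls_X\<^sup>2 = (1 :: complex fls)"
      by (simp add: fls_X_inv_power_conv_shift_1 fls_X_power_conv_shift_1 fls_times_both_shifted_simp)
    ultimately show ?thesis using 2 by (simp add: fps_to_fls_power distrib_right numeral_2_eq_2[symmetric])
  next
    case 3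
    have "{j. j \<in> {1..<Suc k} \<and> j mod 2 \<noteq> Suc k mod 2} =
        insert k {j. j \<in> {1..<k - 1} \<and> j mod 2 \<noteq> (k - 1) mod 2}"
    proof (intro set_eqI)
      fix j
      obtain l where "k = Suc (Suc l)" using 3 by (metis Suc_le_D numeral_2_eq_2 le_Suc_eq Suc_le_mono)
      then show "j \<in> {j. j \<in> {1..<Suc k} \<and> j mod 2 \<noteq> Suc k mod 2} \<longleftrightarrow>
          j \<in> insert k {j. j \<in> {1..<k - 1} \<and> j mod 2 \<noteq> (k - 1) mod 2}"
        by (simp add: mod2_eq_if) presburger
    qed
    then have "Q_series (Suc k) = (\<Prod>j\<in>insert k {j. j \<in> {1..<k - 1} \<and> j mod 2 \<noteq> (k - 1) mod 2}.
        1 + of_nat (j\<^sup>2) * fls_X_inv\<^sup>2)" by (simp only: Q_series_def)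
    also have "\<dots> = (1 + of_nat (k\<^sup>2) * fls_X_inv\<^sup>2) * Q_series (k - 1)"
      unfolding Q_series_def using 3 by (intro prod.insert) auto
    finally have Q: "Q_series (Suc k) = (1 + of_nat (k\<^sup>2) * fls_X_inv\<^sup>2) * Q_series (Suc (k - 2))"
      using 3 by (simp add: Suc_diff_Suc numeral_2_eq_2)
    have inv: "fls_X_inv\<^sup>2 * fls_X\<^sup>2 = (1 :: complex fls)"
      by (simp add: fls_X_inv_power_conv_shift_1 fls_X_power_conv_shift_1 fls_times_both_shifted_simp)
    have "fps_to_fls (quad_prod 0 k) = (of_nat (k\<^sup>2) + fls_X\<^sup>2) * fps_to_fls (quad_prod 0 (k - 2))"
      using quad_prod_step[of k 0] 3
      by (simp add: fls_times_fps_to_fls fps_to_fls_power)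
    also have "fps_to_fls (quad_prod 0 (k - 2)) = Q_series (Suc (k - 2)) * fls_X ^ (2 * (Suc (k - 2) div 2))"
      using 3 by (intro less.IH) auto
    also have "of_nat (k\<^sup>2) + fls_X\<^sup>2 = (1 + of_nat (k\<^sup>2) * fls_X_inv\<^sup>2) * (fls_X\<^sup>2 :: complex fls)"
      using inv by (simp add: distrib_right mult.assoc)
    also have "(1 + of_nat (k\<^sup>2) * fls_X_inv\<^sup>2) * fls_X\<^sup>2 * (Q_series (Suc (k - 2)) * fls_X ^ (2 * (Suc (k - 2) div 2))) =
        Q_series (Suc k) * fls_X ^ (2 + 2 * (Suc (k - 2) div 2))"
      unfolding Q power_add by (simp only: mult_ac)
    also have "2 + 2 * (Suc (k - 2) div 2) = 2 * (Suc k div 2)" using 3 by presburger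
    finally show ?thesis .
  qed
qed

lemma A_num_odd:
  assumes "odd K"
  shows "A_num (K - 1) (- 1) = Re ((tanh_fps * quad_prod 0 (K - 2)) $ K)"
proof -
  have Q: "fps_to_fls (quad_prod 0 (K - 2)) = Q_series (K - 1) * fls_X ^ (K - 1)"
  \<comment> \<open>Truncated subtraction makes \<open>K = 1\<close> special:
    \<open>Suc (K - 2)\<close> is then 1 and not \<open>K - 1\<close>.\<close>
  proof (cases "K = 1")
    case True
    have "{j::nat. j \<in> {1..<0} \<and> j mod 2 \<noteq> 0 mod 2} = {}" by auto
    then have "Q_series 0 = 1" unfolding Q_series_def by simp
    then show ?thesis using True by (simp add: quad_prod_trivial)
  next
    case False
    then have "Suc (K - 2) = K - 1" "2 * ((K - 1) div 2) = K - 1" using assms by presburger+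
    then show ?thesis using fps_to_fls_quad_prod[of "K - 2"] by simp
  qed
  have "(tanh_fps * quad_prod 0 (K - 2)) $ K = fls_nth (fps_to_fls (tanh_fps * quad_prod 0 (K - 2))) (int K)"
    by simp
  also have "fps_to_fls (tanh_fps * quad_prod 0 (K - 2)) = (tanh_series * Q_series (K - 1)) * fls_X ^ (K - 1)"
    unfolding fls_times_fps_to_fls Q tanh_series_eq by (simp only: mult.assoc)
  also have "\<dots> = fls_shift (- int (K - 1)) (tanh_series * Q_series (K - 1))"
    by (simp only: fls_X_power_times_conv_shift)
  \<comment> \<open>The \<open>K - 1\<close> extra powers of \<open>t\<close> lower the index from
    \<open>K\<close> to 1, which stands for the power -1 of \<open>x\<close>.\<close>
  also have "fls_nth \<dots> (int K) = fls_nth (tanh_series * Q_series (K - 1)) 1"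
    using assms by (simp add: of_nat_diff odd_pos Suc_leI)
  finally show ?thesis using assms by (simp add: A_num_def)
qed

text \<open>Of the \<open>K - 1\<close> extra powers of \<open>t\<close>, one belongs to
  \<open>t_coth_fps\<close> and \<open>K - 2\<close> belong to \<open>quad_prod\<close>.\<close>

lemma A_num_even:
  assumes "even K" "K > 0"
  shows "A_num (K - 1) (- 1) = Re ((t_coth_fps * quad_prod 0 (K - 2)) $ K)"
proof -
  have K: "Suc (K - 2) = K - 1" "2 * ((K - 1) div 2) = K - 2" "1 + (K - 2) = K - 1" "K \<ge> 2"
    using assms by presburger+
  then have Q: "fps_to_fls (quad_prod 0 (K - 2)) = Q_series (K - 1) * fls_X ^ (K - 2)"
    using fps_to_fls_quad_prod[of "K - 2"] by simp
  have "(t_coth_fps * quad_prod 0 (K - 2)) $ K = fls_nth (fps_to_fls (t_coth_fps * quad_prod 0 (K - 2))) (int K)"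
    by simp
  also have "fps_to_fls (t_coth_fps * quad_prod 0 (K - 2)) = (coth_series * Q_series (K - 1)) * (fls_X ^ 1 * fls_X ^ (K - 2))"
    unfolding fls_times_fps_to_fls Q coth_series_eq[symmetric] by (simp only: mult_ac power_one_right)
  also have "\<dots> = fls_shift (- int (K - 1)) (coth_series * Q_series (K - 1))"
    unfolding power_add[symmetric] K(3) by (simp only: fls_X_power_times_conv_shift)
  also have "fls_nth \<dots> (int K) = fls_nth (coth_series * Q_series (K - 1)) 1"
    using K(4) by (simp add: of_nat_diff)
  finally show ?thesis using assms by (simp add: A_num_def)
qed

lemma sum_beta_fps_nth:
  assumes "n \<le> K"
  shows "(\<Sum>k | k \<in> {1..K} \<and> k mod 2 = K mod 2. of_real (X k) * beta_fps k $ n) =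
    of_real (\<Sum>k | k \<in> {1..n} \<and> k mod 2 = K mod 2. beta n k * X k)"
proof -
  have "(\<Sum>k | k \<in> {1..K} \<and> k mod 2 = K mod 2. of_real (X k) * beta_fps k $ n) =
      (\<Sum>k | k \<in> {1..K} \<and> k mod 2 = K mod 2. of_real (beta n k * X k) :: complex)"
    by (simp add: beta_fps_def mult.commute)
  also have "\<dots> = (\<Sum>k | k \<in> {1..n} \<and> k mod 2 = K mod 2. of_real (beta n k * X k))"
    using assms by (intro sum.mono_neutral_right) (auto simp: beta_def)
  finally show ?thesis by simp
qed

lemma triangular_solution_odd:
  assumes "\<And>n. n \<ge> 1 \<Longrightarrow> (\<Sum>k | k \<in> {1..n} \<and> k mod 2 = 1. beta n k * X k) = pi ^ n / fact n"
    and K: "odd K"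
  shows "X K = (real K)\<^sup>2 * A_num (K - 1) (- 1)"
proof -
  have K1: "K \<ge> 1" "K mod 2 = 1" using K by (auto simp: odd_iff_mod_2_eq_one odd_pos Suc_leI)
  have U: "(exp_pi + 1) $ 0 \<noteq> 0" by (simp only: exp_pi_plus_1_nth_0) simp
  \<comment> \<open>\<open>exp_pi - 1\<close> has the right-hand sides
    \<open>pi ^ n / fact n\<close> as its coefficients, with 0 at \<open>n = 0\<close>. Divided by
    the common factor \<open>exp_pi + 1\<close> of the odd chain it becomes the hyperbolic
    tangent.\<close>
  have VU: "tanh_fps * (exp_pi + 1) = exp_pi - 1"
    using U by (simp add: tanh_fps_def mult.assoc inverse_mult_eq_1)
  have "complex_of_real (X K) = of_nat (K\<^sup>2) * (tanh_fps * quad_prod 0 (K - 2)) $ K"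
  proof (rule triangular_coefficient[OF K1(1) U])
    show "(\<Sum>k | k \<in> {1..K} \<and> k mod 2 = K mod 2. of_real (X k) * beta_fps k $ n) =
        (tanh_fps * (exp_pi + 1)) $ n" if "n \<le> K" for n
      unfolding sum_beta_fps_nth[OF that] VU
      using assms(1)[of n] K1(2) by (cases "n = 0") (simp_all add: exp_pi_nth)
  qed (use K1 beta_fps_odd in auto)
  then have "X K = Re (of_nat (K\<^sup>2) * (tanh_fps * quad_prod 0 (K - 2)) $ K)"
    by (metis Re_complex_of_real)
  also have "\<dots> = (real K)\<^sup>2 * Re ((tanh_fps * quad_prod 0 (K - 2)) $ K)"
    by (simp flip: of_nat_power)
  finally show ?thesis unfolding A_num_odd[OF K] .
qed

lemma triangular_solution_even:
  assumes "\<And>n. n \<ge> 1 \<Longrightarrow> (\<Sum>k | k \<in> {1..n} \<and> k mod 2 = 0. beta n k * X k) =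
      pi ^ n / fact n * ((real n - 1) / (real n + 1))"
    and K: "even K" "K > 0"
  shows "X K = (real K)\<^sup>2 * A_num (K - 1) (- 1)"
proof -
  have K1: "K \<ge> 1" "K mod 2 = 0" using K by auto
  have U: "beta_fps 0 $ 0 \<noteq> 0" by (simp add: beta_fps_0_nth_0)
  \<comment> \<open>Since \<open>2 / pi * beta n 0\<close> is \<open>pi ^ n / fact n\<close> times
    \<open>2 / (n + 1)\<close>, subtracting \<open>2 / pi\<close> produces the factor
    \<open>(n - 1) / (n + 1)\<close> and annihilates the coefficient at 0. This constant multiplies
    a polynomial of degree \<open>K - 2\<close> and leaves the coefficient at \<open>K\<close>
    unchanged.\<close>
  define V where "V = t_coth_fps - fps_const (of_real (2 / pi))"
  have "t_coth_fps * beta_fps 0 = exp_pi + 1"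
    using U by (simp add: t_coth_fps_def mult.assoc inverse_mult_eq_1)
  then have VU: "V * beta_fps 0 = exp_pi + 1 - fps_const (of_real (2 / pi)) * beta_fps 0"
    by (simp add: V_def left_diff_distrib)
  have "complex_of_real (X K) = of_nat (K\<^sup>2) * (V * quad_prod 0 (K - 2)) $ K"
  proof (rule triangular_coefficient[OF K1(1) U])
    show "(\<Sum>k | k \<in> {1..K} \<and> k mod 2 = K mod 2. of_real (X k) * beta_fps k $ n) =
        (V * beta_fps 0) $ n" if "n \<le> K" for n
    proof -
      have "(V * beta_fps 0) $ n =
          of_real (pi ^ n / fact n + (if n = 0 then 1 else 0) - 2 / pi * beta n 0)"
        unfolding VU by (simp add: exp_pi_nth beta_fps_def)
      also have "pi ^ n / fact n + (if n = 0 then 1 else 0) - 2 / pi * beta n 0 =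
          (\<Sum>k | k \<in> {1..n} \<and> k mod 2 = 0. beta n k * X k)"
      proof (cases "n = 0")
        case False
        have "2 / pi * beta n 0 = pi ^ n / fact n * (2 / (real n + 1))"
          by (simp add: beta_0 mult.commute)
        then have "pi ^ n / fact n - 2 / pi * beta n 0 = pi ^ n / fact n * (1 - 2 / (real n + 1))"
          by (simp only: right_diff_distrib mult_1_right)
        also have "1 - 2 / (real n + 1) = (real n - 1) / (real n + 1)" by (simp add: field_simps)
        finally show ?thesis using assms(1)[of n] False by simp
      qed (simp add: beta_0)
      finally show ?thesis unfolding sum_beta_fps_nth[OF that] unfolding K1(2) ..
    qed
  qed (use K1 beta_fps_even in auto)
  also have "(V * quad_prod 0 (K - 2)) $ K = (t_coth_fps * quad_prod 0 (K - 2)) $ K"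
  proof -
    have "quad_prod 0 (K - 2) $ K = 0" using K by (intro quad_prod_nth_eq_0) (auto simp: le_mod_geq[symmetric])
    then show ?thesis by (simp add: V_def left_diff_distrib)
  qed
  finally have "X K = Re (of_nat (K\<^sup>2) * (t_coth_fps * quad_prod 0 (K - 2)) $ K)"
    by (metis Re_complex_of_real)
  also have "\<dots> = (real K)\<^sup>2 * Re ((t_coth_fps * quad_prod 0 (K - 2)) $ K)"
    by (simp flip: of_nat_power)
  finally show ?thesis unfolding A_num_even[OF K] .
qed

section \<open>The absorption probabilities\<close>

definition absorb_prob :: "nat \<Rightarrow> nat \<Rightarrow> real" where
  "absorb_prob n d = event_prob n (feas_zero n d)"

text \<open>The unknowns of the triangular systems. The 2 is the one in
  \<open>event_prob_feas_zero_add\<close>, and \<open>pi ^ k\<close> makes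
  \<open>fact n / pi ^ n\<close> a common prefactor of all terms.\<close>

definition basis_weight :: "nat \<Rightarrow> real" where
  "basis_weight k = 2 * enn2real (basis_const k) * pi ^ k"

lemma enn2real_angle_integral: "enn2real (angle_integral k p) = sin_moment k p / pi ^ p"
proof -
  have "sin_moment k p \<ge> 0" unfolding sin_moment_def
    by (intro integral_nonneg sin_moment_integrable) (simp add: sin_ge_zero)
  then show ?thesis unfolding angle_integral_eq sin_moment_def[symmetric] by simp
qed

lemma telescope_halves:
  fixes a b c :: real
  assumes "a + b = 2 * u" "b + c = 2 * v" shows "a - c = 2 * (u - v)"
  using assms by (simp add: algebra_simps)

lemma absorb_prob_step:
  assumes "d < n"
  shows "absorb_prob n d = fact n / pi ^ n * (beta n (Suc d) * basis_weight (Suc d)) + absorb_prob n (Suc (Suc d))"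
proof -
  let ?k = "Suc d"
  have "absorb_prob n d + absorb_prob n (Suc d) = 2 * event_prob n (feas_pos n ?k)"
    "absorb_prob n (Suc d) + absorb_prob n (Suc (Suc d)) = 2 * event_prob n (feas_pos n (Suc ?k))"
    unfolding absorb_prob_def using assms by (intro event_prob_feas_zero_add; simp)+
  then have "absorb_prob n d - absorb_prob n (Suc (Suc d)) =
      2 * (event_prob n (feas_pos n ?k) - event_prob n (feas_pos n (Suc ?k)))" by (rule telescope_halves)
  also have "\<dots> = 2 * (real (n choose ?k) * (enn2real (basis_const ?k) * (sin_moment ?k (n - ?k) / pi ^ (n - ?k))))"
    by (subst event_prob_feas_pos_step) (simp_all add: enn2real_angle_integral)
  also have "real (n choose ?k) = fact n / (fact ?k * fact (n - ?k))"
    using assms by (intro binomial_fact) simp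
  also have "2 * (fact n / (fact ?k * fact (n - ?k)) * (enn2real (basis_const ?k) * (sin_moment ?k (n - ?k) / pi ^ (n - ?k)))) =
      fact n / pi ^ n * (beta n ?k * basis_weight ?k)"
  proof -
    have "pi ^ n = pi ^ ?k * pi ^ (n - ?k)" using assms by (simp only: power_add[symmetric]) simp
    then show ?thesis using assms by (simp add: beta_def basis_weight_def mult_ac Suc_le_eq del: fact_Suc power_Suc)
  qed
  finally show ?thesis by linarith
qed

text \<open>The step is iterated in jumps of two until the dimension reaches \<open>n\<close>, from
  where on the probability is 0.\<close>

lemma absorb_prob_sum:
  "absorb_prob n d = fact n / pi ^ n * (\<Sum>k | k \<in> {Suc d..n} \<and> k mod 2 = Suc d mod 2. beta n k * basis_weight k)"
proof (induction "n - d" arbitrary: d rule: less_induct)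
  case less
  show ?case
  proof (cases "d < n")
    case False
    then have "{k. k \<in> {Suc d..n} \<and> k mod 2 = Suc d mod 2} = {}" by auto
    then show ?thesis using False unfolding absorb_prob_def by (simp only: event_prob_feas_zero_eq_0) simp
  next
    case True
    \<comment> \<open>Parity excludes \<open>d + 2\<close>, so after \<open>Suc d\<close> the
      indices are those of dimension \<open>d + 2\<close>.\<close>
    have "{k. k \<in> {Suc d..n} \<and> k mod 2 = Suc d mod 2} =
        insert (Suc d) {k. k \<in> {Suc (Suc (Suc d))..n} \<and> k mod 2 = Suc (Suc (Suc d)) mod 2}"
    proof (rule set_eqI)
      fix k
      have "k \<noteq> Suc (Suc d)" if "k mod 2 = Suc d mod 2" using that by (metis mod_Suc_eq_mod_add3 n_not_Suc_n numeral_2_eq_2 parity_cases mod2_Suc_Suc mod_Suc nat.distinct(1))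
      moreover have "Suc (Suc (Suc d)) mod 2 = Suc d mod 2" by simp
      ultimately show "k \<in> {k. k \<in> {Suc d..n} \<and> k mod 2 = Suc d mod 2} \<longleftrightarrow>
          k \<in> insert (Suc d) {k. k \<in> {Suc (Suc (Suc d))..n} \<and> k mod 2 = Suc (Suc (Suc d)) mod 2}"
        using True by (auto simp: le_Suc_eq)
    qed
    then have "(\<Sum>k | k \<in> {Suc d..n} \<and> k mod 2 = Suc d mod 2. beta n k * basis_weight k) =
        beta n (Suc d) * basis_weight (Suc d) +
        (\<Sum>k | k \<in> {Suc (Suc (Suc d))..n} \<and> k mod 2 = Suc (Suc (Suc d)) mod 2. beta n k * basis_weight k)"
      by (simp only:) (subst sum.insert, auto)
    then show ?thesis using absorb_prob_step[OF True] less.hyps[of "Suc (Suc d)"] True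
      by (simp add: distrib_left)
  qed
qed

lemma absorb_prob_0: "n \<ge> 1 \<Longrightarrow> absorb_prob n 0 = 1"
  unfolding absorb_prob_def by (rule event_prob_feas_zero_0)

lemma absorb_prob_1:
  assumes "n \<ge> 1" shows "absorb_prob n 1 = (real n - 1) / (real n + 1)"
proof -
  have G: "1 - event_prob n (feas_pos n 1) = enn2real (basis_const 0) * (pi / (real n + 1))" for n
    unfolding event_prob_feas_pos_1 enn2real_angle_integral sin_moment_0 by (simp add: add.commute)
  \<comment> \<open>The array without columns calibrates \<open>basis_const 0\<close>: for
    \<open>n = 0\<close> no combination is positive, so the left side of \<open>G\<close> is
    1.\<close>
  have "event_prob 0 (feas_pos 0 1) = 0"
    by (simp add: event_prob_def feas_pos_def comb_def)
  with G[of 0] have "enn2real (basis_const 0) * pi = 1" by simp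
  then have "1 - event_prob n (feas_pos n 1) = 1 / (real n + 1)" using G[of n] by (simp add: field_simps)
  moreover have "absorb_prob n 0 + absorb_prob n 1 = 2 * event_prob n (feas_pos n 1)"
    unfolding absorb_prob_def using event_prob_feas_zero_add[of 0 n] by simp
  ultimately have "absorb_prob n 1 = 1 - 2 / (real n + 1)" using absorb_prob_0[OF assms] by linarith
  then show ?thesis by (simp add: field_simps)
qed

text \<open>Dimension 0 involves only odd \<open>k\<close> and dimension 1 only even
  \<open>k\<close>, so the two known probabilities determine all weights.\<close>

lemma basis_weight_eq:
  assumes "k \<ge> 1"
  shows "basis_weight k = (real k)\<^sup>2 * A_num (k - 1) (- 1)"
proof (cases "odd k")
  case True
  show ?thesis
  proof (rule triangular_solution_odd[OF _ True])
    fix n :: nat assume n: "n \<ge> 1"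
    show "(\<Sum>k | k \<in> {1..n} \<and> k mod 2 = 1. beta n k * basis_weight k) = pi ^ n / fact n"
      using absorb_prob_sum[of n 0] absorb_prob_0[OF n] by (simp add: field_simps)
  qed
next
  case False
  show ?thesis
  proof (rule triangular_solution_even)
    fix n :: nat assume n: "n \<ge> 1"
    have "{k. k \<in> {1..n} \<and> k mod 2 = 0} = {k. k \<in> {Suc 1..n} \<and> k mod 2 = Suc 1 mod 2}"
      by (auto simp: Suc_le_eq)
    then have "absorb_prob n 1 = fact n / pi ^ n * (\<Sum>k | k \<in> {1..n} \<and> k mod 2 = 0. beta n k * basis_weight k)"
      using absorb_prob_sum[of n 1] by (simp only:)
    then show "(\<Sum>k | k \<in> {1..n} \<and> k mod 2 = 0. beta n k * basis_weight k) =
        pi ^ n / fact n * ((real n - 1) / (real n + 1))"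
      unfolding absorb_prob_1[OF n] by simp
  qed (use False assms in auto)
qed

theorem absorb_prob_formula:
  "absorb_prob n d = fact n / pi ^ n *
     (\<Sum>m | m \<in> {d + 2..n + 1} \<and> m mod 2 = d mod 2. B_num (n + 1) m * (real m - 1)\<^sup>2 * A_num (m - 2) (- 1))"
proof -
  have "(\<Sum>m | m \<in> {d + 2..n + 1} \<and> m mod 2 = d mod 2. B_num (n + 1) m * (real m - 1)\<^sup>2 * A_num (m - 2) (- 1)) =
      (\<Sum>k | k \<in> {Suc d..n} \<and> k mod 2 = Suc d mod 2. beta n k * basis_weight k)"
  proof (rule sum.reindex_bij_witness[of _ Suc "\<lambda>m. m - 1"])
    fix m assume m: "m \<in> {m. m \<in> {d + 2..n + 1} \<and> m mod 2 = d mod 2}"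
    then obtain k where k: "m = Suc k" "k \<ge> Suc d" "k \<le> n" by (cases m) auto
    show "Suc (m - 1) = m" using k by simp
    show "m - 1 \<in> {k. k \<in> {Suc d..n} \<and> k mod 2 = Suc d mod 2}"
      using m k by (auto simp: mod_Suc split: if_splits)
    show "beta n (m - 1) * basis_weight (m - 1) = B_num (n + 1) m * (real m - 1)\<^sup>2 * A_num (m - 2) (- 1)"
      using k B_num_eq_beta[of k n] by (simp add: basis_weight_eq)
  next
    fix k assume k: "k \<in> {k. k \<in> {Suc d..n} \<and> k mod 2 = Suc d mod 2}"
    show "Suc k - 1 = k" by simp
    show "Suc k \<in> {m. m \<in> {d + 2..n + 1} \<and> m mod 2 = d mod 2}"
      using k by (auto simp: mod_Suc split: if_splits)
  qed
  then show ?thesis using absorb_prob_sum[of n d] by simp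
qed

section \<open>Uniform directions on the half-sphere\<close>

text \<open>\<open>b\<close> numbers the axes of the index type; for the half-sphere its axis
  \<open>i0\<close> receives number 0, where the heights are.\<close>

definition vec_of :: "('i::finite \<Rightarrow> nat) \<Rightarrow> nat \<Rightarrow> (nat \<times> nat \<Rightarrow> real) \<Rightarrow> real ^ 'i" where
  "vec_of b i g = (\<chi> \<iota>. g (i, b \<iota>))"

lemma borel_measurable_vec_of:
  assumes "\<And>a. sets (M a) = sets (borel :: real measure)"
  shows "vec_of b i \<in> borel_measurable (PiM A M)"
proof -
  note [measurable] = measurable_coordinate[OF assms]
  have "(\<lambda>g. \<Sum>\<iota>\<in>UNIV. g (i, b \<iota>) *\<^sub>R axis \<iota> (1::real)) \<in> borel_measurable (PiM A M)"
    by (intro borel_measurable_sum borel_measurable_scaleR measurable_coordinate assms borel_measurable_const)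
  moreover have "vec_of b i = (\<lambda>g. \<Sum>\<iota>\<in>UNIV. g (i, b \<iota>) *\<^sub>R axis \<iota> (1::real))"
    by (auto simp: fun_eq_iff vec_eq_iff vec_of_def axis_def if_distrib cong: if_cong)
  ultimately show ?thesis by simp
qed

lemma distr_lebesgue_prod_vec_of:
  fixes b :: "'i::finite \<Rightarrow> nat"
  assumes b: "bij_betw b UNIV {0..d}"
  shows "distr (lebesgue_prod ({i} \<times> {0..d})) borel (vec_of b i) = lborel"
proof (rule lborel_eqI[symmetric])
  note [measurable] = borel_measurable_vec_of[of "\<lambda>_. lborel"]
  let ?A = "{i} \<times> {0..d}"
  have bA: "bij_betw (\<lambda>\<iota>. (i, b \<iota>)) UNIV ?A"
    using b unfolding bij_betw_def by (auto simp: inj_on_def)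
  fix l u :: "real ^ 'i" assume "\<And>b. b \<in> Basis \<Longrightarrow> l \<bullet> b \<le> u \<bullet> b"
  then have lu: "l $ \<iota> \<le> u $ \<iota>" for \<iota>
    by (auto simp: Basis_vec_def cart_eq_inner_axis)
  let ?l = "\<lambda>a. l $ the_inv_into UNIV b (snd a)" and ?u = "\<lambda>a. u $ the_inv_into UNIV b (snd a)"
  have inv: "the_inv_into UNIV b (b \<iota>) = \<iota>" for \<iota>
    using b by (auto simp: bij_betw_def the_inv_into_f_f)
  have "vec_of b i -` box l u \<inter> space (lebesgue_prod ?A) = PiE ?A (\<lambda>a. {?l a<..<?u a})"
  proof -
    have "(\<forall>\<iota>. l $ \<iota> < g (i, b \<iota>) \<and> g (i, b \<iota>) < u $ \<iota>) \<longleftrightarrow> (\<forall>a\<in>?A. ?l a < g a \<and> g a < ?u a)" for g :: "nat \<times> nat \<Rightarrow> real"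
      unfolding bij_betw_imp_surj_on[OF bA, symmetric] by (simp add: inv)
    then show ?thesis
      by (auto simp: space_PiM PiE_def Pi_def mem_box_cart vec_of_def)
  qed
  then have "emeasure (distr (lebesgue_prod ?A) borel (vec_of b i)) (box l u) =
      (\<Prod>a\<in>?A. emeasure lborel {?l a<..<?u a})"
    by (subst emeasure_distr) (simp_all add: lborels.emeasure_PiM)
  also have "\<dots> = (\<Prod>\<iota>\<in>UNIV. ennreal (u $ \<iota> - l $ \<iota>))"
    by (subst prod.reindex_bij_betw[OF bA, symmetric]) (simp add: inv lu)
  also have "\<dots> = ennreal (\<Prod>\<iota>\<in>UNIV. u $ \<iota> - l $ \<iota>)"
    by (rule prod_ennreal) (simp add: lu)
  also have "(\<Prod>\<iota>\<in>UNIV. u $ \<iota> - l $ \<iota>) = (\<Prod>e\<in>Basis. (u - l) \<bullet> e)"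
  proof -
    have "(Basis :: (real ^ 'i) set) = (\<lambda>\<iota>. axis \<iota> 1) ` UNIV" by (auto simp: Basis_vec_def)
    then have "(\<Prod>e\<in>Basis. (u - l) \<bullet> e) = (\<Prod>e\<in>(\<lambda>\<iota>. axis \<iota> 1) ` UNIV. (u - l) \<bullet> e)" by (simp only:)
    also have "\<dots> = (\<Prod>\<iota>\<in>UNIV. u $ \<iota> - l $ \<iota>)"
      by (subst prod.reindex) (simp_all add: inj_on_def axis_eq_axis cart_eq_inner_axis inner_diff_left)
    finally show ?thesis by simp
  qed
  finally show "emeasure (distr (lebesgue_prod ?A) borel (vec_of b i)) (box l u) = ennreal (\<Prod>e\<in>Basis. (u - l) \<bullet> e)" .
qed simp

lemma nn_integral_exp_tail:
  fixes s :: real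
  assumes "s \<ge> 0"
  shows "(\<integral>\<^sup>+r. ennreal (r * exp (- r\<^sup>2 / 2)) * indicator {s..} r \<partial>lborel) = ennreal (exp (- s\<^sup>2 / 2))"
proof -
  have "(\<integral>\<^sup>+r. ennreal (r * exp (- r\<^sup>2 / 2)) * indicator {s..} r \<partial>lborel) = ennreal (0 - (- exp (- s\<^sup>2 / 2)))"
  proof (rule nn_integral_FTC_atLeast)
    show "((\<lambda>r::real. - exp (- r\<^sup>2 / 2)) \<longlongrightarrow> 0) at_top" by real_asymp
    show "((\<lambda>r. - exp (- r\<^sup>2 / 2)) has_real_derivative r * exp (- r\<^sup>2 / 2)) (at r)" for r :: real
      by (auto intro!: derivative_eq_intros)
  qed (use assms in auto)
  then show ?thesis by simp
qed

lemma emeasure_lborel_cone: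
  fixes K :: "'a::euclidean_space set"
  assumes K [measurable]: "K \<in> sets borel" and cone: "\<And>c x. c > 0 \<Longrightarrow> c *\<^sub>R x \<in> K \<longleftrightarrow> x \<in> K" and r: "r > 0"
  shows "emeasure lborel {x \<in> K. norm x \<le> r} = ennreal (r ^ DIM('a)) * emeasure lborel (K \<inter> cball 0 1)"
proof -
  have "emeasure lborel {x \<in> K. norm x \<le> r} = (\<integral>\<^sup>+x. indicator {x \<in> K. norm x \<le> r} x \<partial>(lborel :: 'a measure))"
    by simp
  also have "\<dots> = (\<integral>\<^sup>+x. ennreal (\<bar>r\<bar> ^ DIM('a)) * indicator {x \<in> K. norm x \<le> r} (r *\<^sub>R x) \<partial>(lborel :: 'a measure))"
    by (subst lborel_affine[of r 0]) (use r in \<open>simp_all add: nn_integral_density nn_integral_distr del: nn_integral_indicator\<close>)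
  also have "\<dots> = (\<integral>\<^sup>+x. ennreal (r ^ DIM('a)) * indicator (K \<inter> cball 0 1) x \<partial>(lborel :: 'a measure))"
    using r by (intro nn_integral_cong) (auto simp: indicator_def cone)
  also have "\<dots> = ennreal (r ^ DIM('a)) * emeasure lborel (K \<inter> cball 0 1)"
    by (rule nn_integral_cmult_indicator) measurable
  finally show ?thesis .
qed

text \<open>Layer-cake form of polar coordinates: \<open>exp (- |x|\<^sup>2 / 2)\<close> is a mixture of indicators of balls.\<close>

lemma nn_integral_gaussian_cone:
  fixes K :: "'a::euclidean_space set"
  assumes K [measurable]: "K \<in> sets borel" and cone: "\<And>c x. c > 0 \<Longrightarrow> c *\<^sub>R x \<in> K \<longleftrightarrow> x \<in> K"
  shows "(\<integral>\<^sup>+x. ennreal (exp (- (norm x)\<^sup>2 / 2)) * indicator K x \<partial>lborel) =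
    (\<integral>\<^sup>+r. ennreal (r * exp (- r\<^sup>2 / 2)) * ennreal (r ^ DIM('a)) \<partial>lborel) * emeasure lborel (K \<inter> cball 0 1)"
proof -
  have "(\<integral>\<^sup>+x. ennreal (exp (- (norm x)\<^sup>2 / 2)) * indicator K x \<partial>lborel) =
      (\<integral>\<^sup>+x. (\<integral>\<^sup>+r. ennreal (r * exp (- r\<^sup>2 / 2)) * indicator {x \<in> K. norm x \<le> r} x \<partial>lborel) \<partial>lborel)"
  proof (rule nn_integral_cong)
    fix x :: 'a
    have "ennreal (exp (- (norm x)\<^sup>2 / 2)) * indicator K x =
        (\<integral>\<^sup>+r. ennreal (r * exp (- r\<^sup>2 / 2)) * indicator {norm x..} r * indicator K x \<partial>lborel)"
      by (subst nn_integral_exp_tail[symmetric]) (auto intro!: nn_integral_multc[symmetric])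
    then show "ennreal (exp (- (norm x)\<^sup>2 / 2)) * indicator K x =
        (\<integral>\<^sup>+r. ennreal (r * exp (- r\<^sup>2 / 2)) * indicator {x \<in> K. norm x \<le> r} x \<partial>lborel)"
      by (auto simp: indicator_def intro!: nn_integral_cong elim!: back_subst[of "\<lambda>y. _ = y"])
  qed
  also have "\<dots> = (\<integral>\<^sup>+r. (\<integral>\<^sup>+x. ennreal (r * exp (- r\<^sup>2 / 2)) * indicator {x \<in> K. norm x \<le> r} x \<partial>lborel) \<partial>lborel)"
  proof (rule lborel_pair.Fubini')
    have *: "(\<lambda>(r, x). ennreal (r * exp (- r\<^sup>2 / 2)) * indicator {x \<in> K. norm x \<le> r} x) =
        (\<lambda>z. ennreal (fst z * exp (- (fst z)\<^sup>2 / 2)) * (indicator K (snd z) * (if norm (snd z) \<le> fst z then 1 else 0)))"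
      by (auto simp: fun_eq_iff indicator_def)
    show "case_prod (\<lambda>r x. ennreal (r * exp (- r\<^sup>2 / 2)) * indicator {x \<in> K. norm x \<le> r} x) \<in>
        borel_measurable (lborel \<Otimes>\<^sub>M lborel)"
      unfolding * by measurable
  qed
  also have "\<dots> = (\<integral>\<^sup>+r. ennreal (r * exp (- r\<^sup>2 / 2)) * ennreal (r ^ DIM('a)) * emeasure lborel (K \<inter> cball 0 1) \<partial>lborel)"
  proof (rule nn_integral_cong)
    fix r :: real
    have "(\<integral>\<^sup>+x. ennreal (r * exp (- r\<^sup>2 / 2)) * indicator {x \<in> K. norm x \<le> r} x \<partial>lborel) =
        ennreal (r * exp (- r\<^sup>2 / 2)) * emeasure lborel {x \<in> K. norm x \<le> r}"
      by (rule nn_integral_cmult_indicator) measurable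
    also have "\<dots> = ennreal (r * exp (- r\<^sup>2 / 2)) * ennreal (r ^ DIM('a)) * emeasure lborel (K \<inter> cball 0 1)"
    proof (cases "r > 0")
      case True
      then show ?thesis by (simp add: emeasure_lborel_cone[OF K cone] mult.assoc)
    next
      case False
      then have "ennreal (r * exp (- r\<^sup>2 / 2)) = 0" by (intro ennreal_neg) (simp add: mult_nonpos_nonneg)
      then show ?thesis by simp
    qed
    finally show "(\<integral>\<^sup>+x. ennreal (r * exp (- r\<^sup>2 / 2)) * indicator {x \<in> K. norm x \<le> r} x \<partial>lborel) =
        ennreal (r * exp (- r\<^sup>2 / 2)) * ennreal (r ^ DIM('a)) * emeasure lborel (K \<inter> cball 0 1)" .
  qed
  also have "\<dots> = (\<integral>\<^sup>+r. ennreal (r * exp (- r\<^sup>2 / 2)) * ennreal (r ^ DIM('a)) \<partial>lborel) * emeasure lborel (K \<inter> cball 0 1)"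
    by (rule nn_integral_multc) measurable
  finally show ?thesis .
qed

lemma sets_half_sphere [measurable, simp]: "half_sphere i0 \<in> sets borel"
proof -
  have "closed (half_sphere i0)" unfolding half_sphere_def
    by (intro closed_Collect_conj closed_Collect_le closed_Collect_eq continuous_intros)
  then show ?thesis by simp
qed

lemma borel_measurable_sgn: "(sgn :: 'a::euclidean_space \<Rightarrow> 'a) \<in> borel_measurable borel"
  unfolding sgn_div_norm by measurable

lemma emeasure_sphere_measure:
  assumes "A \<in> sets borel"
  shows "emeasure (sphere_measure :: 'a::euclidean_space measure) A =
           of_nat DIM('a) * emeasure lborel {x \<in> cball 0 1. sgn x \<in> A}"
proof -
  have m: "(sgn :: 'a \<Rightarrow> 'a) \<in> measurable (restrict_space lborel (cball 0 1)) borel"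
    by (rule measurable_restrict_space1) (simp add: borel_measurable_sgn)
  have eq: "sgn -` A \<inter> space (restrict_space lborel (cball 0 1)) = {x \<in> cball 0 1. sgn x \<in> A}"
    by (auto simp: space_restrict_space)
  show ?thesis
    unfolding sphere_measure_def emeasure_scale_measure emeasure_distr[OF m assms] eq
    by (subst emeasure_restrict_space) auto
qed

lemma space_sphere_measure [simp]: "space sphere_measure = UNIV"
  using sets_eq_imp_space_eq[OF sets_sphere_measure] by simp

lemma finite_measure_sphere_measure: "finite_measure (sphere_measure :: 'a::euclidean_space measure)"
proof (rule finite_measureI)
  have "emeasure lborel {x \<in> cball (0::'a) 1. sgn x \<in> UNIV} < \<infinity>"
    using emeasure_lborel_cball_finite[of "0::'a" 1] by (simp add: cball_def)
  then show "emeasure (sphere_measure :: 'a measure) (space sphere_measure) \<noteq> \<infinity>"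
    by (subst emeasure_sphere_measure) (auto simp: ennreal_mult_eq_top_iff)
qed

lemma AE_component_nonzero: "AE x in lborel. (x :: real ^ 'i::finite) $ i \<noteq> 0"
proof -
  have "negligible {x :: real ^ 'i. x $ i = 0}" by (rule negligible_standard_hyperplane_cart)
  then have "{x :: real ^ 'i. x $ i = 0} \<in> null_sets lborel"
    by (simp add: negligible_iff_null_sets null_sets_completion_iff)
  then show ?thesis by (auto simp: eventually_ae_filter intro!: bexI[of _ "{x :: real ^ 'i. x $ i = 0}"])
qed

lemma sgn_in_half_sphere_iff: "sgn x \<in> half_sphere i0 \<longleftrightarrow> x \<noteq> 0 \<and> x $ i0 \<ge> 0"
  by (auto simp: half_sphere_def norm_sgn sgn_div_norm zero_le_mult_iff)

text \<open>The antipodal map preserves volume and exchanges two half-balls that overlap only in a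
  hyperplane.\<close>

lemma measure_half_sphere:
  fixes i0 :: "'i::finite"
  shows "measure sphere_measure (half_sphere i0) = measure sphere_measure (sphere (0 :: real ^ 'i) 1) / 2"
proof -
  let ?H = "{x \<in> cball (0 :: real ^ 'i) 1. sgn x \<in> half_sphere i0}"
  let ?H' = "{x \<in> cball (0 :: real ^ 'i) 1. - sgn x \<in> half_sphere i0}"
  note [measurable] = borel_measurable_sgn
  have HB [measurable]: "?H \<in> sets borel" "?H' \<in> sets borel" by measurable
  have "emeasure lborel ?H = (\<integral>\<^sup>+x. indicator ?H x \<partial>(lborel :: (real ^ 'i) measure))" by simp
  also have "\<dots> = (\<integral>\<^sup>+x. indicator ?H' x \<partial>(lborel :: (real ^ 'i) measure))"
    by (subst lborel_affine[of "- 1" 0])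
      (simp_all add: nn_integral_density nn_integral_distr indicator_def[abs_def] sgn_minus del: nn_integral_indicator)
  finally have sym: "emeasure lborel ?H = emeasure lborel ?H'" by simp
  have "emeasure lborel {x \<in> cball (0 :: real ^ 'i) 1. sgn x \<in> sphere 0 1} = (\<integral>\<^sup>+x. indicator ?H x + indicator ?H' x \<partial>lborel)"
  proof -
    have "emeasure lborel {x \<in> cball (0 :: real ^ 'i) 1. sgn x \<in> sphere 0 1} =
        (\<integral>\<^sup>+x. indicator {x \<in> cball 0 1. sgn x \<in> sphere 0 1} x \<partial>(lborel :: (real ^ 'i) measure))"
      by (subst nn_integral_indicator) auto
    also have "\<dots> = (\<integral>\<^sup>+x. indicator ?H x + indicator ?H' x \<partial>lborel)"
    proof (rule nn_integral_cong_AE)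
      show "AE x in lborel. indicator {x \<in> cball (0 :: real ^ 'i) 1. sgn x \<in> sphere 0 1} x =
          (indicator ?H x + indicator ?H' x :: ennreal)"
        using AE_component_nonzero[of i0]
      proof eventually_elim
        case (elim x)
        then have "x \<noteq> 0" by auto
        moreover have "- sgn x \<in> half_sphere i0 \<longleftrightarrow> x $ i0 < 0"
          using sgn_in_half_sphere_iff[of "- x" i0] elim \<open>x \<noteq> 0\<close> by (auto simp: sgn_minus)
        ultimately show ?case using elim
          by (auto simp: indicator_def sgn_in_half_sphere_iff norm_sgn)
      qed
    qed
    finally show ?thesis .
  qed
  also have "\<dots> = 2 * emeasure lborel ?H"
    by (subst nn_integral_add) (use sym in \<open>simp_all add: mult_2\<close>)
  finally have "emeasure sphere_measure (sphere (0 :: real ^ 'i) 1) = 2 * emeasure sphere_measure (half_sphere i0)"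
    by (simp add: emeasure_sphere_measure mult.left_commute)
  then show ?thesis by (simp add: measure_def enn2real_mult)
qed

lemma prod_coord_density:
  fixes x :: "real ^ 'i::finite"
  assumes "inj b" "b i0 = 0"
  shows "(\<Prod>\<iota>\<in>UNIV. coord_density (i, b \<iota>) (x $ \<iota>)) =
    2 * (1 / sqrt (2 * pi)) ^ CARD('i) * (exp (- (norm x)\<^sup>2 / 2) * indicator {0<..} (x $ i0))"
proof -
  have b0: "b \<iota> = 0 \<longleftrightarrow> \<iota> = i0" for \<iota> using assms by (auto simp: inj_eq simp flip: assms(2))
  have "(\<Prod>\<iota>\<in>UNIV. coord_density (i, b \<iota>) (x $ \<iota>)) =
      (\<Prod>\<iota>\<in>UNIV. std_normal_density (x $ \<iota>) * (if \<iota> = i0 then 2 * indicator {0<..} (x $ \<iota>) else 1))"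
    by (intro prod.cong) (auto simp: coord_density_def b0)
  also have "\<dots> = (\<Prod>\<iota>\<in>UNIV. std_normal_density (x $ \<iota>)) * (2 * indicator {0<..} (x $ i0))"
    by (simp add: prod.distrib)
  also have "(\<Prod>\<iota>\<in>UNIV. std_normal_density (x $ \<iota>)) = (1 / sqrt (2 * pi)) ^ CARD('i) * exp (\<Sum>\<iota>\<in>UNIV. - (x $ \<iota>)\<^sup>2 / 2)"
    by (simp add: std_normal_density_def prod.distrib exp_sum prod_dividef power_one_over)
  also have "(\<Sum>\<iota>\<in>UNIV. - (x $ \<iota>)\<^sup>2 / 2) = - (norm x)\<^sup>2 / 2"
    by (simp add: norm_vec_def L2_set_def sum_nonneg sum_negf flip: sum_divide_distrib)
  finally show ?thesis by (simp only: mult_ac)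
qed

text \<open>A condition on the direction describes a cone, and on cones the Gaussian integral is a
  fixed multiple of the volume inside the unit ball (\<open>nn_integral_gaussian_cone\<close>). The
  multiple is determined by total mass 1.\<close>

lemma distr_sgn_vec_of:
  fixes b :: "'i::finite \<Rightarrow> nat"
  assumes b: "bij_betw b UNIV {0..d}" "b i0 = 0"
  shows "distr (PiM ({i} \<times> {0..d}) coord) borel (\<lambda>g. sgn (vec_of b i g)) = uniform_measure sphere_measure (half_sphere i0)"
proof -
  let ?A = "{i} \<times> {0..d}"
  let ?D = "distr (PiM ?A coord) borel (\<lambda>g. sgn (vec_of b i g))"
  let ?c = "2 * (1 / sqrt (2 * pi)) ^ CARD('i)"
  note [measurable] = borel_measurable_sgn
  have [measurable]: "(\<lambda>g. sgn (vec_of b i g)) \<in> borel_measurable (PiM A coord)" for A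
    using measurable_comp[OF borel_measurable_vec_of[of coord b i A] borel_measurable_sgn] by (simp add: comp_def)
  have [measurable]: "vec_of b i \<in> borel_measurable (lebesgue_prod A)" for A
    using borel_measurable_vec_of[of "\<lambda>_. lborel" b i A] by simp
  have bA: "bij_betw (\<lambda>\<iota>. (i, b \<iota>)) UNIV ?A"
    using b(1) unfolding bij_betw_def by (auto simp: inj_on_def)
  define C where "C = (\<integral>\<^sup>+r. ennreal (r * exp (- r\<^sup>2 / 2)) * ennreal (r ^ DIM(real ^ 'i)) \<partial>lborel)"
  define k where "k = ennreal ?c * C / of_nat DIM(real ^ 'i)"
  have k: "k * of_nat DIM(real ^ 'i) = ennreal ?c * C"
    unfolding k_def by (subst ennreal_divide_times) (simp add: of_nat_less_top)
  have D: "emeasure ?D B = k * emeasure sphere_measure (half_sphere i0 \<inter> B)" if B [measurable]: "B \<in> sets borel" for B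
  proof -
    define K where "K = {x :: real ^ 'i. x $ i0 > 0 \<and> sgn x \<in> B}"
    have K [measurable]: "K \<in> sets borel" unfolding K_def by measurable
    have "emeasure ?D B = (\<integral>\<^sup>+g. indicator B (sgn (vec_of b i g)) \<partial>PiM ?A coord)"
      by (subst nn_integral_indicator[symmetric]) (simp_all add: nn_integral_distr del: nn_integral_indicator)
    also have "\<dots> = (\<integral>\<^sup>+g. (\<Prod>a\<in>?A. ennreal (coord_density a (g a))) * indicator B (sgn (vec_of b i g)) \<partial>lebesgue_prod ?A)"
      by (rule nn_integral_PiM_coord) auto
    also have "\<dots> = (\<integral>\<^sup>+g. ennreal ?c * (ennreal (exp (- (norm (vec_of b i g))\<^sup>2 / 2)) * indicator K (vec_of b i g)) \<partial>lebesgue_prod ?A)"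
    proof (rule nn_integral_cong)
      fix g :: "nat \<times> nat \<Rightarrow> real"
      have "(\<Prod>a\<in>?A. ennreal (coord_density a (g a))) = ennreal (\<Prod>\<iota>\<in>UNIV. coord_density (i, b \<iota>) (vec_of b i g $ \<iota>))"
        by (subst prod.reindex_bij_betw[OF bA, symmetric]) (simp add: prod_ennreal vec_of_def)
      also have "\<dots> = ennreal (?c * (exp (- (norm (vec_of b i g))\<^sup>2 / 2) * indicator {0<..} (vec_of b i g $ i0)))"
        using b by (subst prod_coord_density) (auto simp: bij_betw_def)
      finally show "(\<Prod>a\<in>?A. ennreal (coord_density a (g a))) * indicator B (sgn (vec_of b i g)) =
          ennreal ?c * (ennreal (exp (- (norm (vec_of b i g))\<^sup>2 / 2)) * indicator K (vec_of b i g))"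
        by (simp add: ennreal_mult K_def indicator_def)
    qed
    also have "\<dots> = (\<integral>\<^sup>+x. ennreal ?c * (ennreal (exp (- (norm x)\<^sup>2 / 2)) * indicator K x) \<partial>lborel)"
      by (subst distr_lebesgue_prod_vec_of[OF b(1), of i, symmetric]) (simp add: nn_integral_distr)
    also have "\<dots> = ennreal ?c * (C * emeasure lborel (K \<inter> cball 0 1))"
    proof (subst nn_integral_cmult)
      have "c *\<^sub>R x \<in> K \<longleftrightarrow> x \<in> K" if "c > 0" for c :: real and x
        using that by (simp add: K_def zero_less_mult_iff sgn_scaleR)
      then show "ennreal ?c * (\<integral>\<^sup>+x. ennreal (exp (- (norm x)\<^sup>2 / 2)) * indicator K x \<partial>lborel) =
          ennreal ?c * (C * emeasure lborel (K \<inter> cball 0 1))"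
        unfolding C_def by (subst nn_integral_gaussian_cone[OF K]) auto
    qed measurable
    \<comment> \<open>\<open>K\<close> omits the equator, which \<open>half_sphere\<close> contains;
      the difference is a null set.\<close>
    also have "emeasure lborel (K \<inter> cball 0 1) = emeasure lborel {x \<in> cball 0 1. sgn x \<in> half_sphere i0 \<inter> B}"
    proof (rule emeasure_eq_AE)
      show "AE x in lborel. x \<in> K \<inter> cball 0 1 \<longleftrightarrow> x \<in> {x \<in> cball 0 1. sgn x \<in> half_sphere i0 \<inter> B}"
        using AE_component_nonzero[of i0]
        by eventually_elim (auto simp: K_def sgn_in_half_sphere_iff less_le)
    qed (measurable, auto)
    also have "ennreal ?c * (C * emeasure lborel {x \<in> cball 0 1. sgn x \<in> half_sphere i0 \<inter> B}) =
        k * emeasure sphere_measure (half_sphere i0 \<inter> B)"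
    proof (subst emeasure_sphere_measure)
      show "half_sphere i0 \<inter> B \<in> sets borel" by simp
      show "ennreal ?c * (C * e) = k * (of_nat DIM(real ^ 'i) * e)" for e
        unfolding mult.assoc[symmetric] k ..
    qed
    finally show ?thesis .
  qed
  interpret prob_space ?D by (intro prob_space.prob_space_distr prob_space_PiM_coord) measurable
  let ?s = "emeasure sphere_measure (half_sphere i0)"
  have 1: "k * ?s = 1" using D[of UNIV] emeasure_space_1 by simp
  have s: "?s \<noteq> 0" "?s \<noteq> \<infinity>"
    using 1 finite_measure.emeasure_finite[OF finite_measure_sphere_measure] by auto
  show ?thesis
  proof (rule measure_eqI)
    fix B assume "B \<in> sets ?D"
    then have B: "B \<in> sets borel" by simp
    have "emeasure (uniform_measure sphere_measure (half_sphere i0)) B = k * ?s * emeasure sphere_measure (half_sphere i0 \<inter> B) / ?s"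
      using B 1 by simp
    also have "\<dots> = k * emeasure sphere_measure (half_sphere i0 \<inter> B)"
      using ennreal_mult_divide_eq[OF s(1), of "k * emeasure sphere_measure (half_sphere i0 \<inter> B)"] s(2)
      by (simp only: infinity_ennreal_def mult_ac) simp
    finally show "emeasure ?D B = emeasure (uniform_measure sphere_measure (half_sphere i0)) B"
      unfolding D[OF B] by (rule sym)
  qed simp
qed

section \<open>Random cones\<close>

abbreviation uniform_half :: "'i::finite \<Rightarrow> (real ^ 'i) measure" where
  "uniform_half i0 \<equiv> uniform_measure sphere_measure (half_sphere i0)"

lemma sphere_measure_half_sphere:
  "emeasure sphere_measure (half_sphere i0) \<noteq> 0" "emeasure sphere_measure (half_sphere i0) \<noteq> \<infinity>"
proof -
  have "measure sphere_measure (half_sphere i0) > 0"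
    unfolding measure_half_sphere measure_sphere_measure_sphere omega_def
    by (simp add: Gamma_real_pos zero_less_divide_iff)
  then show "emeasure sphere_measure (half_sphere i0) \<noteq> 0" by (auto simp: measure_def)
  show "emeasure sphere_measure (half_sphere i0) \<noteq> \<infinity>"
    using finite_measure.emeasure_finite[OF finite_measure_sphere_measure] by simp
qed

lemma prob_space_uniform_half: "prob_space (uniform_half i0)"
  by (intro prob_space_uniform_measure sphere_measure_half_sphere)

text \<open>Distinct vectors occupy disjoint blocks of the array, hence the independence. Only the
  coordinates up to \<open>d\<close> are read, so one array serves several dimensions.\<close>

lemma distr_directions:
  fixes b :: "'i::finite \<Rightarrow> nat"
  assumes b: "bij_betw b UNIV {0..d}" "b i0 = 0" and d: "d \<le> m"
  shows "distr (PiM ({0..n} \<times> {0..m}) coord) (PiM {0..n} (\<lambda>_. borel)) (\<lambda>g. \<lambda>i\<in>{0..n}. sgn (vec_of b i g)) =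
    PiM {0..n} (\<lambda>_. uniform_half i0)"
proof -
  let ?A = "{0..n} \<times> {0..m}" and ?K = "\<lambda>i. {i} \<times> {0..d}"
  interpret prob_space "PiM ?A coord" by (rule prob_space_PiM_coord)
  have sgn_vec: "(\<lambda>g. sgn (vec_of b i g)) \<in> borel_measurable (PiM A M)"
    if "\<And>a. sets (M a) = sets (borel :: real measure)" for A i and M :: "nat \<times> nat \<Rightarrow> real measure"
    using measurable_comp[OF borel_measurable_vec_of[OF that] borel_measurable_sgn] by (simp add: comp_def)
  have "b \<iota> \<le> d" for \<iota> using bij_betw_apply[OF b(1), of \<iota>] by simp
  then have restrict: "vec_of b i (restrict g (?K i)) = vec_of b i g" for i g
    by (simp add: vec_of_def)
  have K: "?K i \<noteq> {}" "?K i \<subseteq> ?A" if "i \<in> {0..n}" for i using that d by auto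
  have "indep_vars (\<lambda>i. PiM (?K i) (\<lambda>_. borel)) (\<lambda>i g. restrict (\<lambda>a. g a) (?K i)) {0..n}"
    by (rule indep_vars_restrict[OF indep_vars_coordinates]) (use d in \<open>auto simp: disjoint_family_on_def\<close>)
  then have "indep_vars (\<lambda>_. borel) (\<lambda>i g. sgn (vec_of b i (restrict (\<lambda>a. g a) (?K i)))) {0..n}"
    by (rule indep_vars_compose2[where Y = "\<lambda>i g. sgn (vec_of b i g)"]) (intro sgn_vec, simp)
  then have "indep_vars (\<lambda>_. borel) (\<lambda>i g. sgn (vec_of b i g)) {0..n}" by (simp only: restrict)
  then have "distr (PiM ?A coord) (PiM {0..n} (\<lambda>_. borel)) (\<lambda>g. \<lambda>i\<in>{0..n}. sgn (vec_of b i g)) =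
      PiM {0..n} (\<lambda>i. distr (PiM ?A coord) borel (\<lambda>g. sgn (vec_of b i g)))"
    by (subst indep_vars_iff_distr_eq_PiM'[symmetric]) (auto intro: sgn_vec)
  also have "\<dots> = PiM {0..n} (\<lambda>_. uniform_half i0)"
  proof (rule PiM_cong[OF refl])
    fix i assume i: "i \<in> {0..n}"
    have "uniform_half i0 = distr (PiM (?K i) coord) borel (\<lambda>g. sgn (vec_of b i g))"
      by (rule distr_sgn_vec_of[OF b, symmetric])
    also have "PiM (?K i) coord = distr (PiM ?A coord) (PiM (?K i) coord) (\<lambda>g. restrict g (?K i))"
      using K[OF i] by (intro coords.distr_restrict) auto
    also have "distr \<dots> borel (\<lambda>g. sgn (vec_of b i g)) = distr (PiM ?A coord) borel (\<lambda>g. sgn (vec_of b i g))"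
      by (subst distr_distr) (use K[OF i] restrict in \<open>auto intro!: sgn_vec measurable_restrict_subset simp: comp_def\<close>)
    finally show "distr (PiM ?A coord) borel (\<lambda>g. sgn (vec_of b i g)) = uniform_half i0" ..
  qed
  finally show ?thesis .
qed

section \<open>Membership in cones spanned by random points\<close>

lemma borel_pos_span:
  "{p. snd p \<in> pos_span n (fst p)} \<in> sets (borel :: ((nat \<Rightarrow> 'a::euclidean_space) \<times> 'a) measure)"
proof (rule borel_parametric_Collect)
  let ?P = "\<lambda>N l (p :: (nat \<Rightarrow> 'a) \<times> 'a). (\<forall>i\<in>{1..n}. l i \<ge> 0) \<and> snd p = (\<Sum>i=1..n. l i *\<^sub>R fst p i)"
  have "continuous_on (UNIV :: ((nat \<Rightarrow> real) \<times> ((nat \<Rightarrow> 'a) \<times> 'a)) set) (\<lambda>q. fst (snd q) i)" for i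
    by (rule continuous_on_compose2[OF continuous_on_fst_coordinate[of UNIV] continuous_on_snd[OF continuous_on_id]]) simp
  then show "closed {q. ?P N (fst q) (snd q)}" for N :: nat
    by (intro closed_Collect_conj closed_Collect_ball closed_Collect_le closed_Collect_eq
        continuous_on_sum continuous_on_scaleR continuous_on_fst_coordinate continuous_intros)
  show "snd p \<in> pos_span n (fst p) \<longleftrightarrow> (\<exists>N l. (\<forall>i. \<bar>l i\<bar> \<le> real N) \<and> ?P N l p)" for p :: "(nat \<Rightarrow> 'a) \<times> 'a"
  proof
    assume "snd p \<in> pos_span n (fst p)"
    then obtain l where l: "\<forall>i\<in>{1..n}. l i \<ge> 0" "snd p = (\<Sum>i=1..n. l i *\<^sub>R fst p i)"
      unfolding pos_span_def by blast
    obtain N where N: "\<forall>i\<in>{1..n}. \<bar>l i\<bar> \<le> real N" using exists_parameter_bound[of "{1..n}" 1 l] by auto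
    define y where "y = (\<lambda>i. if i \<in> {1..n} then l i else 0)"
    have "\<forall>i. \<bar>y i\<bar> \<le> real N" unfolding y_def by (rule truncated_parameter) (use N in blast)
    then show "\<exists>N l. (\<forall>i. \<bar>l i\<bar> \<le> real N) \<and> ?P N l p"
      using l by (intro exI[of _ N] exI[of _ y]) (auto simp: y_def)
  next
    assume "\<exists>N l. (\<forall>i. \<bar>l i\<bar> \<le> real N) \<and> ?P N l p"
    then show "snd p \<in> pos_span n (fst p)" unfolding pos_span_def by blast
  qed
qed

lemma pos_span_cong: "(\<And>i. i \<in> {1..n} \<Longrightarrow> u i = v i) \<Longrightarrow> pos_span n u = pos_span n v"
  using sum.cong[of "{1..n}" "{1..n}" "\<lambda>i. l i *\<^sub>R u i" "\<lambda>i. l i *\<^sub>R v i" for l] unfolding pos_span_def by simp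

text \<open>Lengths do not influence membership in a cone, so directions may be replaced by the
  Gaussian vectors themselves.\<close>

lemma pos_span_scale:
  assumes c: "\<And>i. i \<in> {1..n} \<Longrightarrow> c i > 0" and a: "a > (0::real)"
  shows "a *\<^sub>R x \<in> pos_span n (\<lambda>i. c i *\<^sub>R u i) \<longleftrightarrow> x \<in> pos_span n u"
proof
  assume "a *\<^sub>R x \<in> pos_span n (\<lambda>i. c i *\<^sub>R u i)"
  then obtain l where l: "\<forall>i\<in>{1..n}. l i \<ge> 0" "a *\<^sub>R x = (\<Sum>i=1..n. l i *\<^sub>R c i *\<^sub>R u i)"
    unfolding pos_span_def by blast
  have "x = (1 / a) *\<^sub>R a *\<^sub>R x" using a by simp
  also have "\<dots> = (\<Sum>i=1..n. (l i * c i / a) *\<^sub>R u i)" unfolding l by (simp add: scaleR_sum_right)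
  finally show "x \<in> pos_span n u" unfolding pos_span_def using l c a
    by (intro CollectI exI[of _ "\<lambda>i. l i * c i / a"]) (simp add: less_imp_le[OF c])
next
  assume "x \<in> pos_span n u"
  then obtain l where l: "\<forall>i\<in>{1..n}. l i \<ge> 0" "x = (\<Sum>i=1..n. l i *\<^sub>R u i)"
    unfolding pos_span_def by blast
  have "a *\<^sub>R x = (\<Sum>i=1..n. (a * l i / c i) *\<^sub>R c i *\<^sub>R u i)"
    unfolding l scaleR_sum_right by (intro sum.cong refl) (use c in \<open>force\<close>)
  then show "a *\<^sub>R x \<in> pos_span n (\<lambda>i. c i *\<^sub>R u i)" unfolding pos_span_def using l c a
    by (intro CollectI exI[of _ "\<lambda>i. a * l i / c i"]) (simp add: less_imp_le[OF c])
qed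

text \<open>A combination equal to vector 0 has total height \<open>g (0, 0)\<close>, and the
  reductions then subtract exactly vector 0. Conversely, if a combination of reduced columns
  vanishes, the raw combination is \<open>t\<close> times vector 0, and positive heights make
  \<open>t\<close> positive.\<close>

lemma vec_of_in_pos_span_iff:
  fixes b :: "'i::finite \<Rightarrow> nat"
  assumes b: "range b = {0..d}" and g: "\<And>i. i \<le> n \<Longrightarrow> g (i, 0) > 0"
  shows "vec_of b 0 g \<in> pos_span n (\<lambda>i. vec_of b i g) \<longleftrightarrow> feas_zero n d (cols g)"
proof -
  have "vec_of b 0 g \<in> pos_span n (\<lambda>i. vec_of b i g) \<longleftrightarrow>
      (\<exists>l. (\<forall>i\<in>{1..n}. l i \<ge> 0) \<and> (\<forall>j\<in>range b. g (0, j) = (\<Sum>i=1..n. l i * g (i, j))))"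
    unfolding pos_span_def by (auto simp: vec_eq_iff vec_of_def)
  also have "\<dots> \<longleftrightarrow> (\<exists>l. (\<forall>i\<in>{1..n}. l i \<ge> 0) \<and> (\<forall>j\<in>{0..d}. g (0, j) = (\<Sum>i=1..n. l i * g (i, j))))"
    unfolding b ..
  also have "\<dots> \<longleftrightarrow> feas_zero n d (cols g)"
  proof
    assume "\<exists>l. (\<forall>i\<in>{1..n}. l i \<ge> 0) \<and> (\<forall>j\<in>{0..d}. g (0, j) = (\<Sum>i=1..n. l i * g (i, j)))"
    then obtain l where l: "\<forall>i\<in>{1..n}. l i \<ge> 0" "\<And>j. j \<in> {0..d} \<Longrightarrow> g (0, j) = (\<Sum>i=1..n. l i * g (i, j))" by blast
    have "comb n (cols g) l j = (\<Sum>i=1..n. l i * g (i, j)) - (\<Sum>i=1..n. l i * g (i, 0)) * (g (0, j) / g (0, 0))" for j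
      unfolding comb_def cols_def
      by (simp add: right_diff_distrib sum_subtractf sum_distrib_right sum_divide_distrib mult.assoc)
    then have "comb n (cols g) l j = 0" if "j \<in> {1..d}" for j
      using that l(2)[of j] l(2)[of 0] g[of 0] by simp
    moreover have "\<exists>i\<in>{1..n}. l i > 0"
    proof (rule ccontr)
      assume "\<not> ?thesis"
      then have "\<forall>i\<in>{1..n}. l i = 0" using l(1) by (auto simp: not_less intro: antisym)
      then show False using l(2)[of 0] g[of 0] by simp
    qed
    ultimately show "feas_zero n d (cols g)" using l(1) unfolding feas_zero_def by blast
  next
    assume "feas_zero n d (cols g)"
    then obtain x where x: "\<forall>i\<in>{1..n}. x i \<ge> 0" "\<exists>i\<in>{1..n}. x i > 0" "\<forall>j\<in>{1..d}. comb n (cols g) x j = 0"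
      unfolding feas_zero_def by blast
    define t where "t = (\<Sum>i=1..n. x i * g (i, 0)) / g (0, 0)"
    have "(\<Sum>i=1..n. x i * g (i, 0)) > 0"
    proof -
      obtain k where "k \<in> {1..n}" "x k > 0" using x(2) by blast
      then show ?thesis using x(1) by (intro sum_pos2[of _ k]) (simp_all add: less_imp_le[OF g] g)
    qed
    then have t: "t > 0" using g[of 0] by (simp add: t_def)
    have "(\<Sum>i=1..n. x i * g (i, j)) = t * g (0, j)" if j: "j \<in> {0..d}" for j
    proof (cases "j = 0")
      case True
      then show ?thesis using g[of 0] by (simp add: t_def)
    next
      case False
      then have "comb n (cols g) x j = 0" using x(3) j by simp
      moreover have "comb n (cols g) x j = (\<Sum>i=1..n. x i * g (i, j)) - t * g (0, j)"
        unfolding comb_def cols_def t_def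
        by (simp add: right_diff_distrib sum_subtractf sum_distrib_right sum_divide_distrib mult.assoc)
      ultimately show ?thesis by simp
    qed
    then have "g (0, j) = (\<Sum>i=1..n. x i / t * g (i, j))" if "j \<in> {0..d}" for j
      using that t by (simp add: sum_divide_distrib[symmetric])
    then show "\<exists>l. (\<forall>i\<in>{1..n}. l i \<ge> 0) \<and> (\<forall>j\<in>{0..d}. g (0, j) = (\<Sum>i=1..n. l i * g (i, j)))"
      using x(1) t by (intro exI[of _ "\<lambda>i. x i / t"]) auto
  qed
  finally show ?thesis .
qed

lemma AE_height_pos:
  assumes "finite A" "a \<in> A" "snd a = 0"
  shows "AE g in PiM A coord. g a > 0"
proof -
  have "AE x in coord a. x > 0"
    unfolding coord_def using assms(3) by (subst AE_density) (auto simp: coord_density_def indicator_def)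
  then have "AE x in distr (PiM A coord) borel (\<lambda>g. g a). x > 0"
    unfolding distr_coordinate[OF assms(1,2)] .
  then show ?thesis
    by (rule AE_distrD[rotated]) (rule measurable_coordinate, simp)
qed

lemma borel_measurable_indicator_pos_span:
  fixes u :: "nat \<Rightarrow> 'z \<Rightarrow> 'a::euclidean_space"
  assumes u: "\<And>i. i \<in> {1..n} \<Longrightarrow> u i \<in> borel_measurable N" and x: "x \<in> borel_measurable N"
  shows "(\<lambda>z. indicator (pos_span n (\<lambda>i. u i z)) (x z) :: ennreal) \<in> borel_measurable N"
proof -
  \<comment> \<open>Measurability into the function space is checked at every index, while
    \<open>u i\<close> is known to be measurable for \<open>i\<close> in
    \<open>{1..n}\<close>.\<close>
  define u' where "u' z i = (if i \<in> {1..n} then u i z else 0)" for z i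
  have "(\<lambda>z. u' z i) \<in> borel_measurable N" for i
    unfolding u'_def using u by (cases "i \<in> {1..n}") auto
  then have "u' \<in> borel_measurable N" by (rule measurable_coordinatewise_then_product)
  then have "(\<lambda>z. (u' z, x z)) \<in> borel_measurable N" using x by (rule borel_measurable_Pair)
  then have "(\<lambda>z. indicator {p. snd p \<in> pos_span n (fst p)} (u' z, x z) :: ennreal) \<in> borel_measurable N"
    by (rule measurable_compose[OF _ borel_measurable_indicator[OF borel_pos_span]])
  moreover have "pos_span n (u' z) = pos_span n (\<lambda>i. u i z)" for z
    by (rule pos_span_cong) (simp add: u'_def)
  ultimately show ?thesis by (simp add: indicator_def)
qed

lemma sets_pos_span: "pos_span n u \<in> sets borel" for u :: "nat \<Rightarrow> 'a::euclidean_space"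
proof -
  have "(\<lambda>x. indicator (pos_span n u) x :: ennreal) \<in> borel_measurable borel"
    by (rule borel_measurable_indicator_pos_span) auto
  then show ?thesis by (simp add: borel_measurable_indicator_iff)
qed

lemma emeasure_pos_span_eq_nn_integral:
  fixes u :: "nat \<Rightarrow> 'a::euclidean_space"
  assumes "sets N = sets borel" "B \<in> sets borel"
  shows "emeasure N (pos_span n u \<inter> B) = (\<integral>\<^sup>+x. indicator (pos_span n u) x * indicator B x \<partial>N)"
proof -
  have "pos_span n u \<inter> B \<in> sets N" unfolding assms(1) by (intro sets.Int sets_pos_span assms(2))
  then have "emeasure N (pos_span n u \<inter> B) = (\<integral>\<^sup>+x. indicator (pos_span n u \<inter> B) x \<partial>N)"
    by (rule nn_integral_indicator[symmetric])
  then show ?thesis by (simp only: indicator_inter_arith)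
qed

lemma measurable_emeasure_pos_span:
  fixes U :: "nat \<Rightarrow> 'w \<Rightarrow> 'a::euclidean_space"
  assumes U: "\<And>i. i \<in> {1..n} \<Longrightarrow> U i \<in> borel_measurable M"
    and N: "sigma_finite_measure N" "sets N = sets borel" and B: "B \<in> sets borel"
  shows "(\<lambda>w. emeasure N (pos_span n (\<lambda>i. U i w) \<inter> B)) \<in> borel_measurable M"
proof -
  interpret sigma_finite_measure N by (rule N(1))
  have U': "(\<lambda>z. U i (fst z)) \<in> borel_measurable (M \<Otimes>\<^sub>M N)" if "i \<in> {1..n}" for i
    by (rule measurable_compose[OF measurable_fst U[OF that]])
  have "snd \<in> measurable (M \<Otimes>\<^sub>M N) N" by (rule measurable_snd)
  then have snd: "snd \<in> borel_measurable (M \<Otimes>\<^sub>M N)" by (simp only: measurable_cong_sets[OF refl N(2)])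
  then have "(\<lambda>z. indicator (pos_span n (\<lambda>i. U i (fst z))) (snd z) * indicator B (snd z) :: ennreal) \<in>
      borel_measurable (M \<Otimes>\<^sub>M N)"
    by (intro borel_measurable_times_ennreal borel_measurable_indicator_pos_span U' snd
        measurable_compose[OF snd borel_measurable_indicator[OF B]])
  then have "(\<lambda>w. \<integral>\<^sup>+x. indicator (pos_span n (\<lambda>i. U i w)) x * indicator B x \<partial>N) \<in> borel_measurable M"
    by (intro borel_measurable_nn_integral) (simp add: case_prod_beta')
  then show ?thesis by (simp only: emeasure_pos_span_eq_nn_integral[OF N(2) B])
qed

text \<open>Index 0 of the product carries the additional point; independence identifies the joint
  law of \<open>U\<close> on \<open>{1..n}\<close> with a product measure.\<close>

lemma nn_integral_emeasure_pos_span: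
  fixes U :: "nat \<Rightarrow> 'w \<Rightarrow> 'a::euclidean_space"
  assumes M: "prob_space M" and indep: "prob_space.indep_vars M (\<lambda>_. borel) U {1..n}" and n: "n \<ge> 1"
    and \<mu>: "prob_space \<mu>" "sets \<mu> = sets borel" and U: "\<And>i. i \<in> {1..n} \<Longrightarrow> distr M borel (U i) = \<mu>"
  shows "(\<integral>\<^sup>+w. emeasure \<mu> (pos_span n (\<lambda>i. U i w)) \<partial>M) =
    (\<integral>\<^sup>+v. indicator (pos_span n v) (v 0) \<partial>PiM {0..n} (\<lambda>_. \<mu>))"
proof -
  interpret M: prob_space M by (rule M)
  interpret \<mu>: prob_space \<mu> by (rule \<mu>)
  interpret product_sigma_finite "\<lambda>_::nat. \<mu>" by unfold_locales
  have Ub: "U i \<in> borel_measurable M" if "i \<in> {1..n}" for i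
    using indep that by (auto simp: M.indep_vars_def)
  have coord: "(\<lambda>v. v i) \<in> borel_measurable (PiM A (\<lambda>_. \<mu>))" for i and A :: "nat set"
    by (rule measurable_coordinate) (rule \<mu>)
  let ?F = "\<lambda>v. emeasure \<mu> (pos_span n v)"
  have F: "?F \<in> borel_measurable (PiM {1..n} (\<lambda>_. \<mu>))"
    using measurable_emeasure_pos_span[of n "\<lambda>i v. v i", OF coord \<mu>.sigma_finite_measure_axioms \<mu>(2), of UNIV] by simp
  have law: "distr M (PiM {1..n} (\<lambda>_. borel)) (\<lambda>w. \<lambda>i\<in>{1..n}. U i w) = PiM {1..n} (\<lambda>_. \<mu>)"
  proof -
    have "{1..n} \<noteq> {}" using n by simp
    then have "distr M (PiM {1..n} (\<lambda>_. borel)) (\<lambda>w. \<lambda>i\<in>{1..n}. U i w) = PiM {1..n} (\<lambda>i. distr M borel (U i))"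
      using M.indep_vars_iff_distr_eq_PiM'[of "{1..n}" U "\<lambda>_. borel", OF _ Ub] indep by blast
    also have "\<dots> = PiM {1..n} (\<lambda>_. \<mu>)" by (rule PiM_cong[OF refl U])
    finally show ?thesis .
  qed
  have F': "?F \<in> borel_measurable (PiM {1..n} (\<lambda>_. borel))"
    using F measurable_cong_sets[OF sets_PiM_cong[OF refl \<mu>(2)] refl] by blast
  have "(\<integral>\<^sup>+w. ?F (\<lambda>i. U i w) \<partial>M) = (\<integral>\<^sup>+w. ?F (\<lambda>i\<in>{1..n}. U i w) \<partial>M)"
    by (intro nn_integral_cong arg_cong[where f = "emeasure \<mu>"] pos_span_cong) simp
  also have "\<dots> = (\<integral>\<^sup>+v. ?F v \<partial>PiM {1..n} (\<lambda>_. \<mu>))"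
  proof -
    have "(\<lambda>w. \<lambda>i\<in>{1..n}. U i w) \<in> measurable M (PiM {1..n} (\<lambda>_. borel))"
      by (intro measurable_restrict Ub)
    then show ?thesis unfolding law[symmetric] by (rule nn_integral_distr[symmetric]) (use F' in simp)
  qed
  also have "\<dots> = (\<integral>\<^sup>+v. (\<integral>\<^sup>+x. indicator (pos_span n (v(0 := x))) ((v(0 := x)) 0) \<partial>\<mu>) \<partial>PiM {1..n} (\<lambda>_. \<mu>))"
  proof (rule nn_integral_cong)
    fix v :: "nat \<Rightarrow> 'a"
    have "pos_span n (v(0 := x)) = pos_span n v" for x by (rule pos_span_cong) simp
    then show "?F v = (\<integral>\<^sup>+x. indicator (pos_span n (v(0 := x))) ((v(0 := x)) 0) \<partial>\<mu>)"
      using sets_pos_span[of n v] \<mu>(2) by simp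
  qed
  also have "\<dots> = (\<integral>\<^sup>+v. indicator (pos_span n v) (v 0) \<partial>PiM (insert 0 {1..n}) (\<lambda>_. \<mu>))"
    by (intro product_nn_integral_insert[symmetric] borel_measurable_indicator_pos_span coord) auto
  also have "insert 0 {1..n} = {0..n}" by auto
  finally show ?thesis .
qed

lemma exists_axis_bijection:
  fixes i0 :: "'i::finite"
  assumes "CARD('i) = d + 1"
  obtains b :: "'i \<Rightarrow> nat" where "bij_betw b UNIV {0..d}" "b i0 = 0"
proof -
  obtain h :: "'i \<Rightarrow> nat" where h: "bij_betw h UNIV {0..<CARD('i)}" using ex_bij_betw_finite_nat[of "UNIV :: 'i set"] by auto
  have S: "{0..<CARD('i)} = {0..d}" using assms by auto
  have "bij_betw (Transposition.transpose (h i0) 0) {0..d} {0..d}"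
    using bij_betw_apply[OF h, of i0] S by (intro permutes_imp_bij permutes_swap_id) auto
  then have "bij_betw (Transposition.transpose (h i0) 0 \<circ> h) UNIV {0..d}"
    using h unfolding S by (rule bij_betw_trans[rotated])
  then show thesis by (rule that) simp
qed

lemma nn_integral_pos_span_uniform_half:
  fixes i0 :: "'i::finite"
  assumes card: "CARD('i) = d + 1" and d: "d \<le> Suc n"
  shows "(\<integral>\<^sup>+v. indicator (pos_span n v) (v 0) \<partial>PiM {0..n} (\<lambda>_. uniform_half i0)) = ennreal (absorb_prob n d)"
proof -
  let ?A = "{0..n} \<times> {0..Suc n}"
  obtain b :: "'i \<Rightarrow> nat" where b: "bij_betw b UNIV {0..d}" "b i0 = 0" using exists_axis_bijection[OF card] .
  interpret prob_space "PiM ?A coord" by (rule prob_space_PiM_coord)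
  have sgn_vec: "(\<lambda>g. sgn (vec_of b i g)) \<in> borel_measurable (PiM ?A coord)" for i
    using measurable_comp[OF borel_measurable_vec_of[of coord] borel_measurable_sgn] by (simp add: comp_def)
  have "(\<integral>\<^sup>+v. indicator (pos_span n v) (v 0) \<partial>PiM {0..n} (\<lambda>_. uniform_half i0)) =
      (\<integral>\<^sup>+g. indicator (pos_span n (\<lambda>i\<in>{0..n}. sgn (vec_of b i g))) ((\<lambda>i\<in>{0..n}. sgn (vec_of b i g)) 0) \<partial>PiM ?A coord)"
    unfolding distr_directions[OF b d, of n, symmetric]
    by (intro nn_integral_distr borel_measurable_indicator_pos_span measurable_restrict sgn_vec measurable_coordinate) auto
  also have "\<dots> = (\<integral>\<^sup>+g. indicator {D. feas_zero n d D} (cols g) \<partial>PiM ?A coord)"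
  proof (rule nn_integral_cong_AE)
    have "AE g in PiM ?A coord. g (i, 0) > 0" if "i \<in> {0..n}" for i
      by (rule AE_height_pos) (use that in auto)
    then have "AE g in PiM ?A coord. \<forall>i\<in>{0..n}. g (i, 0) > 0" by (intro AE_finite_allI) auto
    then show "AE g in PiM ?A coord. indicator (pos_span n (\<lambda>i\<in>{0..n}. sgn (vec_of b i g))) ((\<lambda>i\<in>{0..n}. sgn (vec_of b i g)) 0) =
        (indicator {D. feas_zero n d D} (cols g) :: ennreal)"
    proof eventually_elim
      case (elim g)
      have nz: "norm (vec_of b i g) > 0" if "i \<in> {0..n}" for i
      proof -
        have "vec_of b i g $ i0 \<noteq> 0" using bspec[OF elim that] b(2) by (simp add: vec_of_def)
        then show ?thesis by auto
      qed
      have "pos_span n (\<lambda>i\<in>{0..n}. sgn (vec_of b i g)) = pos_span n (\<lambda>i. (1 / norm (vec_of b i g)) *\<^sub>R vec_of b i g)"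
        by (rule pos_span_cong) (simp add: sgn_div_norm divide_inverse)
      moreover have "(\<lambda>i\<in>{0..n}. sgn (vec_of b i g)) 0 = (1 / norm (vec_of b 0 g)) *\<^sub>R vec_of b 0 g"
        by (simp add: sgn_div_norm divide_inverse)
      moreover have "(1 / norm (vec_of b 0 g)) *\<^sub>R vec_of b 0 g \<in> pos_span n (\<lambda>i. (1 / norm (vec_of b i g)) *\<^sub>R vec_of b i g) \<longleftrightarrow>
          vec_of b 0 g \<in> pos_span n (\<lambda>i. vec_of b i g)"
        by (rule pos_span_scale) (use nz in auto)
      moreover have "vec_of b 0 g \<in> pos_span n (\<lambda>i. vec_of b i g) \<longleftrightarrow> feas_zero n d (cols g)"
        by (rule vec_of_in_pos_span_iff) (use b elim in \<open>auto simp: bij_betw_def\<close>)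
      ultimately show ?case by (simp add: indicator_def)
    qed
  qed
  also have "\<dots> = emeasure (PiM ?A coord) {g \<in> space (PiM ?A coord). feas_zero n d (cols g)}"
    by (rule emeasure_cols_Collect[OF borel_feas_zero, symmetric])
  also have "\<dots> = ennreal (absorb_prob n d)"
    unfolding absorb_prob_def event_prob_def by (rule emeasure_eq_measure)
  finally show ?thesis .
qed

text \<open>A nonnegative combination of points of the half-space stays in it; this reconciles the
  solid angle with the measure inside the half-sphere.\<close>

lemma pos_span_Int_sphere:
  assumes "\<And>i. i \<in> {1..n} \<Longrightarrow> u i \<in> half_sphere i0"
  shows "pos_span n u \<inter> sphere 0 1 = pos_span n u \<inter> half_sphere i0"
  using assms by (auto simp: pos_span_def half_sphere_def intro!: sum_nonneg)

theorem theorem2p5: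
  fixes M :: "'w measure"
    and U :: "nat \<Rightarrow> 'w \<Rightarrow> real ^ 'i::finite"
    and i0 :: 'i
    and d n :: nat
  assumes "d \<ge> 1"
    and "CARD('i) = d + 1"
    and "n \<ge> d + 1"
    and "prob_space M"
    and "prob_space.indep_vars M (\<lambda>_. borel) U {1..n}"
    and "\<And>i. i \<in> {1..n} \<Longrightarrow> distr M borel (U i) = uniform_measure sphere_measure (half_sphere i0)"
  shows "(\<integral>w. solid_angle (pos_span n (\<lambda>i. U i w)) \<partial>M) =
           (\<integral>w. measure sphere_measure (pos_span n (\<lambda>i. U i w) \<inter> half_sphere i0) \<partial>M) / omega (d + 1)
       \<and> (\<integral>w. measure sphere_measure (pos_span n (\<lambda>i. U i w) \<inter> half_sphere i0) \<partial>M) / omega (d + 1) =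
           fact n / (2 * pi ^ n) *
           (\<Sum>m | m \<in> {d + 2..n + 1} \<and> m mod 2 = d mod 2.
              B_num (n + 1) m * (real m - 1)\<^sup>2 * A_num (m - 2) (- 1))"
proof -
  interpret M: prob_space M by fact
  let ?\<sigma> = "sphere_measure :: (real ^ 'i) measure"
  let ?P = "\<lambda>w. pos_span n (\<lambda>i. U i w)"
  interpret \<sigma>: finite_measure ?\<sigma> by (rule finite_measure_sphere_measure)
  have U: "U i \<in> borel_measurable M" if "i \<in> {1..n}" for i
    using assms(5) that by (auto simp: M.indep_vars_def)
  have meas: "(\<lambda>w. measure ?\<sigma> (?P w \<inter> B)) \<in> borel_measurable M" if "B \<in> sets borel" for B
    unfolding measure_def
    by (intro borel_measurable_enn2real measurable_emeasure_pos_span U \<sigma>.sigma_finite_measure_axioms that) auto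
  have \<omega>: "measure ?\<sigma> (sphere 0 1) = omega (d + 1)"
    using assms(2) by (simp add: measure_sphere_measure_sphere)
  have "AE w in M. \<forall>i\<in>{1..n}. U i w \<in> half_sphere i0"
  proof (rule AE_finite_allI)
    fix i assume i: "i \<in> {1..n}"
    have "AE x in uniform_half i0. x \<in> half_sphere i0" by (rule AE_uniform_measureI) auto
    then have "AE x in distr M borel (U i). x \<in> half_sphere i0" by (simp only: assms(6)[OF i])
    then show "AE w in M. U i w \<in> half_sphere i0" by (rule AE_distrD[OF U[OF i]])
  qed simp
  then have "AE w in M. measure ?\<sigma> (?P w \<inter> sphere 0 1) = measure ?\<sigma> (?P w \<inter> half_sphere i0)"
    by eventually_elim (subst pos_span_Int_sphere, auto)
  then have 1: "(\<integral>w. solid_angle (?P w) \<partial>M) = (\<integral>w. measure ?\<sigma> (?P w \<inter> half_sphere i0) \<partial>M) / omega (d + 1)"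
    unfolding solid_angle_def \<omega> by (simp add: integral_cong_AE[OF meas meas])
  have "(\<integral>w. measure (uniform_half i0) (?P w) \<partial>M) = enn2real (\<integral>\<^sup>+w. emeasure (uniform_half i0) (?P w) \<partial>M)"
  proof -
    interpret \<mu>: prob_space "uniform_half i0" by (rule prob_space_uniform_half)
    have "(\<lambda>w. measure (uniform_half i0) (?P w)) \<in> borel_measurable M"
      using measurable_emeasure_pos_span[of n U M, OF U \<mu>.sigma_finite_measure_axioms, of UNIV]
      unfolding measure_def by (intro borel_measurable_enn2real) simp
    then show ?thesis by (subst integral_eq_nn_integral) (simp_all add: \<mu>.emeasure_eq_measure)
  qed
  also have "\<dots> = absorb_prob n d"
    using assms nn_integral_emeasure_pos_span[OF assms(4,5) _ prob_space_uniform_half[of i0]]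
    by (simp add: nn_integral_pos_span_uniform_half[OF assms(2)] absorb_prob_def event_prob_def)
  finally have "(\<integral>w. measure (uniform_half i0) (?P w) \<partial>M) = absorb_prob n d" .
  \<comment> \<open>The uniform law divides by the measure of the half-sphere, which is half of
    \<open>omega (d + 1)\<close>: this is the factor 1/2 of the final formula.\<close>
  moreover have "measure (uniform_half i0) (?P w) = measure ?\<sigma> (?P w \<inter> half_sphere i0) / (omega (d + 1) / 2)" for w
    using sphere_measure_half_sphere[of i0] sets_pos_span
    by (subst measure_uniform_measure) (auto simp: measure_half_sphere \<omega> Int_commute)
  ultimately have "(\<integral>w. measure ?\<sigma> (?P w \<inter> half_sphere i0) \<partial>M) / omega (d + 1) = absorb_prob n d / 2"
    by simp
  then show ?thesis using 1 absorb_prob_formula[of n d] by simp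
qed

end
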